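(* Let $(M^6,J,g)$ be a strictly nearly Kähler manifold (of real dimension $6$). Then the Ricci curvature of the canonical connection vanishes: $R_{i\bar j}=0$ for all $i$ and $j$ in $\{1,2,3\}$, with respect to any local unitary $(1,0)$-frame.
   Context: An almost Hermitian manifold $(M,J,g)$ is a manifold $M$ of real dimension $2n$ with an almost complex structure $J$ and a Riemannian metric $g$ satisfying $g(JX,JY)=g(X,Y)$ for all tangent vectors $X,Y$. It is nearly Kähler if $(D_XJ)X=0$ for every tangent vector field $X$, where $D$ is the Levi-Civita connection; it is Kähler if $J$ is integrable and the form $\omega_g(X,Y)=g(JX,Y)$ is closed; a strictly nearly Kähler manifold is a nearly Kähler manifold that is not Kähler. Write $\langle\cdot,\cdot\rangle$ for the complex bilinear extension of $g$ to $TM\otimes\mathbb C$. The torsion of a connection $\nabla$ is $\tau(X,Y)=\nabla_XY-\nabla_YX-[X,Y]$. The canonical connection $\nabla$ is the unique connection with $\nabla g=0$, $\nabla J=0$ and $\tau(X,\overline Y)=0$ for all $(1,0)$-vectors $X,Y$ (tensors and connections are extended complex linearly). Curvature of the canonical connection: $R(X,Y)Z=\nabla_X\nabla_YZ-\nabla_Y\nabla_XZ-\nabla_{[X,Y]}Z$ and $R(X,Y,Z,W)=\langle R(Z,W)X,Y\rangle$. For a local unitary $(1,0)$-frame $(e_1,\dots,e_n)$ (i.e. a local frame of $T^{1,0}M$ with $\langle e_i,\overline{e_j}\rangle=\delta_{ij}$), put $e_{\bar i}=\overline{e_i}$ and $R_{ABCD}=R(e_A,e_B,e_C,e_D)$ for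 indices $A,B,C,D\in\{1,\bar 1,\dots,n,\bar n\}$. The first and second Ricci curvatures are $R'_{i\bar j}=\sum_{\lambda=1}^nR_{\lambda\bar\lambda i\bar j}$ and $R''_{i\bar j}=\sum_{\lambda=1}^nR_{i\bar j\lambda\bar\lambda}$. On a nearly Kähler manifold these coincide, and their common value, denoted $R_{i\bar j}$, is called the Ricci curvature of the canonical connection.
   Formalization: The manifold M is assumed connected; otherwise the claim fails, e.g. for the disjoint union of CP^3 with its Kähler metric and the nearly Kähler S^6, which is nearly Kähler and not Kähler but has nonzero Ricci curvature on CP^3. *)

theory Defs
  imports "HOL-Analysis.Analysis" "HOL-Library.Function_Algebras"
begin

section \<open>Smooth manifolds\<close>

(* On an open subset of a Euclidean space: f is of class C^infinity iff all its iterated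
   directional derivatives exist and are (Frechet) differentiable. *)

primrec Ck_on :: "nat \<Rightarrow> ('a::real_normed_vector) set \<Rightarrow> ('a \<Rightarrow> 'b::real_normed_vector) \<Rightarrow> bool" where
  "Ck_on 0 S f \<longleftrightarrow> continuous_on S f"
| "Ck_on (Suc k) S f \<longleftrightarrow> (\<forall>x\<in>S. f differentiable (at x)) \<and>
     (\<forall>v. Ck_on k S (\<lambda>x. frechet_derivative f (at x) v))"

definition smooth_on :: "('a::real_normed_vector) set \<Rightarrow> ('a \<Rightarrow> 'b::real_normed_vector) \<Rightarrow> bool" where
  "smooth_on S f \<longleftrightarrow> (\<forall>k. Ck_on k S f)"

(* A chart is a pair of a domain and a coordinate map; the values of the coordinate map
   outside the domain are irrelevant. The manifold is the whole type 'm, so its Hausdorff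
   and countability properties are expressed by type classes. *)

type_synonym ('m, 'n) chart = "'m set \<times> ('m \<Rightarrow> real ^ 'n)"

abbreviation dom_of :: "('m, 'n::finite) chart \<Rightarrow> 'm set" where
  "dom_of c \<equiv> fst c"

abbreviation coord :: "('m, 'n::finite) chart \<Rightarrow> 'm \<Rightarrow> real ^ 'n" where
  "coord c \<equiv> snd c"

definition chart_inv :: "('m, 'n::finite) chart \<Rightarrow> real ^ 'n \<Rightarrow> 'm" where
  "chart_inv c = inv_into (dom_of c) (coord c)"

definition is_chart :: "('m::topological_space, 'n::finite) chart \<Rightarrow> bool" where
  "is_chart c \<longleftrightarrow> open (dom_of c) \<and> open (coord c ` dom_of c) \<and>
     homeomorphism (dom_of c) (coord c ` dom_of c) (coord c) (chart_inv c)"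

definition transition :: "('m, 'n::finite) chart \<Rightarrow> ('m, 'n) chart \<Rightarrow> real ^ 'n \<Rightarrow> real ^ 'n" where
  "transition c c' = coord c' \<circ> chart_inv c"

definition smooth_atlas :: "('m::topological_space, 'n::finite) chart set \<Rightarrow> bool" where
  "smooth_atlas A \<longleftrightarrow> (\<forall>c\<in>A. is_chart c) \<and> (\<Union>c\<in>A. dom_of c) = UNIV \<and>
     (\<forall>c\<in>A. \<forall>c'\<in>A. smooth_on (coord c ` (dom_of c \<inter> dom_of c')) (transition c c'))"

definition smooth_fun :: "('m, 'n::finite) chart set \<Rightarrow> 'm set \<Rightarrow> ('m \<Rightarrow> real) \<Rightarrow> bool" where
  "smooth_fun A U f \<longleftrightarrow> (\<forall>c\<in>A. smooth_on (coord c ` (dom_of c \<inter> U)) (f \<circ> chart_inv c))"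


section \<open>Tangent vectors and vector fields\<close>

(* A tangent vector at p is the family of its coordinate vectors in all the charts around p,
   related by the derivatives of the transition maps. The entries at the remaining charts
   carry no information and are set to 0, so that equality of families is equality of
   tangent vectors. Vectors are added pointwise (Function_Algebras). *)

type_synonym ('m, 'n) tvec = "('m, 'n) chart \<Rightarrow> real ^ 'n"
type_synonym ('m, 'n) field = "'m \<Rightarrow> ('m, 'n) tvec"

definition tangent :: "('m, 'n::finite) chart set \<Rightarrow> 'm \<Rightarrow> ('m, 'n) tvec set" where
  "tangent A p = {v. (\<forall>c. \<not> (c \<in> A \<and> p \<in> dom_of c) \<longrightarrow> v c = 0) \<and>
     (\<forall>c\<in>A. \<forall>c'\<in>A. p \<in> dom_of c \<inter> dom_of c' \<longrightarrow>
        v c' = frechet_derivative (transition c c') (at (coord c p)) (v c))}"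

definition tscale :: "real \<Rightarrow> ('m, 'n::finite) tvec \<Rightarrow> ('m, 'n) tvec" where
  "tscale a v = (\<lambda>c. a *\<^sub>R v c)"

definition field_rep :: "('m, 'n::finite) chart \<Rightarrow> ('m, 'n) field \<Rightarrow> real ^ 'n \<Rightarrow> real ^ 'n" where
  "field_rep c X = (\<lambda>x. X (chart_inv c x) c)"

(* Smooth vector fields on U; the values outside U are irrelevant. *)
definition vfield :: "('m, 'n::finite) chart set \<Rightarrow> 'm set \<Rightarrow> ('m, 'n) field \<Rightarrow> bool" where
  "vfield A U X \<longleftrightarrow> (\<forall>p\<in>U. X p \<in> tangent A p) \<and>
     (\<forall>c\<in>A. smooth_on (coord c ` (dom_of c \<inter> U)) (field_rep c X))"

(* The derivative v(f) of a function f along a tangent vector v at p; it does not depend on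
   the chart around p used to compute it. *)
definition dirderiv :: "('m, 'n::finite) chart set \<Rightarrow> 'm \<Rightarrow> ('m, 'n) tvec \<Rightarrow> ('m \<Rightarrow> real) \<Rightarrow> real" where
  "dirderiv A p v f = (let c = (SOME c. c \<in> A \<and> p \<in> dom_of c)
     in frechet_derivative (f \<circ> chart_inv c) (at (coord c p)) (v c))"

definition lie_bracket ::
  "('m, 'n::finite) chart set \<Rightarrow> ('m, 'n) field \<Rightarrow> ('m, 'n) field \<Rightarrow> ('m, 'n) field" where
  "lie_bracket A X Y = (\<lambda>p c. if c \<in> A \<and> p \<in> dom_of c
     then frechet_derivative (field_rep c Y) (at (coord c p)) (X p c)
        - frechet_derivative (field_rep c X) (at (coord c p)) (Y p c)
     else 0)"


section \<open>Almost Hermitian structures\<close>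

type_synonym ('m, 'n) endo = "'m \<Rightarrow> ('m, 'n) tvec \<Rightarrow> ('m, 'n) tvec"
type_synonym ('m, 'n) form2 = "'m \<Rightarrow> ('m, 'n) tvec \<Rightarrow> ('m, 'n) tvec \<Rightarrow> real"

definition app :: "('m, 'n::finite) endo \<Rightarrow> ('m, 'n) field \<Rightarrow> ('m, 'n) field" where
  "app J X = (\<lambda>p. J p (X p))"

definition almost_complex :: "('m::topological_space, 'n::finite) chart set \<Rightarrow> ('m, 'n) endo \<Rightarrow> bool" where
  "almost_complex A J \<longleftrightarrow>
     (\<forall>p. \<forall>v\<in>tangent A p. J p v \<in> tangent A p \<and> J p (J p v) = - v) \<and>
     (\<forall>p. \<forall>u\<in>tangent A p. \<forall>v\<in>tangent A p. J p (u + v) = J p u + J p v) \<and>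
     (\<forall>p a. \<forall>v\<in>tangent A p. J p (tscale a v) = tscale a (J p v)) \<and>
     (\<forall>U X. open U \<longrightarrow> vfield A U X \<longrightarrow> vfield A U (app J X))"

definition riemannian_metric :: "('m::topological_space, 'n::finite) chart set \<Rightarrow> ('m, 'n) form2 \<Rightarrow> bool" where
  "riemannian_metric A g \<longleftrightarrow>
     (\<forall>p. \<forall>u\<in>tangent A p. \<forall>v\<in>tangent A p. g p u v = g p v u) \<and>
     (\<forall>p. \<forall>u\<in>tangent A p. \<forall>v\<in>tangent A p. \<forall>w\<in>tangent A p. g p (u + v) w = g p u w + g p v w) \<and>
     (\<forall>p a. \<forall>u\<in>tangent A p. \<forall>v\<in>tangent A p. g p (tscale a u) v = a * g p u v) \<and>
     (\<forall>p. \<forall>v\<in>tangent A p. v \<noteq> 0 \<longrightarrow> g p v v > 0) \<and>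
     (\<forall>U X Y. open U \<longrightarrow> vfield A U X \<longrightarrow> vfield A U Y \<longrightarrow> smooth_fun A U (\<lambda>p. g p (X p) (Y p)))"

definition almost_hermitian ::
  "('m::topological_space, 'n::finite) chart set \<Rightarrow> ('m, 'n) endo \<Rightarrow> ('m, 'n) form2 \<Rightarrow> bool" where
  "almost_hermitian A J g \<longleftrightarrow> smooth_atlas A \<and> almost_complex A J \<and> riemannian_metric A g \<and>
     (\<forall>p. \<forall>u\<in>tangent A p. \<forall>v\<in>tangent A p. g p (J p u) (J p v) = g p u v)"


section \<open>Connections\<close>

(* "nab p v Y" is the covariant derivative at p of the vector field Y, defined near p, in the
   direction of the tangent vector v at p; it depends only on the germ of Y at p. *)

type_synonym ('m, 'n) conn = "'m \<Rightarrow> ('m, 'n) tvec \<Rightarrow> ('m, 'n) field \<Rightarrow> ('m, 'n) tvec"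

definition covd :: "('m, 'n::finite) conn \<Rightarrow> ('m, 'n) field \<Rightarrow> ('m, 'n) field \<Rightarrow> ('m, 'n) field" where
  "covd nab X Y = (\<lambda>p. nab p (X p) Y)"

definition affine_connection :: "('m::topological_space, 'n::finite) chart set \<Rightarrow> ('m, 'n) conn \<Rightarrow> bool" where
  "affine_connection A nab \<longleftrightarrow>
     (\<forall>U p v Y. open U \<longrightarrow> p \<in> U \<longrightarrow> v \<in> tangent A p \<longrightarrow> vfield A U Y \<longrightarrow> nab p v Y \<in> tangent A p) \<and>
     (\<forall>U p u v Y. open U \<longrightarrow> p \<in> U \<longrightarrow> u \<in> tangent A p \<longrightarrow> v \<in> tangent A p \<longrightarrow> vfield A U Y \<longrightarrow>
        nab p (u + v) Y = nab p u Y + nab p v Y) \<and>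
     (\<forall>U p a v Y. open U \<longrightarrow> p \<in> U \<longrightarrow> v \<in> tangent A p \<longrightarrow> vfield A U Y \<longrightarrow>
        nab p (tscale a v) Y = tscale a (nab p v Y)) \<and>
     (\<forall>U p v Y Y'. open U \<longrightarrow> p \<in> U \<longrightarrow> v \<in> tangent A p \<longrightarrow> vfield A U Y \<longrightarrow> vfield A U Y' \<longrightarrow>
        (\<forall>q\<in>U. Y q = Y' q) \<longrightarrow> nab p v Y = nab p v Y') \<and>
     (\<forall>U p v Y Y'. open U \<longrightarrow> p \<in> U \<longrightarrow> v \<in> tangent A p \<longrightarrow> vfield A U Y \<longrightarrow> vfield A U Y' \<longrightarrow>
        nab p v (Y + Y') = nab p v Y + nab p v Y') \<and>
     (\<forall>U p v f Y. open U \<longrightarrow> p \<in> U \<longrightarrow> v \<in> tangent A p \<longrightarrow> smooth_fun A U f \<longrightarrow> vfield A U Y \<longrightarrow>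
        nab p v (\<lambda>q. tscale (f q) (Y q)) = tscale (dirderiv A p v f) (Y p) + tscale (f p) (nab p v Y)) \<and>
     (\<forall>U X Y. open U \<longrightarrow> vfield A U X \<longrightarrow> vfield A U Y \<longrightarrow> vfield A U (covd nab X Y))"

definition metric_connection ::
  "('m::topological_space, 'n::finite) chart set \<Rightarrow> ('m, 'n) form2 \<Rightarrow> ('m, 'n) conn \<Rightarrow> bool" where
  "metric_connection A g nab \<longleftrightarrow>
     (\<forall>U X Y Z. open U \<longrightarrow> vfield A U X \<longrightarrow> vfield A U Y \<longrightarrow> vfield A U Z \<longrightarrow>
        (\<forall>p\<in>U. dirderiv A p (X p) (\<lambda>q. g q (Y q) (Z q)) =
               g p (covd nab X Y p) (Z p) + g p (Y p) (covd nab X Z p)))"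

definition torsion ::
  "('m, 'n::finite) chart set \<Rightarrow> ('m, 'n) conn \<Rightarrow> ('m, 'n) field \<Rightarrow> ('m, 'n) field \<Rightarrow> ('m, 'n) field" where
  "torsion A nab X Y = covd nab X Y - covd nab Y X - lie_bracket A X Y"

definition levi_civita ::
  "('m::topological_space, 'n::finite) chart set \<Rightarrow> ('m, 'n) form2 \<Rightarrow> ('m, 'n) conn \<Rightarrow> bool" where
  "levi_civita A g D \<longleftrightarrow> affine_connection A D \<and> metric_connection A g D \<and>
     (\<forall>U X Y. open U \<longrightarrow> vfield A U X \<longrightarrow> vfield A U Y \<longrightarrow> (\<forall>p\<in>U. torsion A D X Y p = 0))"

(* (nabla_X J) Y *)
definition cov_endo :: "('m, 'n::finite) conn \<Rightarrow> ('m, 'n) endo \<Rightarrow> ('m, 'n) field \<Rightarrow> ('m, 'n) field \<Rightarrow> ('m, 'n) field" where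
  "cov_endo nab J X Y = covd nab X (app J Y) - app J (covd nab X Y)"


section \<open>Kaehler and nearly Kaehler manifolds\<close>

definition nijenhuis ::
  "('m, 'n::finite) chart set \<Rightarrow> ('m, 'n) endo \<Rightarrow> ('m, 'n) field \<Rightarrow> ('m, 'n) field \<Rightarrow> ('m, 'n) field" where
  "nijenhuis A J X Y = lie_bracket A (app J X) (app J Y) - app J (lie_bracket A (app J X) Y)
     - app J (lie_bracket A X (app J Y)) - lie_bracket A X Y"

(* Integrability of J in the sense that its Nijenhuis tensor vanishes. *)
definition integrable_acs :: "('m::topological_space, 'n::finite) chart set \<Rightarrow> ('m, 'n) endo \<Rightarrow> bool" where
  "integrable_acs A J \<longleftrightarrow>
     (\<forall>U X Y. open U \<longrightarrow> vfield A U X \<longrightarrow> vfield A U Y \<longrightarrow> (\<forall>p\<in>U. nijenhuis A J X Y p = 0))"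

definition fundamental_form :: "('m, 'n::finite) endo \<Rightarrow> ('m, 'n) form2 \<Rightarrow> ('m, 'n) form2" where
  "fundamental_form J g p u v = g p (J p u) v"

(* The exterior derivative of a 2-form w, by the invariant formula (up to a normalizing factor
   that is immaterial for closedness). *)
definition ext_deriv2 ::
  "('m, 'n::finite) chart set \<Rightarrow> ('m, 'n) form2 \<Rightarrow> ('m, 'n) field \<Rightarrow> ('m, 'n) field \<Rightarrow> ('m, 'n) field \<Rightarrow> 'm \<Rightarrow> real" where
  "ext_deriv2 A w X Y Z p =
       dirderiv A p (X p) (\<lambda>q. w q (Y q) (Z q))
     + dirderiv A p (Y p) (\<lambda>q. w q (Z q) (X q))
     + dirderiv A p (Z p) (\<lambda>q. w q (X q) (Y q))
     - w p (lie_bracket A X Y p) (Z p)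
     - w p (lie_bracket A Y Z p) (X p)
     - w p (lie_bracket A Z X p) (Y p)"

definition closed_form2 :: "('m::topological_space, 'n::finite) chart set \<Rightarrow> ('m, 'n) form2 \<Rightarrow> bool" where
  "closed_form2 A w \<longleftrightarrow>
     (\<forall>U X Y Z. open U \<longrightarrow> vfield A U X \<longrightarrow> vfield A U Y \<longrightarrow> vfield A U Z \<longrightarrow>
        (\<forall>p\<in>U. ext_deriv2 A w X Y Z p = 0))"

definition kaehler ::
  "('m::topological_space, 'n::finite) chart set \<Rightarrow> ('m, 'n) endo \<Rightarrow> ('m, 'n) form2 \<Rightarrow> bool" where
  "kaehler A J g \<longleftrightarrow> almost_hermitian A J g \<and> integrable_acs A J \<and> closed_form2 A (fundamental_form J g)"

(* The Levi-Civita connection exists and is unique as far as its values on tangent vectors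
   and smooth fields are concerned, so quantifying D existentially or universally is the same. *)
definition nearly_kaehler ::
  "('m::topological_space, 'n::finite) chart set \<Rightarrow> ('m, 'n) endo \<Rightarrow> ('m, 'n) form2 \<Rightarrow> bool" where
  "nearly_kaehler A J g \<longleftrightarrow> almost_hermitian A J g \<and>
     (\<exists>D. levi_civita A g D \<and>
        (\<forall>U X. open U \<longrightarrow> vfield A U X \<longrightarrow> (\<forall>p\<in>U. cov_endo D J X X p = 0)))"

definition strictly_nearly_kaehler ::
  "('m::topological_space, 'n::finite) chart set \<Rightarrow> ('m, 'n) endo \<Rightarrow> ('m, 'n) form2 \<Rightarrow> bool" where
  "strictly_nearly_kaehler A J g \<longleftrightarrow> nearly_kaehler A J g \<and> \<not> kaehler A J g"


section \<open>Complexification\<close>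

(* A complex tangent vector u + i v is the family of the complex coordinate vectors
   u c + i v c. Real tensors, the bracket and connections are extended complex linearly
   in each argument. *)

type_synonym ('m, 'n) ctvec = "('m, 'n) chart \<Rightarrow> complex ^ 'n"
type_synonym ('m, 'n) cfield = "'m \<Rightarrow> ('m, 'n) ctvec"

definition tRe :: "('m, 'n::finite) ctvec \<Rightarrow> ('m, 'n) tvec" where
  "tRe z = (\<lambda>c. \<chi> k. Re (z c $ k))"

definition tIm :: "('m, 'n::finite) ctvec \<Rightarrow> ('m, 'n) tvec" where
  "tIm z = (\<lambda>c. \<chi> k. Im (z c $ k))"

definition tComplex :: "('m, 'n::finite) tvec \<Rightarrow> ('m, 'n) tvec \<Rightarrow> ('m, 'n) ctvec" where
  "tComplex u v = (\<lambda>c. \<chi> k. Complex (u c $ k) (v c $ k))"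

definition ctscale :: "complex \<Rightarrow> ('m, 'n::finite) ctvec \<Rightarrow> ('m, 'n) ctvec" where
  "ctscale a z = (\<lambda>c. a *s z c)"

definition tcnj :: "('m, 'n::finite) ctvec \<Rightarrow> ('m, 'n) ctvec" where
  "tcnj z = (\<lambda>c. \<chi> k. cnj (z c $ k))"

definition fRe :: "('m, 'n::finite) cfield \<Rightarrow> ('m, 'n) field" where
  "fRe X = (\<lambda>p. tRe (X p))"

definition fIm :: "('m, 'n::finite) cfield \<Rightarrow> ('m, 'n) field" where
  "fIm X = (\<lambda>p. tIm (X p))"

definition fComplex :: "('m, 'n::finite) field \<Rightarrow> ('m, 'n) field \<Rightarrow> ('m, 'n) cfield" where
  "fComplex X Y = (\<lambda>p. tComplex (X p) (Y p))"

definition fcnj :: "('m, 'n::finite) cfield \<Rightarrow> ('m, 'n) cfield" where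
  "fcnj X = (\<lambda>p. tcnj (X p))"

definition ctangent :: "('m, 'n::finite) chart set \<Rightarrow> 'm \<Rightarrow> ('m, 'n) ctvec set" where
  "ctangent A p = {z. tRe z \<in> tangent A p \<and> tIm z \<in> tangent A p}"

definition cvfield :: "('m, 'n::finite) chart set \<Rightarrow> 'm set \<Rightarrow> ('m, 'n) cfield \<Rightarrow> bool" where
  "cvfield A U X \<longleftrightarrow> vfield A U (fRe X) \<and> vfield A U (fIm X)"

definition cendo :: "('m, 'n::finite) endo \<Rightarrow> 'm \<Rightarrow> ('m, 'n) ctvec \<Rightarrow> ('m, 'n) ctvec" where
  "cendo J p z = tComplex (J p (tRe z)) (J p (tIm z))"

definition cmetric :: "('m, 'n::finite) form2 \<Rightarrow> 'm \<Rightarrow> ('m, 'n) ctvec \<Rightarrow> ('m, 'n) ctvec \<Rightarrow> complex" where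
  "cmetric g p z w = Complex (g p (tRe z) (tRe w) - g p (tIm z) (tIm w))
                             (g p (tRe z) (tIm w) + g p (tIm z) (tRe w))"

definition bilinear_ext ::
  "(('m, 'n::finite) field \<Rightarrow> ('m, 'n) field \<Rightarrow> ('m, 'n) field) \<Rightarrow> ('m, 'n) cfield \<Rightarrow> ('m, 'n) cfield \<Rightarrow> ('m, 'n) cfield" where
  "bilinear_ext B X Y = fComplex (B (fRe X) (fRe Y) - B (fIm X) (fIm Y))
                                 (B (fRe X) (fIm Y) + B (fIm X) (fRe Y))"

definition ccovd :: "('m, 'n::finite) conn \<Rightarrow> ('m, 'n) cfield \<Rightarrow> ('m, 'n) cfield \<Rightarrow> ('m, 'n) cfield" where
  "ccovd nab = bilinear_ext (covd nab)"

definition clie_bracket ::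
  "('m, 'n::finite) chart set \<Rightarrow> ('m, 'n) cfield \<Rightarrow> ('m, 'n) cfield \<Rightarrow> ('m, 'n) cfield" where
  "clie_bracket A = bilinear_ext (lie_bracket A)"

definition ctorsion ::
  "('m, 'n::finite) chart set \<Rightarrow> ('m, 'n) conn \<Rightarrow> ('m, 'n) cfield \<Rightarrow> ('m, 'n) cfield \<Rightarrow> ('m, 'n) cfield" where
  "ctorsion A nab = bilinear_ext (torsion A nab)"

definition T10 :: "('m, 'n::finite) chart set \<Rightarrow> ('m, 'n) endo \<Rightarrow> 'm \<Rightarrow> ('m, 'n) ctvec set" where
  "T10 A J p = {z \<in> ctangent A p. cendo J p z = ctscale \<i> z}"

definition field10 ::
  "('m, 'n::finite) chart set \<Rightarrow> ('m, 'n) endo \<Rightarrow> 'm set \<Rightarrow> ('m, 'n) cfield \<Rightarrow> bool" where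
  "field10 A J U X \<longleftrightarrow> cvfield A U X \<and> (\<forall>p\<in>U. X p \<in> T10 A J p)"


section \<open>The canonical connection and its Ricci curvatures\<close>

definition canonical_connection ::
  "('m::topological_space, 'n::finite) chart set \<Rightarrow> ('m, 'n) endo \<Rightarrow> ('m, 'n) form2 \<Rightarrow> ('m, 'n) conn \<Rightarrow> bool" where
  "canonical_connection A J g nab \<longleftrightarrow> affine_connection A nab \<and> metric_connection A g nab \<and>
     (\<forall>U X Y. open U \<longrightarrow> vfield A U X \<longrightarrow> vfield A U Y \<longrightarrow> (\<forall>p\<in>U. cov_endo nab J X Y p = 0)) \<and>
     (\<forall>U X Y. open U \<longrightarrow> field10 A J U X \<longrightarrow> field10 A J U Y \<longrightarrow>
        (\<forall>p\<in>U. ctorsion A nab X (fcnj Y) p = 0))"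

definition curvature ::
  "('m, 'n::finite) chart set \<Rightarrow> ('m, 'n) conn \<Rightarrow>
   ('m, 'n) cfield \<Rightarrow> ('m, 'n) cfield \<Rightarrow> ('m, 'n) cfield \<Rightarrow> ('m, 'n) cfield" where
  "curvature A nab X Y Z =
     ccovd nab X (ccovd nab Y Z) - ccovd nab Y (ccovd nab X Z) - ccovd nab (clie_bracket A X Y) Z"

definition curvature4 ::
  "('m, 'n::finite) chart set \<Rightarrow> ('m, 'n) form2 \<Rightarrow> ('m, 'n) conn \<Rightarrow>
   ('m, 'n) cfield \<Rightarrow> ('m, 'n) cfield \<Rightarrow> ('m, 'n) cfield \<Rightarrow> ('m, 'n) cfield \<Rightarrow> 'm \<Rightarrow> complex" where
  "curvature4 A g nab X Y Z W p = cmetric g p (curvature A nab Z W X p) (Y p)"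

(* Local unitary (1,0)-frame on U: at each point of U the vectors form a basis of T^{1,0}. *)
definition unitary_frame ::
  "('m, 'n::finite) chart set \<Rightarrow> ('m, 'n) endo \<Rightarrow> ('m, 'n) form2 \<Rightarrow> 'm set \<Rightarrow>
   ('k::finite \<Rightarrow> ('m, 'n) cfield) \<Rightarrow> bool" where
  "unitary_frame A J g U e \<longleftrightarrow> (\<forall>i. field10 A J U (e i)) \<and>
     (\<forall>p\<in>U. \<forall>z\<in>T10 A J p. \<exists>!a. z = (\<Sum>i\<in>UNIV. ctscale (a i) (e i p))) \<and>
     (\<forall>p\<in>U. \<forall>i j. cmetric g p (e i p) (fcnj (e j) p) = (if i = j then 1 else 0))"

definition ricci1 ::
  "('m, 'n::finite) chart set \<Rightarrow> ('m, 'n) form2 \<Rightarrow> ('m, 'n) conn \<Rightarrow>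
   ('k::finite \<Rightarrow> ('m, 'n) cfield) \<Rightarrow> 'k \<Rightarrow> 'k \<Rightarrow> 'm \<Rightarrow> complex" where
  "ricci1 A g nab e i j p =
     (\<Sum>l\<in>UNIV. curvature4 A g nab (e l) (fcnj (e l)) (e i) (fcnj (e j)) p)"

definition ricci2 ::
  "('m, 'n::finite) chart set \<Rightarrow> ('m, 'n) form2 \<Rightarrow> ('m, 'n) conn \<Rightarrow>
   ('k::finite \<Rightarrow> ('m, 'n) cfield) \<Rightarrow> 'k \<Rightarrow> 'k \<Rightarrow> 'm \<Rightarrow> complex" where
  "ricci2 A g nab e i j p =
     (\<Sum>l\<in>UNIV. curvature4 A g nab (e i) (fcnj (e j)) (e l) (fcnj (e l)) p)"

end

theory Submission
  imports Defs
begin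

text \<open>
  Let \<open>T\<close> be the torsion of the canonical connection. The nearly Kaehler condition and the
  vanishing of \<open>T\<close> on pairs of vectors of opposite type force the difference of the canonical
  and the Levi-Civita connection to be totally skew and to anticommute with \<open>J\<close>, so \<open>T\<close> is a
  3-form of type (3,0) + (0,3). Splitting the first Bianchi identity by type shows that \<open>T\<close> is
  parallel; what remains of the identity then gives the pair symmetry of the curvature, so that
  the two Ricci curvatures agree. Since \<open>T\<close> is parallel, the curvature annihilates its (3,0)-part,
  which in complex dimension 3 is a multiple of a volume form of the bundle of (1,0)-vectors;
  hence the product of this multiple with the trace of the curvature vanishes. If \<open>T\<close> vanished
  at one point it would vanish everywhere, because it is parallel and the manifold is connected,
  and the manifold would be Kaehler.
\<close>

section \<open>Calculus on open subsets of Euclidean space\<close>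

text \<open>The splitting by type is done in real terms. A statement on (1,0)- or (0,1)-vectors
  becomes the real identity obtained on inserting X - iJX or X + iJX and collecting real parts;
  imaginary parts follow on replacing one argument by its image under J. Complex fields return only
  when the Ricci sums are expanded in a unitary frame.

  Identities are proved for vector fields, since connections and brackets act on fields. Of the
  tensors built from the connections, only the torsion 3-form is ever evaluated through the values
  of its arguments at a point, and its symmetries permit this: each argument can be rotated into the
  slot that the metric pairs pointwise.

  The factor in front of the volume form has two real components, either of which may vanish at a
  point, so each gets its own equation against the trace. The failure of the Kaehler condition is
  global, whereas the division by this factor happens at one point; hence zeros of the torsion have
  to spread. A Gronwall estimate along segments in a chart takes the place of parallel
  transport.\<close>

lemma has_derivative_cong_open:
  assumes "open S" "x \<in> S" "\<And>y. y \<in> S \<Longrightarrow> f y = g y"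
  shows "(f has_derivative F) (at x) \<longleftrightarrow> (g has_derivative F) (at x)"
  using assms has_derivative_transform_within_open by metis

lemma frechet_derivative_cong_open:
  assumes "open S" "x \<in> S" "\<And>y. y \<in> S \<Longrightarrow> f y = g y"
  shows "frechet_derivative f (at x) = frechet_derivative g (at x)"
  unfolding frechet_derivative_def using has_derivative_cong_open[OF assms] by simp

lemma differentiable_cong_open:
  assumes "open S" "x \<in> S" "\<And>y. y \<in> S \<Longrightarrow> f y = g y"
  shows "f differentiable (at x) \<longleftrightarrow> g differentiable (at x)"
  unfolding differentiable_def using has_derivative_cong_open[OF assms] by simp

lemma frechet_derivative_eqI: "(f has_derivative F) (at x) \<Longrightarrow> frechet_derivative f (at x) = F"
  using frechet_derivative_at by metis

lemma has_derivative_frechet: 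
  "f differentiable (at x) \<Longrightarrow> (f has_derivative frechet_derivative f (at x)) (at x)"
  using frechet_derivative_works by blast

lemma Ck_on_cong:
  assumes "open S" "\<And>y. y \<in> S \<Longrightarrow> f y = g y"
  shows "Ck_on k S f \<longleftrightarrow> Ck_on k S g"
  using assms(2)
proof (induction k arbitrary: f g)
  case 0
  then show ?case by (simp cong: continuous_on_cong)
next
  case (Suc k)
  have D: "frechet_derivative f (at x) = frechet_derivative g (at x)" if "x \<in> S" for x
    using assms(1) that Suc.prems by (rule frechet_derivative_cong_open)
  have "Ck_on k S (\<lambda>x. frechet_derivative f (at x) v) \<longleftrightarrow> Ck_on k S (\<lambda>x. frechet_derivative g (at x) v)" for v
    by (rule Suc.IH) (simp add: D)
  moreover have "f differentiable (at x) \<longleftrightarrow> g differentiable (at x)" if "x \<in> S" for x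
    using assms(1) that Suc.prems by (rule differentiable_cong_open)
  ultimately show ?case by simp
qed

lemma Ck_on_subset: "Ck_on k S f \<Longrightarrow> S' \<subseteq> S \<Longrightarrow> Ck_on k S' f"
  by (induction k arbitrary: f) (auto intro: continuous_on_subset)

lemma Ck_on_SucD: "Ck_on (Suc k) S f \<Longrightarrow> Ck_on k S f"
proof (induction k arbitrary: f)
  case 0
  then show ?case by (auto intro: differentiable_imp_continuous_on differentiable_at_imp_differentiable_on)
next
  case (Suc k)
  then show ?case by (metis Ck_on.simps(2))
qed

lemma Ck_on_SucI:
  assumes "open S" "\<And>x. x \<in> S \<Longrightarrow> (f has_derivative F x) (at x)" "\<And>v. Ck_on k S (\<lambda>x. F x v)"
  shows "Ck_on (Suc k) S f"
proof -
  have "Ck_on k S (\<lambda>x. frechet_derivative f (at x) v)" for v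
    using assms(3)[of v]
    by (rule Ck_on_cong[THEN iffD1, OF assms(1), rotated]) (simp add: frechet_derivative_eqI[OF assms(2)])
  then show ?thesis using assms(2) by (auto simp: differentiable_def)
qed

lemma Ck_on_has_derivative:
  assumes "Ck_on (Suc k) S f" "x \<in> S"
  shows "(f has_derivative frechet_derivative f (at x)) (at x)"
  using assms has_derivative_frechet by auto

lemma Ck_on_const: "open S \<Longrightarrow> Ck_on k S (\<lambda>x. c)"
proof (induction k arbitrary: c)
  case (Suc k)
  show ?case by (rule Ck_on_SucI[where F = "\<lambda>x v. 0"]) (use Suc in auto)
qed simp

lemma Ck_on_add:
  assumes "open S" "Ck_on k S f" "Ck_on k S g"
  shows "Ck_on k S (\<lambda>x. f x + g x)"
  using assms(2,3)
proof (induction k arbitrary: f g)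
  case (Suc k)
  show ?case
  proof (rule Ck_on_SucI)
    show "((\<lambda>x. f x + g x) has_derivative
        (\<lambda>v. frechet_derivative f (at x) v + frechet_derivative g (at x) v)) (at x)" if "x \<in> S" for x
      using Suc.prems that by (intro has_derivative_add Ck_on_has_derivative)
  qed (use Suc assms(1) in auto)
qed (simp add: continuous_on_add)

lemma Ck_on_sum:
  assumes "open S" "finite I" "\<And>i. i \<in> I \<Longrightarrow> Ck_on k S (f i)"
  shows "Ck_on k S (\<lambda>x. \<Sum>i\<in>I. f i x)"
  using assms(2,3) by induction (auto simp: assms(1) intro: Ck_on_const Ck_on_add)

lemma Ck_on_bounded_linear:
  assumes "open S" "bounded_linear h" "Ck_on k S f"
  shows "Ck_on k S (\<lambda>x. h (f x))"
  using assms(3)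
proof (induction k arbitrary: f)
  case 0
  then show ?case using assms(2) by (simp add: bounded_linear.continuous_on)
next
  case (Suc k)
  show ?case
  proof (rule Ck_on_SucI)
    show "((\<lambda>x. h (f x)) has_derivative (\<lambda>v. h (frechet_derivative f (at x) v))) (at x)"
      if "x \<in> S" for x
      using Suc.prems that by (intro bounded_linear.has_derivative[OF assms(2)] Ck_on_has_derivative)
  qed (use Suc assms(1) in auto)
qed

lemma Ck_on_scaleR:
  assumes "open S" "Ck_on k S f" "Ck_on k S g"
  shows "Ck_on k S (\<lambda>x. f x *\<^sub>R g x)"
  using assms(2,3)
proof (induction k arbitrary: f g)
  case (Suc k)
  show ?case
  proof (rule Ck_on_SucI)
    show "((\<lambda>x. f x *\<^sub>R g x) has_derivative
        (\<lambda>v. f x *\<^sub>R frechet_derivative g (at x) v + frechet_derivative f (at x) v *\<^sub>R g x)) (at x)" if "x \<in> S" for x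
      using Suc.prems that by (intro has_derivative_scaleR Ck_on_has_derivative)
    show "Ck_on k S (\<lambda>x. f x *\<^sub>R frechet_derivative g (at x) v + frechet_derivative f (at x) v *\<^sub>R g x)" for v
      using Suc.prems assms(1) Ck_on_SucD[OF Suc.prems(1)] Ck_on_SucD[OF Suc.prems(2)]
      by (auto intro!: Ck_on_add Suc.IH)
  qed (use assms(1) in auto)
qed (simp add: continuous_on_scaleR)

lemma linear_frechet_derivative:
  "f differentiable (at x) \<Longrightarrow> linear (frechet_derivative f (at x))"
  using has_derivative_frechet has_derivative_linear by blast

lemma frechet_derivative_basis:
  fixes v :: "'a::euclidean_space"
  assumes "f differentiable (at x)"
  shows "frechet_derivative f (at x) v = (\<Sum>b\<in>Basis. (v \<bullet> b) *\<^sub>R frechet_derivative f (at x) b)"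
proof -
  interpret linear "frechet_derivative f (at x)" by (rule linear_frechet_derivative[OF assms])
  have "frechet_derivative f (at x) v = frechet_derivative f (at x) (\<Sum>b\<in>Basis. (v \<bullet> b) *\<^sub>R b)"
    by (simp add: euclidean_representation)
  then show ?thesis by (simp add: sum scale)
qed

text \<open>The chain rule applies \<open>f'\<close> to a direction that moves with the point, while
  \<open>Ck_on\<close> speaks about fixed directions only. Expanding the moving direction in the
  basis gives sums of products that the induction hypothesis covers.\<close>

lemma Ck_on_compose:
  fixes g :: "'a::real_normed_vector \<Rightarrow> 'b::euclidean_space"
  assumes "open S" "open S'" "g ` S \<subseteq> S'" "Ck_on k S' f" "Ck_on k S g"
  shows "Ck_on k S (\<lambda>x. f (g x))"
  using assms(4,5)
proof (induction k arbitrary: f)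
  case 0
  then show ?case using assms(3) by (auto intro: continuous_on_compose2)
next
  case (Suc k)
  show ?case
  proof (rule Ck_on_SucI)
    fix x assume x: "x \<in> S"
    then have gx: "g x \<in> S'" using assms(3) by auto
    have f: "f differentiable (at (g x))" using Suc.prems gx by simp
    have "((\<lambda>x. f (g x)) has_derivative (\<lambda>v. frechet_derivative f (at (g x)) (frechet_derivative g (at x) v))) (at x)"
      using Ck_on_has_derivative[OF Suc.prems(1) gx] Ck_on_has_derivative[OF Suc.prems(2) x]
      by (rule has_derivative_compose[rotated])
    then show "((\<lambda>x. f (g x)) has_derivative (\<lambda>v. \<Sum>b\<in>Basis. (frechet_derivative g (at x) v \<bullet> b) *\<^sub>R
        frechet_derivative f (at (g x)) b)) (at x)"
      by (simp add: frechet_derivative_basis[OF f, of "frechet_derivative g (at x) _"])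
  next
    have "Ck_on k S g" using Suc.prems(2) by (rule Ck_on_SucD)
    then show "Ck_on k S (\<lambda>x. \<Sum>b\<in>Basis. (frechet_derivative g (at x) v \<bullet> b) *\<^sub>R
        frechet_derivative f (at (g x)) b)" for v
      using Suc.prems assms(1)
      by (intro Ck_on_sum Ck_on_scaleR Suc.IH Ck_on_bounded_linear[where h = "\<lambda>x. x \<bullet> _"] bounded_linear_inner_left)
         auto
  qed (use assms(1) in auto)
qed

lemma smooth_on_Ck: "smooth_on S f \<Longrightarrow> Ck_on k S f"
  by (simp add: smooth_on_def)

lemma smooth_on_cong: "open S \<Longrightarrow> (\<And>y. y \<in> S \<Longrightarrow> f y = g y) \<Longrightarrow> smooth_on S f \<longleftrightarrow> smooth_on S g"
  unfolding smooth_on_def using Ck_on_cong by metis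

lemma smooth_on_subset: "smooth_on S f \<Longrightarrow> S' \<subseteq> S \<Longrightarrow> smooth_on S' f"
  unfolding smooth_on_def using Ck_on_subset by metis

lemma smooth_on_add: "open S \<Longrightarrow> smooth_on S f \<Longrightarrow> smooth_on S g \<Longrightarrow> smooth_on S (\<lambda>x. f x + g x)"
  by (simp add: smooth_on_def Ck_on_add)

lemma smooth_on_bounded_linear:
  "open S \<Longrightarrow> bounded_linear h \<Longrightarrow> smooth_on S f \<Longrightarrow> smooth_on S (\<lambda>x. h (f x))"
  by (simp add: smooth_on_def Ck_on_bounded_linear)

lemma smooth_on_compose:
  fixes g :: "'a::real_normed_vector \<Rightarrow> 'b::euclidean_space"
  assumes "open S" "open S'" "g ` S \<subseteq> S'" "smooth_on S' f" "smooth_on S g"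
  shows "smooth_on S (\<lambda>x. f (g x))"
  using assms unfolding smooth_on_def by (blast intro: Ck_on_compose)

lemma smooth_on_differentiable: "smooth_on S f \<Longrightarrow> x \<in> S \<Longrightarrow> f differentiable (at x)"
  using smooth_on_Ck[of S f "Suc 0"] by simp

lemma smooth_on_has_derivative:
  "smooth_on S f \<Longrightarrow> x \<in> S \<Longrightarrow> (f has_derivative frechet_derivative f (at x)) (at x)"
  by (rule has_derivative_frechet[OF smooth_on_differentiable])

lemma smooth_on_frechet_derivative:
  "smooth_on S f \<Longrightarrow> smooth_on S (\<lambda>x. frechet_derivative f (at x) v)"
  unfolding smooth_on_def using Ck_on.simps(2) by blast

lemma smooth_on_continuous_on: "smooth_on S f \<Longrightarrow> continuous_on S f"
  using smooth_on_Ck[of S f 0] by simp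

section \<open>Symmetry of second derivatives\<close>

abbreviation deriv2 :: "('a::real_normed_vector \<Rightarrow> 'b::real_normed_vector) \<Rightarrow> 'a \<Rightarrow> 'a \<Rightarrow> 'a \<Rightarrow> 'b" where
  "deriv2 f x v w \<equiv> frechet_derivative (\<lambda>y. frechet_derivative f (at y) w) (at x) v"

text \<open>The second difference is an increment of s \<mapsto> f(x + sv + tw) - f(x + sv). The
  mean value theorem turns it into t times a difference of values of the derivative along v, which
  differentiability of that derivative at x alone controls.\<close>

lemma second_difference_approx:
  fixes f :: "'a::real_normed_vector \<Rightarrow> real"
  assumes "open S" "x \<in> S" "smooth_on S f" "e > 0"
  obtains d where "d > 0" "\<And>t. 0 < t \<Longrightarrow> t < d \<Longrightarrow>
    \<bar>(f (x + t *\<^sub>R v + t *\<^sub>R w) - f (x + t *\<^sub>R v) - f (x + t *\<^sub>R w) + f x) - t\<^sup>2 * deriv2 f x w v\<bar> \<le> e * t\<^sup>2"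
proof -
  let ?Dv = "\<lambda>y. frechet_derivative f (at y) v"
  define A where "A = frechet_derivative ?Dv (at x)"
  have A: "(?Dv has_derivative A) (at x)"
    unfolding A_def using smooth_on_has_derivative[OF smooth_on_frechet_derivative[OF assms(3)] assms(2)] .
  interpret A: bounded_linear A by (rule has_derivative_bounded_linear[OF A])
  \<comment> \<open>The two points compared lie at distances adding up to at most t(2|v| + |w|) from
    x; the summand 1 keeps \<open>C\<close> positive.\<close>
  define C where "C = 2 * norm v + norm w + 1"
  have C: "C > 0" unfolding C_def using norm_ge_zero[of v] norm_ge_zero[of w] by linarith
  obtain r where r: "r > 0" "ball x r \<subseteq> S" using assms(1,2) openE by blast
  from A have "\<forall>e>0. \<exists>d>0. \<forall>y. norm (y - x) < d \<longrightarrow> norm (?Dv y - ?Dv x - A (y - x)) \<le> e * norm (y - x)"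
    unfolding has_derivative_at_alt by blast
  then obtain d0 where d0: "d0 > 0"
    "\<And>y. norm (y - x) < d0 \<Longrightarrow> norm (?Dv y - ?Dv x - A (y - x)) \<le> (e / C) * norm (y - x)"
    using assms(4) C by (meson divide_pos_pos)
  define d where "d = min r d0 / C"
  have d: "d > 0" using r d0 C by (simp add: d_def)
  show thesis
  proof (rule that[OF d])
    fix t :: real assume t: "0 < t" "t < d"
    have tC: "t * C < r" "t * C < d0" using t C by (simp_all add: d_def pos_less_divide_eq)
    have near: "norm (s *\<^sub>R v + u *\<^sub>R w) \<le> t * (norm v + norm w)" if "0 \<le> s" "s \<le> t" "0 \<le> u" "u \<le> t" for s u
    proof -
      have "norm (s *\<^sub>R v + u *\<^sub>R w) \<le> s * norm v + u * norm w"
        using norm_triangle_ineq[of "s *\<^sub>R v" "u *\<^sub>R w"] that by simp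
      also have "\<dots> \<le> t * norm v + t * norm w"
        using that by (intro add_mono mult_right_mono) auto
      finally show ?thesis by (simp add: algebra_simps)
    qed
    have tC': "t * (norm v + norm w) \<le> t * C"
      using t by (intro mult_left_mono) (auto simp: C_def)
    have inS: "x + (s *\<^sub>R v + u *\<^sub>R w) \<in> S" if "0 \<le> s" "s \<le> t" "0 \<le> u" "u \<le> t" for s u
    proof -
      have "norm (s *\<^sub>R v + u *\<^sub>R w) < r" using near[OF that] tC tC' by linarith
      then have "x + (s *\<^sub>R v + u *\<^sub>R w) \<in> ball x r" 
        using norm_minus_cancel[of "s *\<^sub>R v + u *\<^sub>R w"] by (simp add: dist_norm)
      then show ?thesis using r by blast
    qed
    let ?\<phi> = "\<lambda>s. f (x + (s *\<^sub>R v + t *\<^sub>R w)) - f (x + (s *\<^sub>R v + 0 *\<^sub>R w))"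
    have der: "DERIV (\<lambda>s. f (x + (s *\<^sub>R v + u *\<^sub>R w))) s :> ?Dv (x + (s *\<^sub>R v + u *\<^sub>R w))"
      if "0 \<le> s" "s \<le> t" "0 \<le> u" "u \<le> t" for s u
    proof -
      have f: "(f has_derivative frechet_derivative f (at (x + (s *\<^sub>R v + u *\<^sub>R w)))) (at (x + (s *\<^sub>R v + u *\<^sub>R w)))"
        using smooth_on_has_derivative[OF assms(3) inS[OF that]] .
      have "((\<lambda>s. x + (s *\<^sub>R v + u *\<^sub>R w)) has_derivative (\<lambda>h. h *\<^sub>R v)) (at s)"
        by (auto intro!: derivative_eq_intros)
      from has_derivative_compose[OF this f]
      have "((\<lambda>s. f (x + (s *\<^sub>R v + u *\<^sub>R w))) has_derivative
          (\<lambda>h. frechet_derivative f (at (x + (s *\<^sub>R v + u *\<^sub>R w))) (h *\<^sub>R v))) (at s)" .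
      moreover have "frechet_derivative f (at (x + (s *\<^sub>R v + u *\<^sub>R w))) (h *\<^sub>R v) = ?Dv (x + (s *\<^sub>R v + u *\<^sub>R w)) * h" for h
        using linear_scale[OF has_derivative_linear[OF f], of h v] by simp
      ultimately show ?thesis by (simp add: has_field_derivative_def)
    qed
    have der\<phi>: "DERIV ?\<phi> s :> ?Dv (x + (s *\<^sub>R v + t *\<^sub>R w)) - ?Dv (x + (s *\<^sub>R v + 0 *\<^sub>R w))"
      if "0 \<le> s" "s \<le> t" for s
      using that t by (intro DERIV_diff der) auto
    obtain z where z: "0 < z" "z < t"
      "?\<phi> t - ?\<phi> 0 = (t - 0) * (?Dv (x + (z *\<^sub>R v + t *\<^sub>R w)) - ?Dv (x + (z *\<^sub>R v + 0 *\<^sub>R w)))"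
      using MVT2[OF t(1) der\<phi>] by blast
    have e: "\<bar>?Dv (x + (z *\<^sub>R v + u *\<^sub>R w)) - ?Dv x - A (z *\<^sub>R v + u *\<^sub>R w)\<bar> \<le> (e / C) * norm (z *\<^sub>R v + u *\<^sub>R w)"
      if "0 \<le> u" "u \<le> t" for u
    proof -
      have "norm (z *\<^sub>R v + u *\<^sub>R w) < d0" using near[of z u] z that tC tC' by linarith
      then show ?thesis using d0(2)[of "x + (z *\<^sub>R v + u *\<^sub>R w)"] by simp
    qed
    have n: "norm (z *\<^sub>R v + t *\<^sub>R w) + norm (z *\<^sub>R v + 0 *\<^sub>R w) \<le> t * C"
    proof -
      have "norm (z *\<^sub>R v) \<le> t * norm v" using z by (simp add: mult_right_mono)
      then show ?thesis using near[of z t] z t by (simp add: C_def algebra_simps)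
    qed
    have "A (z *\<^sub>R v + t *\<^sub>R w) - A (z *\<^sub>R v + 0 *\<^sub>R w) = t * A w"
      by (simp add: A.add A.scaleR)
    then have "\<bar>(?Dv (x + (z *\<^sub>R v + t *\<^sub>R w)) - ?Dv (x + (z *\<^sub>R v + 0 *\<^sub>R w))) - t * A w\<bar>
       \<le> (e / C) * norm (z *\<^sub>R v + t *\<^sub>R w) + (e / C) * norm (z *\<^sub>R v + 0 *\<^sub>R w)"
      using e[of t] e[of 0] t by linarith
    also have "\<dots> \<le> (e / C) * (t * C)"
      using n assms(4) C by (simp only: flip: distrib_left) (intro mult_left_mono, auto)
    also have "\<dots> = e * t" using C by simp
    finally have "t * \<bar>(?Dv (x + (z *\<^sub>R v + t *\<^sub>R w)) - ?Dv (x + (z *\<^sub>R v + 0 *\<^sub>R w))) - t * A w\<bar> \<le> t * (e * t)"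
      using t by (intro mult_left_mono) auto
    then have "\<bar>t * ((?Dv (x + (z *\<^sub>R v + t *\<^sub>R w)) - ?Dv (x + (z *\<^sub>R v + 0 *\<^sub>R w))) - t * A w)\<bar> \<le> e * t\<^sup>2"
      using t by (simp add: abs_mult power2_eq_square mult_ac)
    then have "\<bar>?\<phi> t - ?\<phi> 0 - t\<^sup>2 * A w\<bar> \<le> e * t\<^sup>2"
      using z(3) by (simp add: power2_eq_square algebra_simps)
    moreover have "f (x + t *\<^sub>R v + t *\<^sub>R w) - f (x + t *\<^sub>R v) - f (x + t *\<^sub>R w) + f x = ?\<phi> t - ?\<phi> 0"
      by (simp add: add.assoc)
    ultimately show "\<bar>(f (x + t *\<^sub>R v + t *\<^sub>R w) - f (x + t *\<^sub>R v) - f (x + t *\<^sub>R w) + f x) - t\<^sup>2 * deriv2 f x w v\<bar> \<le> e * t\<^sup>2"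
      by (simp only: A_def)
  qed
qed

text \<open>The second difference is symmetric in v and w, so it approximates both iterated
  derivatives.\<close>

lemma deriv2_commute_real:
  fixes f :: "'a::real_normed_vector \<Rightarrow> real"
  assumes "open S" "x \<in> S" "smooth_on S f"
  shows "deriv2 f x v w = deriv2 f x w v"
proof (rule ccontr)
  assume ne: "deriv2 f x v w \<noteq> deriv2 f x w v"
  \<comment> \<open>A third of the gap: two errors of this size cannot add up to it.\<close>
  define e where "e = \<bar>deriv2 f x v w - deriv2 f x w v\<bar> / 3"
  have e: "e > 0" using ne by (simp add: e_def)
  obtain d1 where d1: "d1 > 0" "\<And>t. 0 < t \<Longrightarrow> t < d1 \<Longrightarrow>
    \<bar>(f (x + t *\<^sub>R v + t *\<^sub>R w) - f (x + t *\<^sub>R v) - f (x + t *\<^sub>R w) + f x) - t\<^sup>2 * deriv2 f x w v\<bar> \<le> e * t\<^sup>2"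
    using second_difference_approx[OF assms e, where v = v and w = w] by blast
  obtain d2 where d2: "d2 > 0" "\<And>t. 0 < t \<Longrightarrow> t < d2 \<Longrightarrow>
    \<bar>(f (x + t *\<^sub>R w + t *\<^sub>R v) - f (x + t *\<^sub>R w) - f (x + t *\<^sub>R v) + f x) - t\<^sup>2 * deriv2 f x v w\<bar> \<le> e * t\<^sup>2"
    using second_difference_approx[OF assms e, where v = w and w = v] by blast
  define t where "t = min d1 d2 / 2"
  have t: "0 < t" "t < d1" "t < d2" using d1 d2 by (auto simp: t_def)
  have sw: "f (x + t *\<^sub>R w + t *\<^sub>R v) = f (x + t *\<^sub>R v + t *\<^sub>R w)" by (simp add: add_ac)
  have "\<bar>t\<^sup>2 * deriv2 f x v w - t\<^sup>2 * deriv2 f x w v\<bar> \<le> e * t\<^sup>2 + e * t\<^sup>2"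
    using d1(2)[OF t(1,2)] d2(2)[OF t(1,3)] unfolding sw by linarith
  then have "t\<^sup>2 * \<bar>deriv2 f x v w - deriv2 f x w v\<bar> \<le> t\<^sup>2 * (2 * e)"
    by (simp only: flip: right_diff_distrib) (simp add: abs_mult mult.commute)
  then have "\<bar>deriv2 f x v w - deriv2 f x w v\<bar> \<le> 2 * e" using t by simp
  then show False using e by (simp add: e_def)
qed

lemma deriv2_commute:
  fixes f :: "'a::real_normed_vector \<Rightarrow> 'b::euclidean_space"
  assumes "open S" "x \<in> S" "smooth_on S f"
  shows "deriv2 f x v w = deriv2 f x w v"
proof (rule euclidean_eqI)
  fix b :: 'b assume "b \<in> Basis"
  have "deriv2 (\<lambda>y. f y \<bullet> b) x v w = deriv2 f x v w \<bullet> b" for v w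
  proof -
    have "frechet_derivative (\<lambda>y. f y \<bullet> b) (at y) w = frechet_derivative f (at y) w \<bullet> b" if "y \<in> S" for y
      by (subst frechet_derivative_eqI[OF has_derivative_inner_left[OF smooth_on_has_derivative[OF assms(3) that]]]) simp
    then have "deriv2 (\<lambda>y. f y \<bullet> b) x v w = frechet_derivative (\<lambda>y. frechet_derivative f (at y) w \<bullet> b) (at x) v"
      by (intro fun_cong[OF frechet_derivative_cong_open[OF assms(1,2)]])
    also have "\<dots> = deriv2 f x v w \<bullet> b"
      by (subst frechet_derivative_eqI[OF has_derivative_inner_left[OF smooth_on_has_derivative[OF
             smooth_on_frechet_derivative[OF assms(3)] assms(2)]]]) simp
    finally show ?thesis .
  qed
  then show "deriv2 f x v w \<bullet> b = deriv2 f x w v \<bullet> b"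
    using deriv2_commute_real[OF assms(1,2) smooth_on_bounded_linear[OF assms(1) bounded_linear_inner_left assms(3), of b], of v w]
    by simp
qed

text \<open>A product rule for the pairing of f' with a moving vector. It is the source of every
  second-order term in the computations with brackets; as in \<open>Ck_on_compose\<close>, the
  vector is expanded in the basis first.\<close>

lemma has_derivative_frechet_along:
  fixes f :: "'a::euclidean_space \<Rightarrow> 'b::real_normed_vector"
  assumes "open S" "x \<in> S" "smooth_on S f" "Y differentiable (at x)"
  shows "((\<lambda>y. frechet_derivative f (at y) (Y y)) has_derivative
    (\<lambda>v. deriv2 f x v (Y x) + frechet_derivative f (at x) (frechet_derivative Y (at x) v))) (at x)"
proof -
  have D: "((\<lambda>y. frechet_derivative f (at y) b) has_derivative (\<lambda>v. deriv2 f x v b)) (at x)" for b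
    using smooth_on_has_derivative[OF smooth_on_frechet_derivative[OF assms(3)] assms(2)] .
  have expand: "frechet_derivative f (at y) w = (\<Sum>b\<in>Basis. (w \<bullet> b) *\<^sub>R frechet_derivative f (at y) b)"
    if "y \<in> S" for y w
    by (rule frechet_derivative_basis[OF smooth_on_differentiable[OF assms(3) that]])
  have Y: "((\<lambda>y. Y y \<bullet> b) has_derivative (\<lambda>v. frechet_derivative Y (at x) v \<bullet> b)) (at x)" for b
    by (rule has_derivative_inner_left[OF has_derivative_frechet[OF assms(4)]])
  have expand2: "deriv2 f x v w = (\<Sum>b\<in>Basis. (w \<bullet> b) *\<^sub>R deriv2 f x v b)" for v w
  proof -
    have "((\<lambda>y. \<Sum>b\<in>Basis. (w \<bullet> b) *\<^sub>R frechet_derivative f (at y) b) has_derivative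
       (\<lambda>v. \<Sum>b\<in>Basis. (w \<bullet> b) *\<^sub>R deriv2 f x v b)) (at x)"
      by (intro has_derivative_sum has_derivative_scaleR_right D)
    then have "((\<lambda>y. frechet_derivative f (at y) w) has_derivative
       (\<lambda>v. \<Sum>b\<in>Basis. (w \<bullet> b) *\<^sub>R deriv2 f x v b)) (at x)"
      by (rule has_derivative_cong_open[OF assms(1,2), THEN iffD1, rotated]) (rule expand[symmetric])
    then show ?thesis by (simp add: frechet_derivative_eqI)
  qed
  have "((\<lambda>y. \<Sum>b\<in>Basis. (Y y \<bullet> b) *\<^sub>R frechet_derivative f (at y) b) has_derivative
     (\<lambda>v. \<Sum>b\<in>Basis. (Y x \<bullet> b) *\<^sub>R deriv2 f x v b
       + (frechet_derivative Y (at x) v \<bullet> b) *\<^sub>R frechet_derivative f (at x) b)) (at x)"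
    by (intro has_derivative_sum has_derivative_scaleR D Y)
  then have "((\<lambda>y. frechet_derivative f (at y) (Y y)) has_derivative
     (\<lambda>v. \<Sum>b\<in>Basis. (Y x \<bullet> b) *\<^sub>R deriv2 f x v b
       + (frechet_derivative Y (at x) v \<bullet> b) *\<^sub>R frechet_derivative f (at x) b)) (at x)"
    by (rule has_derivative_cong_open[OF assms(1,2), THEN iffD1, rotated]) (rule expand[symmetric])
  then show ?thesis
    by (simp only: sum.distrib expand2[symmetric] expand[OF assms(2), symmetric])
qed

section \<open>Tangent vectors, vector fields and the Lie bracket\<close>

locale smooth_manifold =
  fixes A :: "('m::topological_space, 'n::finite) chart set"
  assumes atlas: "smooth_atlas A"
begin

abbreviation img :: "('m, 'n) chart \<Rightarrow> 'm set \<Rightarrow> (real ^ 'n) set" where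
  "img c U \<equiv> coord c ` (dom_of c \<inter> U)"

lemma is_chart: "c \<in> A \<Longrightarrow> is_chart c"
  using atlas by (simp add: smooth_atlas_def)

lemma chart_inv_coord [simp]: "c \<in> A \<Longrightarrow> p \<in> dom_of c \<Longrightarrow> chart_inv c (coord c p) = p"
  using is_chart[of c] by (auto simp: is_chart_def homeomorphism_def)

lemma ex_chart: "\<exists>c. c \<in> A \<and> p \<in> dom_of c"
proof -
  have "p \<in> (\<Union>c\<in>A. dom_of c)"
    using atlas unfolding smooth_atlas_def by simp
  then show ?thesis by blast
qed

lemma open_dom: "c \<in> A \<Longrightarrow> open (dom_of c)"
  using is_chart[of c] by (simp add: is_chart_def)

lemma open_img:
  assumes "c \<in> A" "open U"
  shows "open (img c U)"
proof -
  have h: "homeomorphism (dom_of c) (coord c ` dom_of c) (coord c) (chart_inv c)"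
    and o: "open (dom_of c)" "open (coord c ` dom_of c)"
    using is_chart[OF assms(1)] by (auto simp: is_chart_def)
  have "openin (top_of_set (dom_of c)) (dom_of c \<inter> U)"
    using assms(2) by (simp add: openin_open_Int)
  then have "openin (top_of_set (coord c ` dom_of c)) (img c U)"
    using homeomorphism_imp_open_map[OF h] by blast
  then show ?thesis using o(2) openin_open_trans by blast
qed

lemma coord_in_img: "p \<in> dom_of c \<Longrightarrow> p \<in> U \<Longrightarrow> coord c p \<in> img c U"
  by blast

lemma smooth_transition: "c \<in> A \<Longrightarrow> c' \<in> A \<Longrightarrow> smooth_on (img c (dom_of c')) (transition c c')"
  using atlas by (auto simp: smooth_atlas_def)

lemma transition_coord: "c \<in> A \<Longrightarrow> p \<in> dom_of c \<Longrightarrow> transition c c' (coord c p) = coord c' p"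
  by (simp add: transition_def)

lemma transition_differentiable:
  "c \<in> A \<Longrightarrow> c' \<in> A \<Longrightarrow> p \<in> dom_of c \<Longrightarrow> p \<in> dom_of c' \<Longrightarrow> transition c c' differentiable (at (coord c p))"
  using smooth_on_differentiable[OF smooth_transition coord_in_img] .

abbreviation dtrans :: "('m, 'n) chart \<Rightarrow> ('m, 'n) chart \<Rightarrow> 'm \<Rightarrow> real ^ 'n \<Rightarrow> real ^ 'n" where
  "dtrans c c' p \<equiv> frechet_derivative (transition c c') (at (coord c p))"

lemma linear_dtrans:
  "c \<in> A \<Longrightarrow> c' \<in> A \<Longrightarrow> p \<in> dom_of c \<Longrightarrow> p \<in> dom_of c' \<Longrightarrow> linear (dtrans c c' p)"
  by (intro linear_frechet_derivative transition_differentiable)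

lemma dtrans_self:
  assumes "c \<in> A" "p \<in> dom_of c"
  shows "dtrans c c p w = w"
proof -
  have "dtrans c c p = frechet_derivative (\<lambda>x. x) (at (coord c p))"
    by (rule frechet_derivative_cong_open[OF open_img[OF assms(1) open_UNIV]])
      (use assms in \<open>auto simp: transition_coord\<close>)
  then show ?thesis by simp
qed

text \<open>\<open>F\<close> and \<open>F'\<close> represent one map in two charts. With a
  transition map for \<open>F'\<close> this yields the cocycle rule, with a function it yields the
  independence of \<open>dirderiv\<close> from the chart.\<close>

lemma frechet_change_chart:
  assumes "c \<in> A" "c' \<in> A" "p \<in> dom_of c" "p \<in> dom_of c'" "open U" "p \<in> U"
    and "\<And>q. q \<in> dom_of c \<Longrightarrow> q \<in> dom_of c' \<Longrightarrow> q \<in> U \<Longrightarrow> F (coord c q) = F' (coord c' q)"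
    and "F' differentiable (at (coord c' p))"
  shows "(F has_derivative (\<lambda>w. frechet_derivative F' (at (coord c' p)) (dtrans c c' p w))) (at (coord c p))"
proof -
  have "(F' has_derivative frechet_derivative F' (at (coord c' p))) (at (transition c c' (coord c p)))"
    using assms by (simp add: transition_coord has_derivative_frechet)
  from has_derivative_compose[OF has_derivative_frechet[OF transition_differentiable[OF assms(1,2,3,4)]] this]
  have "((\<lambda>x. F' (transition c c' x)) has_derivative
      (\<lambda>w. frechet_derivative F' (at (coord c' p)) (dtrans c c' p w))) (at (coord c p))" .
  then show ?thesis
  proof (rule has_derivative_cong_open[THEN iffD1, rotated -1])
    show "open (img c (dom_of c' \<inter> U))" using assms by (intro open_img open_Int open_dom)
    show "coord c p \<in> img c (dom_of c' \<inter> U)" using assms by blast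
    show "F' (transition c c' x) = F x" if "x \<in> img c (dom_of c' \<inter> U)" for x
      using that assms by (auto simp: transition_coord)
  qed
qed

lemma dtrans_dtrans:
  assumes "c \<in> A" "c' \<in> A" "c'' \<in> A" "p \<in> dom_of c" "p \<in> dom_of c'" "p \<in> dom_of c''"
  shows "dtrans c' c'' p (dtrans c c' p w) = dtrans c c'' p w"
proof -
  have "(transition c c'' has_derivative (\<lambda>w. dtrans c' c'' p (dtrans c c' p w))) (at (coord c p))"
    by (rule frechet_change_chart[where U = UNIV])
      (use assms in \<open>auto simp: transition_coord transition_differentiable\<close>)
  then show ?thesis by (simp add: frechet_derivative_eqI)
qed

lemma tangent_change:
  assumes "v \<in> tangent A p" "c \<in> A" "c' \<in> A" "p \<in> dom_of c" "p \<in> dom_of c'"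
  shows "v c' = dtrans c c' p (v c)"
  using assms unfolding tangent_def by blast

lemma tangent_outside: "v \<in> tangent A p \<Longrightarrow> \<not> (c \<in> A \<and> p \<in> dom_of c) \<Longrightarrow> v c = 0"
  unfolding tangent_def by blast

lemma tangentI:
  assumes "\<And>c. \<not> (c \<in> A \<and> p \<in> dom_of c) \<Longrightarrow> v c = 0"
    and "\<And>c c'. c \<in> A \<Longrightarrow> c' \<in> A \<Longrightarrow> p \<in> dom_of c \<Longrightarrow> p \<in> dom_of c' \<Longrightarrow> v c' = dtrans c c' p (v c)"
  shows "v \<in> tangent A p"
  using assms unfolding tangent_def by blast

lemma tangent_eqI:
  assumes "u \<in> tangent A p" "v \<in> tangent A p" "c \<in> A" "p \<in> dom_of c" "u c = v c"
  shows "u = v"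
proof
  fix c' show "u c' = v c'"
  proof (cases "c' \<in> A \<and> p \<in> dom_of c'")
    case True
    then show ?thesis
      using tangent_change[OF assms(1,3)] tangent_change[OF assms(2,3)] assms(4,5) by metis
  next
    case False
    then show ?thesis using tangent_outside assms(1,2) by metis
  qed
qed

lemma tangent_0 [simp]: "0 \<in> tangent A p"
  by (rule tangentI) (simp_all add: linear_0[OF linear_dtrans])

lemma tangent_add [simp]: "u \<in> tangent A p \<Longrightarrow> v \<in> tangent A p \<Longrightarrow> u + v \<in> tangent A p"
  by (rule tangentI)
    (simp_all add: tangent_outside linear_add[OF linear_dtrans] flip: tangent_change)

lemma tangent_tscale [simp]: "u \<in> tangent A p \<Longrightarrow> tscale a u \<in> tangent A p"
  by (rule tangentI)
    (simp_all add: tscale_def tangent_outside linear_scale[OF linear_dtrans] flip: tangent_change)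

lemma tangent_uminus [simp]: "u \<in> tangent A p \<Longrightarrow> - u \<in> tangent A p"
  using tangent_tscale[of u p "-1"] by (simp add: tscale_def fun_Compl_def)

lemma tangent_diff [simp]: "u \<in> tangent A p \<Longrightarrow> v \<in> tangent A p \<Longrightarrow> u - v \<in> tangent A p"
  using tangent_add[of u p "- v"] by simp

lemma field_rep_coord [simp]: "c \<in> A \<Longrightarrow> p \<in> dom_of c \<Longrightarrow> field_rep c X (coord c p) = X p c"
  by (simp add: field_rep_def)

lemma vfield_tangent: "vfield A U X \<Longrightarrow> p \<in> U \<Longrightarrow> X p \<in> tangent A p"
  by (simp add: vfield_def)

lemma vfield_smooth: "vfield A U X \<Longrightarrow> c \<in> A \<Longrightarrow> smooth_on (img c U) (field_rep c X)"
  by (simp add: vfield_def)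

lemma vfield_cong:
  assumes "open U" "\<And>p. p \<in> U \<Longrightarrow> X p = Y p"
  shows "vfield A U X \<longleftrightarrow> vfield A U Y"
proof -
  have "smooth_on (img c U) (field_rep c X) \<longleftrightarrow> smooth_on (img c U) (field_rep c Y)" if "c \<in> A" for c
    by (rule smooth_on_cong[OF open_img[OF that assms(1)]]) (use that assms in auto)
  then show ?thesis using assms by (simp add: vfield_def)
qed

lemma vfield_subset: "vfield A U X \<Longrightarrow> U' \<subseteq> U \<Longrightarrow> vfield A U' X"
  unfolding vfield_def by (meson Int_mono image_mono order_refl smooth_on_subset subsetD)

lemma vfield_add:
  assumes "open U" "vfield A U X" "vfield A U Y"
  shows "vfield A U (X + Y)"
  using assms smooth_on_add[OF open_img vfield_smooth vfield_smooth]
  by (auto simp: vfield_def field_rep_def)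

lemma vfield_uminus:
  assumes "open U" "vfield A U X"
  shows "vfield A U (- X)"
  using assms smooth_on_bounded_linear[OF open_img bounded_linear_minus[OF bounded_linear_ident] vfield_smooth]
  by (auto simp: vfield_def field_rep_def)

lemma vfield_diff: "open U \<Longrightarrow> vfield A U X \<Longrightarrow> vfield A U Y \<Longrightarrow> vfield A U (X - Y)"
  using vfield_add[of U X "- Y"] vfield_uminus[of U Y] by simp

text \<open>The field with constant components \<open>w\<close> in the chart \<open>c\<close>,
  carried to the other charts by their transition maps. The axis vectors give the coordinate frame
  in which the torsion is later followed along a segment.\<close>

definition coord_field :: "('m, 'n) chart \<Rightarrow> real ^ 'n \<Rightarrow> ('m, 'n) field" where
  "coord_field c w = (\<lambda>p c'. if c' \<in> A \<and> p \<in> dom_of c' then dtrans c c' p w else 0)"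

lemma coord_field_tangent: "c \<in> A \<Longrightarrow> p \<in> dom_of c \<Longrightarrow> coord_field c w p \<in> tangent A p"
  by (rule tangentI) (auto simp: coord_field_def dtrans_dtrans)

lemma coord_field_self: "c \<in> A \<Longrightarrow> p \<in> dom_of c \<Longrightarrow> coord_field c w p c = w"
  by (simp add: coord_field_def dtrans_self)

lemma vfield_coord_field:
  assumes c: "c \<in> A"
  shows "vfield A (dom_of c) (coord_field c w)"
proof -
  have "smooth_on (img c' (dom_of c)) (field_rep c' (coord_field c w))" if c': "c' \<in> A" for c'
  proof -
    have "smooth_on (img c' (dom_of c)) (\<lambda>x. frechet_derivative (transition c c') (at (transition c' c x)) w)"
      by (rule smooth_on_compose[OF _ _ _ smooth_on_frechet_derivative[OF smooth_transition[OF c c']]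
            smooth_transition[OF c' c]])
         (use c c' in \<open>auto simp: open_img open_dom transition_coord\<close>)
    then show ?thesis
      by (rule smooth_on_cong[THEN iffD1, rotated -1])
         (use c c' in \<open>auto simp: open_img open_dom transition_coord coord_field_def\<close>)
  qed
  then show ?thesis using c by (simp add: vfield_def coord_field_tangent)
qed

text \<open>The chart picked inside \<open>dirderiv\<close> is arbitrary; the derivative of the
  transition map that enters through the function is absorbed by the one that enters through the
  tangent vector.\<close>

lemma dirderiv_eq:
  assumes "c \<in> A" "p \<in> dom_of c" "v \<in> tangent A p" "(f \<circ> chart_inv c) differentiable (at (coord c p))"
  shows "dirderiv A p v f = frechet_derivative (f \<circ> chart_inv c) (at (coord c p)) (v c)"
proof -
  define c' where "c' = (SOME c. c \<in> A \<and> p \<in> dom_of c)"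
  have c': "c' \<in> A" "p \<in> dom_of c'"
    using someI_ex[OF ex_chart[of p]] by (auto simp: c'_def)
  have "((f \<circ> chart_inv c') has_derivative
      (\<lambda>w. frechet_derivative (f \<circ> chart_inv c) (at (coord c p)) (dtrans c' c p w))) (at (coord c' p))"
    by (rule frechet_change_chart[where U = UNIV]) (use assms c' in auto)
  then show ?thesis
    using tangent_change[OF assms(3) c'(1) assms(1) c'(2) assms(2)]
    by (simp add: dirderiv_def frechet_derivative_eqI flip: c'_def)
qed

lemma dirderiv_cong:
  assumes "open U" "p \<in> U" "\<And>q. q \<in> U \<Longrightarrow> f q = f' q"
  shows "dirderiv A p v f = dirderiv A p v f'"
proof -
  define c where "c = (SOME c. c \<in> A \<and> p \<in> dom_of c)"
  have c: "c \<in> A" "p \<in> dom_of c"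
    using someI_ex[OF ex_chart[of p]] by (auto simp: c_def)
  have "frechet_derivative (f \<circ> chart_inv c) (at (coord c p)) =
    frechet_derivative (f' \<circ> chart_inv c) (at (coord c p))"
    by (rule frechet_derivative_cong_open[OF open_img[OF c(1) assms(1)]]) (use c assms in auto)
  then show ?thesis by (simp add: dirderiv_def flip: c_def)
qed

lemma smooth_fun_on: "smooth_fun A U f \<Longrightarrow> c \<in> A \<Longrightarrow> smooth_on (img c U) (f \<circ> chart_inv c)"
  by (simp add: smooth_fun_def)

lemma smooth_fun_differentiable:
  "smooth_fun A U f \<Longrightarrow> c \<in> A \<Longrightarrow> p \<in> dom_of c \<Longrightarrow> p \<in> U \<Longrightarrow>
    (f \<circ> chart_inv c) differentiable (at (coord c p))"
  using smooth_on_differentiable[OF smooth_fun_on coord_in_img] .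

lemma dirderiv_add:
  assumes "smooth_fun A U f" "smooth_fun A U f'" "p \<in> U" "v \<in> tangent A p"
  shows "dirderiv A p v (\<lambda>q. f q + f' q) = dirderiv A p v f + dirderiv A p v f'"
proof -
  obtain c where c: "c \<in> A" "p \<in> dom_of c" using ex_chart by blast
  note d = smooth_fun_differentiable[OF assms(1) c assms(3)] smooth_fun_differentiable[OF assms(2) c assms(3)]
  have "(((\<lambda>q. f q + f' q) \<circ> chart_inv c) has_derivative (\<lambda>w.
      frechet_derivative (f \<circ> chart_inv c) (at (coord c p)) w +
      frechet_derivative (f' \<circ> chart_inv c) (at (coord c p)) w)) (at (coord c p))"
    unfolding comp_def using d by (intro has_derivative_add has_derivative_frechet) (auto simp: comp_def)
  moreover from this have "((\<lambda>q. f q + f' q) \<circ> chart_inv c) differentiable (at (coord c p))"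
    by (auto simp: differentiable_def)
  ultimately show ?thesis
    using c assms(4) d by (simp add: dirderiv_eq frechet_derivative_eqI)
qed

section \<open>Derivatives of brackets and derivatives along brackets\<close>

lemma has_derivative_lie_bracket:
  assumes "open U" "vfield A U X" "vfield A U Y" "c \<in> A" "p \<in> dom_of c" "p \<in> U"
    and "\<And>q. q \<in> U \<Longrightarrow> Z q = lie_bracket A X Y q"
  defines "x \<equiv> coord c p" and "X' \<equiv> field_rep c X" and "Y' \<equiv> field_rep c Y"
  shows "(field_rep c Z has_derivative (\<lambda>v.
     (deriv2 Y' x v (X' x) + frechet_derivative Y' (at x) (frechet_derivative X' (at x) v)) -
     (deriv2 X' x v (Y' x) + frechet_derivative X' (at x) (frechet_derivative Y' (at x) v)))) (at x)"
proof -
  have x: "x \<in> img c U" and o: "open (img c U)" using assms by (auto simp: open_img)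
  have s: "smooth_on (img c U) X'" "smooth_on (img c U) Y'" using assms by (auto simp: vfield_smooth)
  note d = smooth_on_differentiable[OF s(1) x] smooth_on_differentiable[OF s(2) x]
  have "((\<lambda>y. frechet_derivative Y' (at y) (X' y) - frechet_derivative X' (at y) (Y' y)) has_derivative (\<lambda>v.
     (deriv2 Y' x v (X' x) + frechet_derivative Y' (at x) (frechet_derivative X' (at x) v)) -
     (deriv2 X' x v (Y' x) + frechet_derivative X' (at x) (frechet_derivative Y' (at x) v)))) (at x)"
    using d by (intro has_derivative_diff has_derivative_frechet_along[OF o x] s)
  then show ?thesis
    by (rule has_derivative_cong_open[OF o x, THEN iffD1, rotated])
       (use assms in \<open>auto simp: field_rep_def lie_bracket_def\<close>)
qed

text \<open>In a chart the second derivatives cancel in pairs by symmetry, the products of first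
  derivatives by linearity. The inner brackets need only agree with \<open>XY\<close>,
  \<open>YZ\<close>, \<open>ZX\<close> on \<open>U\<close>, because the fields used later are set to
  zero outside \<open>U\<close>.\<close>

lemma jacobi_lie_bracket:
  assumes "open U" "vfield A U X" "vfield A U Y" "vfield A U Z" "p \<in> U"
    and "\<And>q. q \<in> U \<Longrightarrow> XY q = lie_bracket A X Y q"
    and "\<And>q. q \<in> U \<Longrightarrow> YZ q = lie_bracket A Y Z q"
    and "\<And>q. q \<in> U \<Longrightarrow> ZX q = lie_bracket A Z X q"
  shows "lie_bracket A X YZ p + lie_bracket A Y ZX p + lie_bracket A Z XY p = 0"
proof
  fix c
  show "(lie_bracket A X YZ p + lie_bracket A Y ZX p + lie_bracket A Z XY p) c = 0 c"
  proof (cases "c \<in> A \<and> p \<in> dom_of c")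
    case True
    then have c: "c \<in> A" "p \<in> dom_of c" by auto
    let ?x = "coord c p" and ?X = "field_rep c X" and ?Y = "field_rep c Y" and ?Z = "field_rep c Z"
    have x: "?x \<in> img c U" and o: "open (img c U)" using assms c by (auto simp: open_img)
    have s: "smooth_on (img c U) ?X" "smooth_on (img c U) ?Y" "smooth_on (img c U) ?Z"
      using assms c by (auto simp: vfield_smooth)
    interpret DX: linear "frechet_derivative ?X (at ?x)"
      by (rule linear_frechet_derivative[OF smooth_on_differentiable[OF s(1) x]])
    interpret DY: linear "frechet_derivative ?Y (at ?x)"
      by (rule linear_frechet_derivative[OF smooth_on_differentiable[OF s(2) x]])
    interpret DZ: linear "frechet_derivative ?Z (at ?x)"
      by (rule linear_frechet_derivative[OF smooth_on_differentiable[OF s(3) x]])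
    have b: "XY p c = frechet_derivative ?Y (at ?x) (?X ?x) - frechet_derivative ?X (at ?x) (?Y ?x)"
      "YZ p c = frechet_derivative ?Z (at ?x) (?Y ?x) - frechet_derivative ?Y (at ?x) (?Z ?x)"
      "ZX p c = frechet_derivative ?X (at ?x) (?Z ?x) - frechet_derivative ?Z (at ?x) (?X ?x)"
      using assms c by (simp_all add: lie_bracket_def)
    note D = has_derivative_lie_bracket[OF assms(1,2,3) c assms(5,6), THEN frechet_derivative_eqI]
      has_derivative_lie_bracket[OF assms(1,3,4) c assms(5,7), THEN frechet_derivative_eqI]
      has_derivative_lie_bracket[OF assms(1,4,2) c assms(5,8), THEN frechet_derivative_eqI]
    note sym = deriv2_commute[OF o x s(1), of "?Z ?x" "?Y ?x"]
      deriv2_commute[OF o x s(2), of "?Z ?x" "?X ?x"]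
      deriv2_commute[OF o x s(3), of "?Y ?x" "?X ?x"]
    show ?thesis
      using c by (simp add: lie_bracket_def b D DX.diff DY.diff DZ.diff sym flip: field_rep_coord)
  next
    case False
    then show ?thesis by (auto simp: lie_bracket_def)
  qed
qed

text \<open>The symmetry of the second derivative of f cancels all but the first-order terms.
  Tangency of the bracket is a hypothesis here and is supplied later, when a torsion-free connection
  is at hand (\<open>vfield_lie_bracket\<close>).\<close>

lemma dirderiv_lie_bracket:
  assumes "open U" "vfield A U X" "vfield A U Y" "smooth_fun A U f" "p \<in> U"
    and "\<And>q. q \<in> U \<Longrightarrow> fX q = dirderiv A q (X q) f"
    and "\<And>q. q \<in> U \<Longrightarrow> fY q = dirderiv A q (Y q) f"
    and "lie_bracket A X Y p \<in> tangent A p"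
  shows "dirderiv A p (lie_bracket A X Y p) f = dirderiv A p (X p) fY - dirderiv A p (Y p) fX"
proof -
  obtain c where c: "c \<in> A" "p \<in> dom_of c" using ex_chart by blast
  let ?x = "coord c p" and ?f = "f \<circ> chart_inv c"
  have x: "?x \<in> img c U" and o: "open (img c U)" using assms c by (auto simp: open_img)
  have f: "smooth_on (img c U) ?f" using assms(4) c by (simp add: smooth_fun_on)
  interpret Df: linear "frechet_derivative ?f (at ?x)"
    by (rule linear_frechet_derivative[OF smooth_on_differentiable[OF f x]])
  have h: "((fY \<circ> chart_inv c) has_derivative (\<lambda>v. deriv2 ?f ?x v (Y p c) +
      frechet_derivative ?f (at ?x) (frechet_derivative (field_rep c Y) (at ?x) v))) (at ?x)"
    if "vfield A U Y" "\<And>q. q \<in> U \<Longrightarrow> fY q = dirderiv A q (Y q) f" for Y fY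
  proof -
    have s: "smooth_on (img c U) (field_rep c Y)" using that c by (simp add: vfield_smooth)
    have "((\<lambda>y. frechet_derivative ?f (at y) (field_rep c Y y)) has_derivative
      (\<lambda>v. deriv2 ?f ?x v (field_rep c Y ?x) +
      frechet_derivative ?f (at ?x) (frechet_derivative (field_rep c Y) (at ?x) v))) (at ?x)"
      by (rule has_derivative_frechet_along[OF o x f smooth_on_differentiable[OF s x]])
    then have "((fY \<circ> chart_inv c) has_derivative
      (\<lambda>v. deriv2 ?f ?x v (field_rep c Y ?x) +
      frechet_derivative ?f (at ?x) (frechet_derivative (field_rep c Y) (at ?x) v))) (at ?x)"
      by (rule has_derivative_cong_open[OF o x, THEN iffD1, rotated])
        (use that c assms(4) in \<open>auto simp: dirderiv_eq smooth_fun_differentiable vfield_tangent\<close>)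
    then show ?thesis using c by simp
  qed
  have e: "dirderiv A p v fY = deriv2 ?f ?x (v c) (Y p c) +
      frechet_derivative ?f (at ?x) (frechet_derivative (field_rep c Y) (at ?x) (v c))"
    if "vfield A U Y" "\<And>q. q \<in> U \<Longrightarrow> fY q = dirderiv A q (Y q) f" "v \<in> tangent A p" for Y fY v
    using h[OF that(1,2)] dirderiv_eq[OF c that(3), of fY]
    by (auto simp: frechet_derivative_eqI differentiable_def)
  have "dirderiv A p (lie_bracket A X Y p) f = frechet_derivative ?f (at ?x) (lie_bracket A X Y p c)"
    using assms c by (intro dirderiv_eq) (auto simp: smooth_fun_differentiable)
  moreover have "deriv2 ?f ?x (X p c) (Y p c) = deriv2 ?f ?x (Y p c) (X p c)"
    by (rule deriv2_commute[OF o x f])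
  ultimately show ?thesis
    using e[OF assms(3,7) vfield_tangent[OF assms(2,5)]] e[OF assms(2,6) vfield_tangent[OF assms(3,5)]] c
    by (simp add: lie_bracket_def Df.diff)
qed

end

section \<open>The algebra of nearly Kaehler fields\<close>

text \<open>
  \<open>V\<close> models the smooth vector fields on a fixed open set, extended by zero, and the bracket is
  \<open>D X Y - D Y X\<close>. Only additivity is required: everything derived here is multilinear over the
  constants, so multiplication of fields by functions never enters.
\<close>

locale field_algebra =
  fixes V :: "'v::ab_group_add set"
    and J :: "'v \<Rightarrow> 'v"
    and G :: "'v \<Rightarrow> 'v \<Rightarrow> 'm \<Rightarrow> real"
    and der :: "'v \<Rightarrow> ('m \<Rightarrow> real) \<Rightarrow> 'm \<Rightarrow> real"
    and D nab :: "'v \<Rightarrow> 'v \<Rightarrow> 'v"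
  assumes V_add [simp]: "\<And>X Y. X \<in> V \<Longrightarrow> Y \<in> V \<Longrightarrow> X + Y \<in> V"
    and V_uminus [simp]: "\<And>X. X \<in> V \<Longrightarrow> - X \<in> V"
    and V_J [simp]: "\<And>X. X \<in> V \<Longrightarrow> J X \<in> V"
    and V_D [simp]: "\<And>X Y. X \<in> V \<Longrightarrow> Y \<in> V \<Longrightarrow> D X Y \<in> V"
    and V_nab [simp]: "\<And>X Y. X \<in> V \<Longrightarrow> Y \<in> V \<Longrightarrow> nab X Y \<in> V"
    and J_add: "\<And>X Y. X \<in> V \<Longrightarrow> Y \<in> V \<Longrightarrow> J (X + Y) = J X + J Y"
    and J_J [simp]: "\<And>X. X \<in> V \<Longrightarrow> J (J X) = - X"
    and G_sym: "\<And>X Y. X \<in> V \<Longrightarrow> Y \<in> V \<Longrightarrow> G X Y = G Y X"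
    and G_add: "\<And>X Y Z. X \<in> V \<Longrightarrow> Y \<in> V \<Longrightarrow> Z \<in> V \<Longrightarrow> G (X + Y) Z = G X Z + G Y Z"
    and G_J: "\<And>X Y. X \<in> V \<Longrightarrow> Y \<in> V \<Longrightarrow> G (J X) (J Y) = G X Y"
    and G_definite: "\<And>X. X \<in> V \<Longrightarrow> G X X = 0 \<Longrightarrow> X = 0"
    and der_add: "\<And>X A B A' B'. \<lbrakk>X \<in> V; A \<in> V; B \<in> V; A' \<in> V; B' \<in> V\<rbrakk>
      \<Longrightarrow> der X (G A B + G A' B') = der X (G A B) + der X (G A' B')"
    and der_bracket: "\<And>X Y A B. \<lbrakk>X \<in> V; Y \<in> V; A \<in> V; B \<in> V\<rbrakk>
      \<Longrightarrow> der (D X Y - D Y X) (G A B) = der X (der Y (G A B)) - der Y (der X (G A B))"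
    and jacobi: "\<And>X Y Z br. \<lbrakk>X \<in> V; Y \<in> V; Z \<in> V; br = (\<lambda>X Y. D X Y - D Y X)\<rbrakk>
      \<Longrightarrow> br X (br Y Z) + br Y (br Z X) + br Z (br X Y) = 0"
    and D_add1: "\<And>X Y Z. X \<in> V \<Longrightarrow> Y \<in> V \<Longrightarrow> Z \<in> V \<Longrightarrow> D (X + Y) Z = D X Z + D Y Z"
    and D_add2: "\<And>X Y Z. X \<in> V \<Longrightarrow> Y \<in> V \<Longrightarrow> Z \<in> V \<Longrightarrow> D X (Y + Z) = D X Y + D X Z"
    and nab_add1: "\<And>X Y Z. X \<in> V \<Longrightarrow> Y \<in> V \<Longrightarrow> Z \<in> V \<Longrightarrow> nab (X + Y) Z = nab X Z + nab Y Z"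
    and nab_add2: "\<And>X Y Z. X \<in> V \<Longrightarrow> Y \<in> V \<Longrightarrow> Z \<in> V \<Longrightarrow> nab X (Y + Z) = nab X Y + nab X Z"
    and D_metric: "\<And>X Y Z. X \<in> V \<Longrightarrow> Y \<in> V \<Longrightarrow> Z \<in> V \<Longrightarrow> der X (G Y Z) = G (D X Y) Z + G Y (D X Z)"
    and nab_metric: "\<And>X Y Z. X \<in> V \<Longrightarrow> Y \<in> V \<Longrightarrow> Z \<in> V \<Longrightarrow> der X (G Y Z) = G (nab X Y) Z + G Y (nab X Z)"
    and nab_J: "\<And>X Y. X \<in> V \<Longrightarrow> Y \<in> V \<Longrightarrow> nab X (J Y) = J (nab X Y)"
    and D_J: "\<And>X. X \<in> V \<Longrightarrow> D X (J X) = J (D X X)"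
    and torsion_type: "\<And>X Y T. \<lbrakk>X \<in> V; Y \<in> V; T = (\<lambda>X Y. nab X Y - nab Y X - (D X Y - D Y X))\<rbrakk>
      \<Longrightarrow> T (J X) Y = T X (J Y)"
begin

definition br :: "'v \<Rightarrow> 'v \<Rightarrow> 'v" where
  "br X Y = D X Y - D Y X"

definition T :: "'v \<Rightarrow> 'v \<Rightarrow> 'v" where
  "T X Y = nab X Y - nab Y X - br X Y"

definition R :: "'v \<Rightarrow> 'v \<Rightarrow> 'v \<Rightarrow> 'v" where
  "R X Y Z = nab X (nab Y Z) - nab Y (nab X Z) - nab (br X Y) Z"

definition nabT :: "'v \<Rightarrow> 'v \<Rightarrow> 'v \<Rightarrow> 'v" where
  "nabT X Y Z = nab X (T Y Z) - T (nab X Y) Z - T Y (nab X Z)"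

lemma V_diff [simp]: "X \<in> V \<Longrightarrow> Y \<in> V \<Longrightarrow> X - Y \<in> V"
  using V_add[of X "- Y"] by simp

lemma V_br [simp]: "X \<in> V \<Longrightarrow> Y \<in> V \<Longrightarrow> br X Y \<in> V"
  by (simp add: br_def)

lemma V_T [simp]: "X \<in> V \<Longrightarrow> Y \<in> V \<Longrightarrow> T X Y \<in> V"
  by (simp add: T_def)

lemma V_R [simp]: "X \<in> V \<Longrightarrow> Y \<in> V \<Longrightarrow> Z \<in> V \<Longrightarrow> R X Y Z \<in> V"
  by (simp add: R_def)

lemma V_nabT [simp]: "X \<in> V \<Longrightarrow> Y \<in> V \<Longrightarrow> Z \<in> V \<Longrightarrow> nabT X Y Z \<in> V"
  by (simp add: nabT_def)

text \<open>The source of all sign rules below: zero lies in \<open>V\<close> as X - X, and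
  additivity at zero forces the value zero there.\<close>

lemma additive_on_V:
  fixes f :: "'v \<Rightarrow> 'b::ab_group_add"
  assumes "\<And>X Y. X \<in> V \<Longrightarrow> Y \<in> V \<Longrightarrow> f (X + Y) = f X + f Y"
  shows "X \<in> V \<Longrightarrow> f (- X) = - f X"
    and "X \<in> V \<Longrightarrow> Y \<in> V \<Longrightarrow> f (X - Y) = f X - f Y"
proof -
  have minus: "f (- X) = - f X" if "X \<in> V" for X
  proof -
    have "X - X \<in> V" using that by (rule V_diff[OF that])
    then have "f 0 = f 0 + f 0" using assms[of 0 0] by simp
    then have "f 0 = 0" by simp
    then show ?thesis using assms[of X "- X"] that by (simp add: eq_neg_iff_add_eq_0 add.commute)
  qed
  show "X \<in> V \<Longrightarrow> f (- X) = - f X" by (rule minus)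
  show "X \<in> V \<Longrightarrow> Y \<in> V \<Longrightarrow> f (X - Y) = f X - f Y"
    using assms[of X "- Y"] minus[of Y] by simp
qed

lemma J_diff: "X \<in> V \<Longrightarrow> Y \<in> V \<Longrightarrow> J (X - Y) = J X - J Y"
  and J_minus [simp]: "X \<in> V \<Longrightarrow> J (- X) = - J X"
  using additive_on_V[of J] J_add by auto

lemma G_add2: "X \<in> V \<Longrightarrow> Y \<in> V \<Longrightarrow> Z \<in> V \<Longrightarrow> G X (Y + Z) = G X Y + G X Z"
  using G_add G_sym by simp

lemma G_diff: "X \<in> V \<Longrightarrow> Y \<in> V \<Longrightarrow> Z \<in> V \<Longrightarrow> G (X - Y) Z = G X Z - G Y Z"
  and G_minus [simp]: "X \<in> V \<Longrightarrow> Z \<in> V \<Longrightarrow> G (- X) Z = - G X Z"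
  using additive_on_V[of "\<lambda>X. G X Z"] G_add by auto

lemma G_diff2: "X \<in> V \<Longrightarrow> Y \<in> V \<Longrightarrow> Z \<in> V \<Longrightarrow> G X (Y - Z) = G X Y - G X Z"
  and G_minus2 [simp]: "X \<in> V \<Longrightarrow> Y \<in> V \<Longrightarrow> G X (- Y) = - G X Y"
  using additive_on_V[of "\<lambda>Y. G X Y"] G_add2 by auto

lemma G_J_left: "G (J X) Y = - G X (J Y)" if "X \<in> V" "Y \<in> V"
proof -
  have "- G (J X) Y = G X (J Y)" using G_J[of X "J Y"] that by simp
  then show ?thesis by (metis minus_minus)
qed

lemma G_ext: "X = Y" if "X \<in> V" "Y \<in> V" "\<And>Z. Z \<in> V \<Longrightarrow> G X Z = G Y Z"
proof -
  have "G (X - Y) (X - Y) = 0" using that by (simp add: G_diff)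
  then show ?thesis using G_definite[of "X - Y"] that by simp
qed

lemma nab_minus1 [simp]: "X \<in> V \<Longrightarrow> Z \<in> V \<Longrightarrow> nab (- X) Z = - nab X Z"
  using additive_on_V[of "\<lambda>X. nab X Z"] nab_add1 by auto

lemma nab_diff2: "X \<in> V \<Longrightarrow> Y \<in> V \<Longrightarrow> Z \<in> V \<Longrightarrow> nab X (Y - Z) = nab X Y - nab X Z"
  and nab_minus2 [simp]: "X \<in> V \<Longrightarrow> Z \<in> V \<Longrightarrow> nab X (- Z) = - nab X Z"
  using additive_on_V[of "\<lambda>Z. nab X Z"] nab_add2 by auto

lemma br_add1: "X \<in> V \<Longrightarrow> Y \<in> V \<Longrightarrow> Z \<in> V \<Longrightarrow> br (X + Y) Z = br X Z + br Y Z"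
  and br_add2: "X \<in> V \<Longrightarrow> Y \<in> V \<Longrightarrow> Z \<in> V \<Longrightarrow> br X (Y + Z) = br X Y + br X Z"
  by (simp_all add: br_def D_add1 D_add2)

lemma br_skew: "br X Y = - br Y X"
  by (simp add: br_def)

lemma T_add1: "X \<in> V \<Longrightarrow> Y \<in> V \<Longrightarrow> Z \<in> V \<Longrightarrow> T (X + Y) Z = T X Z + T Y Z"
  and T_add2: "X \<in> V \<Longrightarrow> Y \<in> V \<Longrightarrow> Z \<in> V \<Longrightarrow> T X (Y + Z) = T X Y + T X Z"
  by (simp_all add: T_def nab_add1 nab_add2 br_add1 br_add2)

lemma T_diff1: "X \<in> V \<Longrightarrow> Y \<in> V \<Longrightarrow> Z \<in> V \<Longrightarrow> T (X - Y) Z = T X Z - T Y Z"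
  and T_minus1 [simp]: "X \<in> V \<Longrightarrow> Z \<in> V \<Longrightarrow> T (- X) Z = - T X Z"
  using additive_on_V[of "\<lambda>X. T X Z"] T_add1 by auto

lemma T_diff2: "X \<in> V \<Longrightarrow> Y \<in> V \<Longrightarrow> Z \<in> V \<Longrightarrow> T X (Y - Z) = T X Y - T X Z"
  and T_minus2 [simp]: "X \<in> V \<Longrightarrow> Z \<in> V \<Longrightarrow> T X (- Z) = - T X Z"
  using additive_on_V[of "\<lambda>Z. T X Z"] T_add2 by auto

lemma T_skew: "T X Y = - T Y X"
  using br_skew[of X Y] by (simp add: T_def)

text \<open>The real form of the type condition: the imaginary part of T(X - iJX, Y + iJY) is T(X,
  JY) - T(JX, Y), and its real part is the same expression up to sign with JX for X.\<close>

lemma T_J_left: "X \<in> V \<Longrightarrow> Y \<in> V \<Longrightarrow> T (J X) Y = T X (J Y)"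
  using torsion_type[of X Y "\<lambda>X Y. nab X Y - nab Y X - (D X Y - D Y X)"]
  by (simp add: T_def br_def)

section \<open>The contorsion and the torsion as 3-forms\<close>

definition contorsion :: "'v \<Rightarrow> 'v \<Rightarrow> 'v \<Rightarrow> 'm \<Rightarrow> real" where
  "contorsion X Y Z = G (nab X Y - D X Y) Z"

lemma contorsion_add:
  assumes "X \<in> V" "X' \<in> V" "Y \<in> V" "Y' \<in> V" "Z \<in> V" "Z' \<in> V"
  shows "contorsion (X + X') Y Z = contorsion X Y Z + contorsion X' Y Z"
    and "contorsion X (Y + Y') Z = contorsion X Y Z + contorsion X Y' Z"
    and "contorsion X Y (Z + Z') = contorsion X Y Z + contorsion X Y Z'"
  using assms by (simp_all add: contorsion_def D_add1 D_add2 nab_add1 nab_add2 G_add G_diff G_add2)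

lemma contorsion_minus [simp]:
  assumes "X \<in> V" "Y \<in> V" "Z \<in> V"
  shows "contorsion (- X) Y Z = - contorsion X Y Z" "contorsion X (- Y) Z = - contorsion X Y Z" "contorsion X Y (- Z) = - contorsion X Y Z"
  using additive_on_V[of "\<lambda>X. contorsion X Y Z"] additive_on_V[of "\<lambda>Y. contorsion X Y Z"]
    additive_on_V[of "\<lambda>Z. contorsion X Y Z"] contorsion_add assms by auto


text \<open>Both connections are metric, so their difference is a skew endomorphism.\<close>

lemma contorsion_skew23:
  assumes "X \<in> V" "Y \<in> V" "Z \<in> V"
  shows "contorsion X Y Z p = - contorsion X Z Y p"
proof -
  have "G (nab X Y) Z + G Y (nab X Z) = G (D X Y) Z + G Y (D X Z)"
    using D_metric[of X Y Z] nab_metric[of X Y Z] assms by simp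
  moreover have "G Y (nab X Z) = G (nab X Z) Y" "G Y (D X Z) = G (D X Z) Y"
    using assms by (auto intro: G_sym)
  ultimately have "contorsion X Y Z = - contorsion X Z Y"
    using assms by (simp add: contorsion_def G_diff algebra_simps)
  then show ?thesis by simp
qed

text \<open>The nearly Kaehler condition only compares D X (J X) with J (D X X). Since
  \<open>nab\<close> preserves J, the contorsion commutes with J on the diagonal, and polarization
  gives all that is available off it.\<close>

lemma contorsion_J_polarized:
  assumes "X \<in> V" "Y \<in> V" "Z \<in> V"
  shows "contorsion X (J Y) Z p + contorsion Y (J X) Z p = - contorsion X Y (J Z) p - contorsion Y X (J Z) p"
proof -
  have diag: "contorsion X (J X) Z p = - contorsion X X (J Z) p" if "X \<in> V" for X
    using that assms by (simp add: contorsion_def nab_J D_J G_J_left flip: J_diff)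
  show ?thesis
    using diag[of "X + Y"] diag[of X] diag[of Y] assms
    by (simp add: J_add contorsion_add)
qed

lemma G_T: 
  assumes "X \<in> V" "Y \<in> V" "Z \<in> V"
  shows "G (T X Y) Z p = contorsion X Y Z p - contorsion Y X Z p"
  using assms by (simp add: T_def br_def contorsion_def G_diff)

lemma contorsion_torsion_type:
  assumes "X \<in> V" "Y \<in> V" "Z \<in> V"
  shows "contorsion (J X) Y Z p - contorsion Y (J X) Z p = contorsion X (J Y) Z p - contorsion (J Y) X Z p"
  using G_T[of "J X" Y Z p] G_T[of X "J Y" Z p] T_J_left[of X Y] assms by simp

text \<open>
  Twice the part of the contorsion that commutes with \<open>J\<close>, composed with \<open>J\<close>, is the form \<open>q\<close> below;
  the type condition on the torsion kills it. The skew-symmetry facts would loop as rewrite rules,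
  therefore \<open>no_asm_use\<close>: they are only combined by linear arithmetic.
\<close>

lemma contorsion_J_23:
  assumes "X \<in> V" "Y \<in> V" "Z \<in> V"
  shows "contorsion X (J Y) Z p = contorsion X Y (J Z) p"
proof -
  define q where "q X Y Z = contorsion X (J Y) Z p - contorsion X Y (J Z) p" for X Y Z
  \<comment> \<open>The part of \<open>q\<close> whose first two arguments have opposite type; by
    \<open>Q_J\<close> a J moves between any two slots at the cost of a sign.\<close>
  define Q where "Q X Y Z = q (J X) (J Y) Z + q X Y Z" for X Y Z
  have q_sym: "q X Y Z = q X Z Y" if "X \<in> V" "Y \<in> V" "Z \<in> V" for X Y Z
    using contorsion_skew23[of X "J Y" Z p] contorsion_skew23[of X Y "J Z" p] that by (simp add: q_def)
  have q_minus: "q (- X) Y Z = - q X Y Z" "q X (- Y) Z = - q X Y Z" "q X Y (- Z) = - q X Y Z"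
    if "X \<in> V" "Y \<in> V" "Z \<in> V" for X Y Z
    using that by (simp_all add: q_def)
  have q_J: "q X Y (J Z) = - q X (J Y) Z" if "X \<in> V" "Y \<in> V" "Z \<in> V" for X Y Z
    using that by (simp add: q_def)
  have Q_skew: "Q X Y Z = - Q Y X Z" if "X \<in> V" "Y \<in> V" "Z \<in> V" for X Y Z
    using contorsion_torsion_type[of X Y Z p] contorsion_J_polarized[of X Y Z p] contorsion_J_polarized[of "J X" "J Y" Z p]
    by (simp (no_asm_use) add: that Q_def q_def)
  have Q_J: "Q X Y (J Z) = - Q X (J Y) Z" "Q (J X) Y Z = - Q X (J Y) Z"
    if "X \<in> V" "Y \<in> V" "Z \<in> V" for X Y Z
    using that by (simp_all add: Q_def q_J q_minus)
  have Q_0: "Q X Y Z = 0" if "X \<in> V" "Y \<in> V" "Z \<in> V" for X Y Z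
  proof -
    have minus: "Q X (- Y) Z = - Q X Y Z" if "X \<in> V" "Y \<in> V" "Z \<in> V" for X Y Z
      using that by (simp add: Q_def q_minus)
    \<comment> \<open>Q(X, Y, JW) equals -Q(X, JY, W) directly. Exchanging X and Y before moving J,
      and then once more, gives +Q(X, JY, W).\<close>
    have "Q X (J Y) W = 0" if "W \<in> V" for W
      using Q_skew[of X Y "J W"] Q_skew[of "J X" Y W] Q_J(1)[of X Y W] Q_J(1)[of Y X W] Q_J(2)[of X Y W]
    by (simp (no_asm_use) add: that \<open>X \<in> V\<close> \<open>Y \<in> V\<close>)
    then show ?thesis using Q_J(1)[of X Y "J Z"] that by (simp add: Q_def q_minus)
  qed
  have qJ1: "q X (J Y) Z = q (J X) Y Z" if "X \<in> V" "Y \<in> V" "Z \<in> V" for X Y Z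
    using Q_0[of X "J Y" Z] that by (simp add: Q_def q_minus)
  \<comment> \<open>Now J also passes freely between the first two slots. As \<open>q\<close> is
    symmetric in the last two, J travels from slot two through slot one to slot three without a
    sign, against \<open>q_J\<close>.\<close>
  have "q X (J Y) Z = 0" if "X \<in> V" "Y \<in> V" "Z \<in> V" for X Y Z
    using q_J[of X Y Z] q_sym[of X Y "J Z"] qJ1[of X Z Y] qJ1[of X Y Z] q_sym[of "J X" Y Z]
    by (simp (no_asm_use) add: that)
  from this[of X "- J Y" Z] have "q X Y Z = 0" using assms by simp
  then show ?thesis by (simp add: q_def)
qed

text \<open>With \<open>contorsion_J_23\<close> the two sides of
  \<open>contorsion_J_polarized\<close> are negatives of each other, so both vanish. This is
  skewness in the first two arguments after inserting J, and skewness in the last two is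
  known.\<close>

lemma contorsion_cyclic:
  assumes "X \<in> V" "Y \<in> V" "Z \<in> V"
  shows "contorsion X Y Z p = contorsion Z X Y p"
proof -
  have "contorsion X (J Y) Z p = - contorsion Y (J X) Z p" if "X \<in> V" "Y \<in> V" "Z \<in> V" for X Y Z
    using contorsion_J_polarized[of X Y Z p] contorsion_J_23[of X Y Z p] contorsion_J_23[of Y X Z p] that by simp
  from this[of X "J Y" Z] this[of "J Y" Z X]
  show ?thesis using contorsion_J_23[of "J Y" X Z p] contorsion_skew23[of "J Y" X "J Z" p] contorsion_skew23[of Z X Y p]
    by (simp (no_asm_use) add: assms)
qed

definition t :: "'v \<Rightarrow> 'v \<Rightarrow> 'v \<Rightarrow> 'm \<Rightarrow> real" where
  "t X Y Z = G (T X Y) Z"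

text \<open>The torsion antisymmetrizes the contorsion in two arguments; on a totally skew form this
  doubles it.\<close>

lemma t_eq_a:
  assumes "X \<in> V" "Y \<in> V" "Z \<in> V"
  shows "t X Y Z p = 2 * contorsion X Y Z p"
  unfolding t_def using G_T[of X Y Z p] contorsion_cyclic[of X Y Z p] contorsion_skew23[of Z X Y p]
    contorsion_cyclic[of Y X Z p]
    by (simp (no_asm_use) add: assms)

lemma t_skew12:
  assumes "X \<in> V" "Y \<in> V" "Z \<in> V"
  shows "t X Y Z p = - t Y X Z p"
  using T_skew[of X Y] assms by (simp add: t_def)

lemma t_skew23:
  assumes "X \<in> V" "Y \<in> V" "Z \<in> V"
  shows "t X Y Z p = - t X Z Y p"
  using t_eq_a contorsion_skew23[OF assms, of p] assms by simp

lemma t_cyclic: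
  assumes "X \<in> V" "Y \<in> V" "Z \<in> V"
  shows "t X Y Z p = t Y Z X p"
  using t_skew12[OF assms, of p] t_skew23[OF assms(2,1,3), of p] by linarith

lemma t_J_left:
  assumes "X \<in> V" "Y \<in> V" "Z \<in> V"
  shows "t (J X) Y Z p = t X (J Y) Z p"
  using T_J_left assms by (simp add: t_def)

lemma t_J_right:
  assumes "X \<in> V" "Y \<in> V" "Z \<in> V"
  shows "t X (J Y) Z p = t X Y (J Z) p"
  using t_eq_a contorsion_J_23[of X Y Z p] assms by simp

text \<open>Together with \<open>T_J_left\<close>: pairs of (1,0)-vectors are sent to (0,1)-vectors,
  hence \<open>t\<close> has type (3,0) + (0,3).\<close>

lemma T_J: "T X (J Y) = - J (T X Y)" if "X \<in> V" "Y \<in> V"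
proof (rule G_ext)
  fix Z assume "Z \<in> V"
  then have "G (T X (J Y)) Z p = G (- J (T X Y)) Z p" for p
    using t_J_right[of X Y Z p] that by (simp add: t_def G_J_left)
  then show "G (T X (J Y)) Z = G (- J (T X Y)) Z" by blast
qed (use that in simp_all)

lemma G_T_left:
  assumes "X \<in> V" "Y \<in> V" "Z \<in> V"
  shows "G Z (T X Y) p = t X Y Z p"
  using G_sym[of Z "T X Y"] assms by (simp add: t_def)

text \<open>The Jacobi identity in which each bracket is replaced by nab A B - nab B A - T A B; the
  second derivatives assemble to curvature, the rest to derivatives and squares of the
  torsion.\<close>

lemma bianchi:
  assumes "X \<in> V" "Y \<in> V" "Z \<in> V"
  shows "R X Y Z + R Y Z X + R Z X Y =
    T (T X Y) Z + T (T Y Z) X + T (T Z X) Y + nabT X Y Z + nabT Y Z X + nabT Z X Y"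
proof -
  have br: "br A B = nab A B - nab B A - T A B" for A B
    by (simp add: T_def)
  have nn: "nab A (nab B C) - nab A (nab C B) = nab A (br B C) + nab A (T B C)"
    if "A \<in> V" "B \<in> V" "C \<in> V" for A B C
    using that by (simp add: T_def nab_diff2 br_def flip: nab_add2)
  have nb: "nab A (br B C) - nab (br B C) A = br A (br B C) + T A (br B C)" for A B C
    by (simp add: T_def)
  have Tb: "T A (br B C) = T A (nab B C) - T A (nab C B) - T A (T B C)"
    if "A \<in> V" "B \<in> V" "C \<in> V" for A B C
    using that by (simp add: br T_diff2)
  have jac: "br X (br Y Z) + br Y (br Z X) + br Z (br X Y) = 0"
    using jacobi[of X Y Z br] assms by (simp add: fun_eq_iff br_def)
  have "R X Y Z + R Y Z X + R Z X Y =
     (nab X (nab Y Z) - nab X (nab Z Y)) - nab (br Y Z) X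
   + (nab Y (nab Z X) - nab Y (nab X Z)) - nab (br Z X) Y
   + (nab Z (nab X Y) - nab Z (nab Y X)) - nab (br X Y) Z"
    by (simp add: R_def)
  also have "\<dots> = (nab X (br Y Z) - nab (br Y Z) X) + nab X (T Y Z)
   + (nab Y (br Z X) - nab (br Z X) Y) + nab Y (T Z X)
   + (nab Z (br X Y) - nab (br X Y) Z) + nab Z (T X Y)"
    using assms by (simp add: nn)
  also have "\<dots> = (br X (br Y Z) + br Y (br Z X) + br Z (br X Y))
    + T X (br Y Z) + nab X (T Y Z) + T Y (br Z X) + nab Y (T Z X) + T Z (br X Y) + nab Z (T X Y)"
    unfolding nb by (simp add: algebra_simps)
  also have "\<dots> = T X (nab Y Z) - T X (nab Z Y) - T X (T Y Z) + nab X (T Y Z)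
    + T Y (nab Z X) - T Y (nab X Z) - T Y (T Z X) + nab Y (T Z X)
    + T Z (nab X Y) - T Z (nab Y X) - T Z (T X Y) + nab Z (T X Y)"
    using assms by (simp add: jac Tb)
  also have "\<dots> = T (T X Y) Z + T (T Y Z) X + T (T Z X) Y + nabT X Y Z + nabT Y Z X + nabT Z X Y"
    unfolding nabT_def T_skew[of "T X Y" Z] T_skew[of "T Y Z" X] T_skew[of "T Z X" Y]
      T_skew[of "nab X Y" Z] T_skew[of "nab Y Z" X] T_skew[of "nab Z X" Y]
    by (simp add: algebra_simps)
  finally show ?thesis .
qed


section \<open>Symmetries of the curvature\<close>

lemma br_minus:
  assumes "X \<in> V" "Y \<in> V"
  shows "br (- X) Y = - br X Y" and "br X (- Y) = - br X Y"
  using additive_on_V(1)[of "\<lambda>X. br X Y"] additive_on_V(1)[of "\<lambda>Y. br X Y"]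
    br_add1 br_add2 assms by auto

lemma R_minus [simp]:
  assumes "X \<in> V" "Y \<in> V" "Z \<in> V"
  shows "R (- X) Y Z = - R X Y Z" "R X (- Y) Z = - R X Y Z" "R X Y (- Z) = - R X Y Z"
  using assms by (simp_all add: R_def br_minus)

lemma R_skew: "X \<in> V \<Longrightarrow> Y \<in> V \<Longrightarrow> Z \<in> V \<Longrightarrow> R X Y Z = - R Y X Z"
  using br_skew[of X Y] by (simp add: R_def)

lemma R_J: "X \<in> V \<Longrightarrow> Y \<in> V \<Longrightarrow> Z \<in> V \<Longrightarrow> R X Y (J Z) = J (R X Y Z)"
  by (simp add: R_def nab_J J_diff)

definition Rm :: "'v \<Rightarrow> 'v \<Rightarrow> 'v \<Rightarrow> 'v \<Rightarrow> 'm \<Rightarrow> real" where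
  "Rm X Y Z W = G (R X Y Z) W"

lemma Rm_minus [simp]:
  assumes "X \<in> V" "Y \<in> V" "Z \<in> V" "W \<in> V"
  shows "Rm (- X) Y Z W = - Rm X Y Z W" "Rm X (- Y) Z W = - Rm X Y Z W"
    "Rm X Y (- Z) W = - Rm X Y Z W" "Rm X Y Z (- W) = - Rm X Y Z W"
  using assms by (simp_all add: Rm_def)

lemma Rm_skew12:
  assumes "X \<in> V" "Y \<in> V" "Z \<in> V" "W \<in> V"
  shows "Rm X Y Z W p = - Rm Y X Z W p"
  using assms R_skew[of X Y Z] by (simp add: Rm_def)

text \<open>\<open>der_bracket\<close> is applied to the function \<open>G Z W\<close> and expanded
  by metricity; the products of two first covariant derivatives cancel.\<close>

lemma Rm_skew34:
  assumes "X \<in> V" "Y \<in> V" "Z \<in> V" "W \<in> V"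
  shows "Rm X Y Z W p = - Rm X Y W Z p"
proof -
  have "der (br X Y) (G Z W) = der X (der Y (G Z W)) - der Y (der X (G Z W))"
    unfolding br_def using assms by (rule der_bracket)
  then have "G (nab (br X Y) Z) W + G Z (nab (br X Y) W)
    = G (nab X (nab Y Z)) W + G (nab Y Z) (nab X W) + (G (nab X Z) (nab Y W) + G Z (nab X (nab Y W)))
     - (G (nab Y (nab X Z)) W + G (nab X Z) (nab Y W) + (G (nab Y Z) (nab X W) + G Z (nab Y (nab X W))))"
    using assms by (simp add: nab_metric der_add)
  moreover have "Rm X Y Z W + G Z (R X Y W)
    = G (nab X (nab Y Z)) W - G (nab Y (nab X Z)) W - G (nab (br X Y) Z) W
      + (G Z (nab X (nab Y W)) - G Z (nab Y (nab X W)) - G Z (nab (br X Y) W))"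
    using assms by (simp add: Rm_def R_def G_diff G_diff2)
  ultimately have "Rm X Y Z W + G Z (R X Y W) = 0"
    by (simp add: algebra_simps)
  then have "Rm X Y Z W p + G Z (R X Y W) p = 0"
    by (metis plus_fun_apply zero_fun_apply)
  moreover have "G Z (R X Y W) = Rm X Y W Z"
    using assms by (simp add: Rm_def G_sym)
  ultimately show ?thesis by simp
qed

text \<open>R preserves type. This rule and its analogues \<open>N_J\<close> and \<open>S_J\<close>
  push J towards a fixed slot (the third for \<open>Rm\<close>, the second for \<open>N\<close>, the
  first for \<open>S\<close>), so that combinations of Bianchi identities become linear arithmetic
  in a few atoms.\<close>

lemma Rm_J [simp]:
  assumes "X \<in> V" "Y \<in> V" "Z \<in> V" "W \<in> V"
  shows "Rm X Y Z (J W) = - Rm X Y (J Z) W"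
  using assms by (simp add: Rm_def R_J G_J_left)

section \<open>The covariant derivative of the torsion\<close>

definition N :: "'v \<Rightarrow> 'v \<Rightarrow> 'v \<Rightarrow> 'v \<Rightarrow> 'm \<Rightarrow> real" where
  "N X Y Z W = G (nabT X Y Z) W"

lemma nabT_minus [simp]:
  assumes "X \<in> V" "Y \<in> V" "Z \<in> V"
  shows "nabT (- X) Y Z = - nabT X Y Z" "nabT X (- Y) Z = - nabT X Y Z"
    "nabT X Y (- Z) = - nabT X Y Z"
  using assms by (simp_all add: nabT_def)

lemma nabT_skew: "X \<in> V \<Longrightarrow> Y \<in> V \<Longrightarrow> Z \<in> V \<Longrightarrow> nabT X Y Z = - nabT X Z Y"
  using T_skew[of Y Z] T_skew[of Y "nab X Z"] T_skew[of Z "nab X Y"] by (simp add: nabT_def)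

lemma nabT_J: "X \<in> V \<Longrightarrow> Y \<in> V \<Longrightarrow> Z \<in> V \<Longrightarrow> nabT X (J Y) Z = - J (nabT X Y Z)"
  and nabT_J': "X \<in> V \<Longrightarrow> Y \<in> V \<Longrightarrow> Z \<in> V \<Longrightarrow> nabT X Y (J Z) = - J (nabT X Y Z)"
  by (simp_all add: nabT_def T_J_left T_J nab_J J_diff)

lemma N_minus [simp]:
  assumes "X \<in> V" "Y \<in> V" "Z \<in> V" "W \<in> V"
  shows "N (- X) Y Z W = - N X Y Z W" "N X (- Y) Z W = - N X Y Z W"
    "N X Y (- Z) W = - N X Y Z W" "N X Y Z (- W) = - N X Y Z W"
  using assms by (simp_all add: N_def)

lemma N_J [simp]:
  assumes "X \<in> V" "Y \<in> V" "Z \<in> V" "W \<in> V"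
  shows "N X Y (J Z) W = N X (J Y) Z W" "N X Y Z (J W) = N X (J Y) Z W"
  using assms by (simp_all add: N_def nabT_J nabT_J' G_J_left)

lemma N_skew23:
  assumes "X \<in> V" "Y \<in> V" "Z \<in> V" "W \<in> V"
  shows "N X Y Z W p = - N X Z Y W p"
  using assms nabT_skew[of X Y Z] by (simp add: N_def)

lemma N_skew34:
  assumes "X \<in> V" "Y \<in> V" "Z \<in> V" "W \<in> V"
  shows "N X Y Z W p = - N X Y W Z p"
proof -
  have N: "N X Y Z W p = der X (t Y Z W) p - t (nab X Y) Z W p - t Y (nab X Z) W p - t Y Z (nab X W) p"
    if "Z \<in> V" "W \<in> V" for Z W
    using that assms by (simp add: N_def nabT_def t_def nab_metric G_diff)
  \<comment> \<open>\<open>der\<close> is controlled only on functions of the form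
    \<open>G A B\<close>, so the sign has to be carried by an argument of \<open>G\<close>.\<close>
  have "G (T Y Z) W p = G (- T Y W) Z p" for p
    using t_skew23[of Y Z W p] assms by (simp add: t_def)
  then have "t Y Z W = G (- T Y W) Z"
    by (auto simp: t_def)
  then have "der X (t Y Z W) = G (nab X (- T Y W)) Z + G (- T Y W) (nab X Z)"
    using nab_metric[of X "- T Y W" Z] assms by simp
  then have "der X (t Y Z W) p = - der X (t Y W Z) p"
    using assms by (simp add: t_def nab_metric)
  then show ?thesis
    using N[of Z W] N[of W Z] t_skew23[of "nab X Y" Z W p] t_skew23[of Y "nab X Z" W p]
      t_skew23[of Y Z "nab X W" p]
    by (simp (no_asm_use) add: assms)
qed

definition S :: "'v \<Rightarrow> 'v \<Rightarrow> 'v \<Rightarrow> 'v \<Rightarrow> 'm \<Rightarrow> real" where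
  "S X Y Z W = G (T X Y) (T Z W)"

lemma S_minus [simp]:
  assumes "X \<in> V" "Y \<in> V" "Z \<in> V" "W \<in> V"
  shows "S (- X) Y Z W = - S X Y Z W" "S X (- Y) Z W = - S X Y Z W"
    "S X Y (- Z) W = - S X Y Z W" "S X Y Z (- W) = - S X Y Z W"
  using assms by (simp_all add: S_def)

lemma S_J [simp]:
  assumes "X \<in> V" "Y \<in> V" "Z \<in> V" "W \<in> V"
  shows "S X (J Y) Z W = S (J X) Y Z W" "S X Y (J Z) W = - S (J X) Y Z W"
    "S X Y Z (J W) = - S (J X) Y Z W"
  using assms by (simp_all add: S_def T_J_left T_J G_J_left)

lemma S_symmetries:
  assumes "X \<in> V" "Y \<in> V" "Z \<in> V" "W \<in> V"
  shows "S X Y Z W p = - S Y X Z W p" "S X Y Z W p = - S X Y W Z p" "S X Y Z W p = S Z W X Y p"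
  using assms T_skew[of X Y] T_skew[of Z W] by (simp_all add: S_def G_sym)

text \<open>Cyclicity of the 3-form turns the quadratic torsion terms of the Bianchi identity into
  inner products of torsion vectors, whose symmetries are evident.\<close>

lemma G_T_T:
  assumes "X \<in> V" "Y \<in> V" "Z \<in> V" "W \<in> V"
  shows "G (T (T X Y) Z) W p = S X Y Z W p"
  using t_cyclic[of "T X Y" Z W p] G_sym[of "T X Y" "T Z W"] assms by (simp add: t_def S_def)

lemma bianchi_metric:
  assumes "X \<in> V" "Y \<in> V" "Z \<in> V" "W \<in> V"
  shows "Rm X Y Z W p + Rm Y Z X W p + Rm Z X Y W p =
    S X Y Z W p + S Y Z X W p + S Z X Y W p + N X Y Z W p + N Y Z X W p + N Z X Y W p"
proof -
  have "G (R X Y Z + R Y Z X + R Z X Y) W p =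
    G (T (T X Y) Z + T (T Y Z) X + T (T Z X) Y + nabT X Y Z + nabT Y Z X + nabT Z X Y) W p"
    using assms by (simp add: bianchi)
  then show ?thesis
    using assms by (simp add: G_add G_T_T N_def Rm_def)
qed

text \<open>
  The eight instances of the Bianchi identity add up to the real part of that identity at
  \<open>X - iJX\<close>, \<open>Y - iJY\<close>, \<open>Z + iJZ\<close>, \<open>W - iJW\<close>, respectively with the types of the last two
  arguments exchanged.
\<close>

lemma N_typed_eq_0:
  assumes "X \<in> V" "Y \<in> V" "Z \<in> V" "W \<in> V"
  shows "N X Y Z W p + N (J X) (J Y) Z W p = 0"
proof -
  \<comment> \<open>\<open>N\<close> with the direction of differentiation of one type and the other
    arguments of the opposite type.\<close>
  define M where "M Z X Y W = N Z X Y W p + N (J Z) (J X) Y W p" for Z X Y W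
  define \<Theta> where "\<Theta> X Y Z W = Rm X Y Z W p - Rm (J X) (J Y) Z W p
     + Rm (J X) Y (J Z) W p + Rm X (J Y) (J Z) W p" for X Y Z W
  \<comment> \<open>\<open>\<Theta>\<close> is the real part of \<open>Rm\<close> on types (1,0),
    (1,0), (0,1). With W of type (1,0), type reasons leave only this curvature term and the
    derivative of the torsion along Z; the products \<open>S\<close> all vanish.\<close>
  have \<Theta>_M: "\<Theta> X Y Z W = 2 * M Z X Y W" if "X \<in> V" "Y \<in> V" "Z \<in> V" "W \<in> V" for X Y Z W
    using bianchi_metric[of X Y Z W p] bianchi_metric[of "J X" "J Y" Z W p]
      bianchi_metric[of "J X" Y "J Z" W p] bianchi_metric[of X "J Y" "J Z" W p]
      bianchi_metric[of "J X" Y Z "J W" p] bianchi_metric[of X "J Y" Z "J W" p]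
      bianchi_metric[of X Y "J Z" "J W" p] bianchi_metric[of "J X" "J Y" "J Z" "J W" p]
    by (simp (no_asm_use) add: that \<Theta>_def M_def)
  \<comment> \<open>Now X, Y, Z have type (1,0) and W has type (0,1): neither the torsion products
    nor its derivatives survive, and skewness moves W into the third slot.\<close>
  have \<Theta>_cyclic: "\<Theta> X Y W Z + \<Theta> Y Z W X + \<Theta> Z X W Y = 0"
    if "X \<in> V" "Y \<in> V" "Z \<in> V" "W \<in> V" for X Y Z W
    using bianchi_metric[of X Y Z W p] bianchi_metric[of "J X" "J Y" Z W p]
      bianchi_metric[of "J X" Y "J Z" W p] bianchi_metric[of X "J Y" "J Z" W p]
      bianchi_metric[of "J X" Y Z "J W" p] bianchi_metric[of X "J Y" Z "J W" p]
      bianchi_metric[of X Y "J Z" "J W" p] bianchi_metric[of "J X" "J Y" "J Z" "J W" p]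
      Rm_skew34[of X Y Z W p] Rm_skew34[of Y Z X W p] Rm_skew34[of Z X Y W p]
      Rm_skew34[of "J X" "J Y" Z W p] Rm_skew34[of "J Y" "J Z" X W p] Rm_skew34[of "J Z" "J X" Y W p]
      Rm_skew34[of "J X" Y Z "J W" p] Rm_skew34[of "J Y" Z X "J W" p] Rm_skew34[of "J Z" X Y "J W" p]
      Rm_skew34[of X "J Y" Z "J W" p] Rm_skew34[of Y "J Z" X "J W" p] Rm_skew34[of Z "J X" Y "J W" p]
    by (simp (no_asm_use) add: that \<Theta>_def)
  have M_cyclic: "M Z X Y W = M Z Y W X" if "X \<in> V" "Y \<in> V" "Z \<in> V" "W \<in> V" for X Y Z W
    using N_skew23[of Z X Y W p] N_skew34[of Z Y X W p]
      N_skew23[of "J Z" "J X" Y W p] N_skew34[of "J Z" Y "J X" W p]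
    by (simp (no_asm_use) add: that M_def)
  \<comment> \<open>By \<open>\<Theta>_M\<close> and \<open>M_cyclic\<close> the three summands of
    \<open>\<Theta>_cyclic\<close> are equal, so each of them is zero.\<close>
  have "M W X Y Z = 0" if "X \<in> V" "Y \<in> V" "Z \<in> V" "W \<in> V" for X Y Z W
    using \<Theta>_cyclic[of X Y Z W] \<Theta>_M[of X Y W Z] \<Theta>_M[of Y Z W X] \<Theta>_M[of Z X W Y]
      M_cyclic[of X Y W Z] M_cyclic[of Y Z W X]
    by (simp (no_asm_use) add: that)
  from this[of Y Z W X] show ?thesis using assms by (simp add: M_def)
qed

text \<open>After \<open>N_typed_eq_0\<close> only the component with all four arguments of one type
  remains. There the metric annihilates the curvature terms and the products \<open>S\<close>, since
  it pairs opposite types, and the Bianchi identity says that the cyclic sum of \<open>N\<close> is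
  zero.\<close>

lemma N_eq_0:
  assumes "X \<in> V" "Y \<in> V" "Z \<in> V" "W \<in> V"
  shows "N X Y Z W p = 0"
proof -
  have N: "N (J X) (J Y) Z W p = - N X Y Z W p" if "X \<in> V" "Y \<in> V" "Z \<in> V" "W \<in> V" for X Y Z W
    using N_typed_eq_0[OF that, of p] by simp
  have cyc: "N X Y Z W p + N Y Z X W p + N Z X Y W p = 0"
    if "X \<in> V" "Y \<in> V" "Z \<in> V" "W \<in> V" for X Y Z W
    using bianchi_metric[of X Y Z W p] bianchi_metric[of "J X" "J Y" Z W p]
      bianchi_metric[of "J X" Y "J Z" W p] bianchi_metric[of X "J Y" "J Z" W p]
      bianchi_metric[of "J X" Y Z "J W" p] bianchi_metric[of X "J Y" Z "J W" p]
      bianchi_metric[of X Y "J Z" "J W" p] bianchi_metric[of "J X" "J Y" "J Z" "J W" p]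
      N[of X Y Z W] N[of Y Z X W] N[of Z X Y W]
    by (simp (no_asm_use) add: that)
  \<comment> \<open>Skewness in the last three arguments leaves four unknowns, one for each choice
    of the direction of differentiation. The four instances of \<open>cyc\<close>, one for each
    argument kept last, have only the zero solution.\<close>
  have "N Y Z X W p = - N Y X Z W p" "N X Y W Z p = - N X Y Z W p"
    "N Y W X Z p = N Y X Z W p" "N X Z W Y p = N X Y Z W p" "N Z W X Y p = N Z X Y W p"
    "N W X Z Y p = - N W X Y Z p" 
    using N_skew23[of Y Z X W p] N_skew34[of X Y W Z p] N_skew23[of Y W X Z p] N_skew34[of Y X W Z p]
      N_skew34[of X Z W Y p] N_skew23[of X Z Y W p] N_skew23[of Z W X Y p] N_skew34[of Z X W Y p]
      N_skew34[of W X Z Y p]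
    by (simp_all (no_asm_use) add: assms)
  moreover have "N Y Z W X p = N Y X Z W p" "N Z W Y X p = - N Z X Y W p" "N W Y Z X p = N W X Y Z p"
    using N_skew34[of Y Z W X p] N_skew23[of Y Z X W p] N_skew34[of Z W Y X p] N_skew23[of Z W X Y p]
      N_skew34[of Z X W Y p] N_skew34[of W Y Z X p] N_skew23[of W Y X Z p]
    by (simp_all (no_asm_use) add: assms)
  ultimately show ?thesis
    using cyc[OF assms(1,2,3,4)] cyc[OF assms(1,2,4,3)] cyc[OF assms(1,3,4,2)] cyc[OF assms(2,3,4,1)]
    by linarith
qed

section \<open>Consequences of parallel torsion\<close>

lemma nabT_eq_0:
  assumes "X \<in> V" "Y \<in> V" "Z \<in> V"
  shows "nabT X Y Z = 0"
proof -
  have "G (nabT X Y Z) (nabT X Y Z) p = 0" for p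
    using N_eq_0[of X Y Z "nabT X Y Z" p] assms by (simp add: N_def)
  then have "G (nabT X Y Z) (nabT X Y Z) = 0"
    by (simp add: fun_eq_iff)
  then show ?thesis using assms by (simp add: G_definite)
qed

lemma nab_T:
  assumes "X \<in> V" "Y \<in> V" "Z \<in> V"
  shows "nab X (T Y Z) = T (nab X Y) Z + T Y (nab X Z)"
  using nabT_eq_0[OF assms] by (simp add: nabT_def algebra_simps)

lemma R_T:
  assumes "X \<in> V" "Y \<in> V" "Z \<in> V" "W \<in> V"
  shows "R X Y (T Z W) = T (R X Y Z) W + T Z (R X Y W)"
  using assms by (simp add: R_def nab_T nab_add2 T_diff1 T_diff2)

lemma der_t:
  assumes "W \<in> V" "X \<in> V" "Y \<in> V" "Z \<in> V"
  shows "der W (t X Y Z) = t (nab W X) Y Z + t X (nab W Y) Z + t X Y (nab W Z)"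
  using assms by (simp add: t_def nab_metric nab_T G_add)

text \<open>\<open>R X Y\<close> acts on the parallel \<open>T\<close> as a derivation, and its
  skewness moves the action on the value of \<open>T\<close> to the third argument.\<close>

lemma R_t:
  assumes "X \<in> V" "Y \<in> V" "A \<in> V" "B \<in> V" "C \<in> V"
  shows "t (R X Y A) B C p + t A (R X Y B) C p + t A B (R X Y C) p = 0"
proof -
  have "G (R X Y (T A B)) C p = - G (T A B) (R X Y C) p"
    using Rm_skew34[of X Y "T A B" C p] assms by (simp add: Rm_def G_sym)
  then show ?thesis
    using assms by (simp add: t_def R_T G_add)
qed

text \<open>
  The octahedron argument: the right-hand side of the Bianchi identity has become a 4-form.
\<close>

lemma Rm_pair:
  assumes "X \<in> V" "Y \<in> V" "Z \<in> V" "W \<in> V"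
  shows "Rm X Y Z W p = Rm Z W X Y p"
proof -
  have b: "Rm X Y Z W p + Rm Y Z X W p + Rm Z X Y W p = S X Y Z W p + S Y Z X W p + S Z X Y W p"
    if "X \<in> V" "Y \<in> V" "Z \<in> V" "W \<in> V" for X Y Z W
    using bianchi_metric[OF that, of p] that by (simp add: N_eq_0)
  have "Rm Y Z W X p = - Rm Y Z X W p" "Rm Z W Y X p = - Rm Z W X Y p" "Rm W Y Z X p = - Rm Y W Z X p"
    "Rm X Y W Z p = - Rm X Y Z W p" "Rm W X Y Z p = - Rm X W Y Z p" "Rm Y W X Z p = - Rm Y W Z X p"
    using assms by (simp_all add: Rm_skew12[of W] Rm_skew34[of Y Z W] Rm_skew34[of Z W Y]
      Rm_skew34[of X Y W] Rm_skew34[of Y W X])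
  moreover have "Rm W X Z Y p = Rm X W Y Z p" "Rm X Z W Y p = Rm Z X Y W p"
    using Rm_skew12[of W X Z Y p] Rm_skew34[of X W Z Y p] Rm_skew12[of X Z W Y p] Rm_skew34[of Z X W Y p]
    by (simp_all (no_asm_use) add: assms)
  moreover have "S Y Z W X p = - S Y Z X W p" "S Z W Y X p = - S X Y Z W p" "S W Y Z X p = - S Z X Y W p"
    "S Z W X Y p = S X Y Z W p" "S X Y W Z p = - S X Y Z W p" 
    using S_symmetries[of Y Z W X p] S_symmetries[of Z W Y X p] S_symmetries[of Z W X Y p] 
       S_symmetries[of X Y W Z p] S_symmetries[of W Y Z X p] S_symmetries[of Z X Y W p]
       S_symmetries[of Y W Z X p] 
    by (simp_all (no_asm_use) add: assms)
  moreover have "S W X Z Y p = S Y Z X W p" "S X Z W Y p = S Z X Y W p" "S W X Y Z p = - S Y Z X W p"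
     "S Y W X Z p = - S Z X Y W p"
    using S_symmetries[of W X Z Y p] S_symmetries[of Z Y W X p] S_symmetries[of Z Y X W p] 
       S_symmetries[of X Z W Y p] S_symmetries[of Z X W Y p] S_symmetries[of W X Y Z p]
       S_symmetries[of Y Z W X p] S_symmetries[of Y W X Z p] S_symmetries[of X Z Y W p] 
    by (simp_all (no_asm_use) add: assms)
  ultimately show ?thesis
    using b[OF assms(1,2,3,4)] b[OF assms(2,3,4,1)] b[OF assms(3,4,1,2)] b[OF assms(4,1,2,3)]
    by linarith
qed

end

section \<open>Vector fields on an open set of a nearly Kaehler manifold\<close>

lemma affine_connectionD:
  assumes "affine_connection A nab" "open U" "vfield A U Y" "vfield A U Y'" "p \<in> U" "u \<in> tangent A p" "v \<in> tangent A p"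
  shows "nab p v Y \<in> tangent A p"
    and "nab p (u + v) Y = nab p u Y + nab p v Y"
    and "(\<And>q. q \<in> U \<Longrightarrow> Y q = Y' q) \<Longrightarrow> nab p v Y = nab p v Y'"
    and "nab p v (Y + Y') = nab p v Y + nab p v Y'"
proof -
  note aff = assms(1)[unfolded affine_connection_def]
  show "nab p v Y \<in> tangent A p"
    using conjunct1[OF aff] assms by blast
  show "nab p (u + v) Y = nab p u Y + nab p v Y"
    using conjunct1[OF conjunct2[OF aff]] assms by blast
  show "nab p v Y = nab p v Y'" if "\<And>q. q \<in> U \<Longrightarrow> Y q = Y' q"
    using conjunct1[OF conjunct2[OF conjunct2[OF conjunct2[OF aff]]]] assms that by blast
  show "nab p v (Y + Y') = nab p v Y + nab p v Y'"
    using conjunct1[OF conjunct2[OF conjunct2[OF conjunct2[OF conjunct2[OF aff]]]]] assms by blast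
qed

locale canonical_nearly_kaehler = smooth_manifold A
  for A :: "('m::topological_space, 'n::finite) chart set" +
  fixes J :: "('m, 'n) endo" and g :: "('m, 'n) form2" and D nab :: "('m, 'n) conn"
  assumes hermitian: "almost_hermitian A J g"
    and levi: "levi_civita A g D"
    and nearly: "\<And>U X p. open U \<Longrightarrow> vfield A U X \<Longrightarrow> p \<in> U \<Longrightarrow> cov_endo D J X X p = 0"
    and canonical: "canonical_connection A J g nab"
begin

lemma almost_complex: "almost_complex A J" and riemannian: "riemannian_metric A g"
  using hermitian by (simp_all add: almost_hermitian_def)

lemma J_tangent [simp]: "v \<in> tangent A p \<Longrightarrow> J p v \<in> tangent A p"
  and J_J_tangent [simp]: "v \<in> tangent A p \<Longrightarrow> J p (J p v) = - v"
  and J_add_tangent: "u \<in> tangent A p \<Longrightarrow> v \<in> tangent A p \<Longrightarrow> J p (u + v) = J p u + J p v"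
  and J_tscale: "v \<in> tangent A p \<Longrightarrow> J p (tscale a v) = tscale a (J p v)"
  and vfield_J: "open U \<Longrightarrow> vfield A U X \<Longrightarrow> vfield A U (app J X)"
  using almost_complex by (simp_all add: almost_complex_def)

lemma tscale_minus_one: "tscale (- 1) v = - v"
  by (simp add: tscale_def fun_eq_iff)

lemma J_uminus: "v \<in> tangent A p \<Longrightarrow> J p (- v) = - J p v"
  using J_tscale[of v p "- 1"] by (simp add: tscale_minus_one)

lemma g_sym: "u \<in> tangent A p \<Longrightarrow> v \<in> tangent A p \<Longrightarrow> g p u v = g p v u"
  using conjunct1[OF riemannian[unfolded riemannian_metric_def]] by blast

lemma g_add: "u \<in> tangent A p \<Longrightarrow> v \<in> tangent A p \<Longrightarrow> w \<in> tangent A p \<Longrightarrow> g p (u + v) w = g p u w + g p v w"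
  using conjunct1[OF conjunct2[OF riemannian[unfolded riemannian_metric_def]]] by blast

lemma g_tscale: "u \<in> tangent A p \<Longrightarrow> v \<in> tangent A p \<Longrightarrow> g p (tscale a u) v = a * g p u v"
  using conjunct1[OF conjunct2[OF conjunct2[OF riemannian[unfolded riemannian_metric_def]]]] by simp

lemma g_pos: "v \<in> tangent A p \<Longrightarrow> v \<noteq> 0 \<Longrightarrow> g p v v > 0"
  using conjunct1[OF conjunct2[OF conjunct2[OF conjunct2[OF riemannian[unfolded riemannian_metric_def]]]]]
  by simp

lemma smooth_fun_g: "open U \<Longrightarrow> vfield A U X \<Longrightarrow> vfield A U Y \<Longrightarrow> smooth_fun A U (\<lambda>p. g p (X p) (Y p))"
  using conjunct2[OF conjunct2[OF conjunct2[OF conjunct2[OF riemannian[unfolded riemannian_metric_def]]]]]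
  by simp

lemma g_J: "u \<in> tangent A p \<Longrightarrow> v \<in> tangent A p \<Longrightarrow> g p (J p u) (J p v) = g p u v"
  using hermitian by (simp add: almost_hermitian_def)

lemma affine_D: "affine_connection A D" and affine_nab: "affine_connection A nab"
  using levi canonical by (simp_all add: levi_civita_def canonical_connection_def)

lemma metric_D: "\<lbrakk>open U; vfield A U X; vfield A U Y; vfield A U Z; p \<in> U\<rbrakk> \<Longrightarrow>
    dirderiv A p (X p) (\<lambda>q. g q (Y q) (Z q)) = g p (covd D X Y p) (Z p) + g p (Y p) (covd D X Z p)"
  and metric_nab: "\<lbrakk>open U; vfield A U X; vfield A U Y; vfield A U Z; p \<in> U\<rbrakk> \<Longrightarrow>
    dirderiv A p (X p) (\<lambda>q. g q (Y q) (Z q)) = g p (covd nab X Y p) (Z p) + g p (Y p) (covd nab X Z p)"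
  using levi canonical
  by (simp_all add: levi_civita_def canonical_connection_def metric_connection_def)

lemma lie_bracket_D: "\<lbrakk>open U; vfield A U X; vfield A U Y; p \<in> U\<rbrakk> \<Longrightarrow>
    lie_bracket A X Y p = covd D X Y p - covd D Y X p"
  using levi by (simp add: levi_civita_def torsion_def)

lemma nab_J_fields: "\<lbrakk>open U; vfield A U X; vfield A U Y; p \<in> U\<rbrakk> \<Longrightarrow>
    covd nab X (app J Y) p = J p (covd nab X Y p)"
  using canonical by (simp add: canonical_connection_def cov_endo_def app_def)

lemma D_J_fields: "\<lbrakk>open U; vfield A U X; p \<in> U\<rbrakk> \<Longrightarrow> covd D X (app J X) p = J p (covd D X X p)"
  using nearly[of U X p] by (simp add: cov_endo_def app_def)

text \<open>\<open>field_algebra\<close> states its laws as equations between whole fields, but the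
  geometric hypotheses only speak about points of \<open>U\<close>. Extension by zero makes the two
  agree.\<close>

definition restr :: "'m set \<Rightarrow> ('m, 'n) field \<Rightarrow> ('m, 'n) field" where
  "restr U X = (\<lambda>p. if p \<in> U then X p else 0)"

definition V :: "'m set \<Rightarrow> ('m, 'n) field set" where
  "V U = {X. vfield A U X \<and> restr U X = X}"

definition J' :: "'m set \<Rightarrow> ('m, 'n) field \<Rightarrow> ('m, 'n) field" where
  "J' U X = restr U (app J X)"

definition G' :: "'m set \<Rightarrow> ('m, 'n) field \<Rightarrow> ('m, 'n) field \<Rightarrow> 'm \<Rightarrow> real" where
  "G' U X Y = (\<lambda>p. if p \<in> U then g p (X p) (Y p) else 0)"

definition der' :: "'m set \<Rightarrow> ('m, 'n) field \<Rightarrow> ('m \<Rightarrow> real) \<Rightarrow> 'm \<Rightarrow> real" where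
  "der' U X f = (\<lambda>p. if p \<in> U then dirderiv A p (X p) f else 0)"

definition D' :: "'m set \<Rightarrow> ('m, 'n) field \<Rightarrow> ('m, 'n) field \<Rightarrow> ('m, 'n) field" where
  "D' U X Y = restr U (covd D X Y)"

definition nab' :: "'m set \<Rightarrow> ('m, 'n) field \<Rightarrow> ('m, 'n) field \<Rightarrow> ('m, 'n) field" where
  "nab' U X Y = restr U (covd nab X Y)"

lemma vfield_restr: "open U \<Longrightarrow> vfield A U (restr U X) \<longleftrightarrow> vfield A U X"
  by (rule vfield_cong) (auto simp: restr_def)

lemma restr_in_V: "open U \<Longrightarrow> vfield A U X \<Longrightarrow> restr U X \<in> V U"
  by (simp add: V_def vfield_restr) (auto simp: restr_def)

lemma V_vfield: "X \<in> V U \<Longrightarrow> vfield A U X"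
  by (simp add: V_def)

lemma V_outside: "X p = 0" if "X \<in> V U" "p \<notin> U"
proof -
  have "restr U X = X" using that by (simp add: V_def)
  then have "X p = restr U X p" by simp
  also have "\<dots> = 0" using that by (simp add: restr_def)
  finally show ?thesis .
qed

lemma V_tangent: "X \<in> V U \<Longrightarrow> X p \<in> tangent A p"
  by (metis V_outside V_vfield tangent_0 vfield_tangent)

lemma VI: "vfield A U X \<Longrightarrow> (\<And>p. p \<notin> U \<Longrightarrow> X p = 0) \<Longrightarrow> X \<in> V U"
  by (auto simp: V_def restr_def)

lemma covd_cong:
  assumes "affine_connection A C" "open U" "vfield A U X" "vfield A U Y" "p \<in> U"
    and "X p = X' p" "\<And>q. q \<in> U \<Longrightarrow> Y q = Y' q"
  shows "covd C X Y p = covd C X' Y' p"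
  using affine_connectionD(3)[OF assms(1,2,4) vfield_cong[OF assms(2,7), THEN iffD1, OF _ assms(4)] assms(5)
      vfield_tangent[OF assms(3,5)] vfield_tangent[OF assms(3,5)]] assms(6,7)
  by (simp add: covd_def)

lemma vfield_covd:
  assumes "affine_connection A C" "open U" "vfield A U X" "vfield A U Y"
  shows "vfield A U (covd C X Y)"
  using conjunct2[OF conjunct2[OF conjunct2[OF conjunct2[OF conjunct2[OF conjunct2[OF
    assms(1)[unfolded affine_connection_def]]]]]]] assms(2-) by simp

text \<open>Writing the bracket by a torsion-free connection gives tangency and smoothness at once,
  without a study of how the coordinate formula transforms.\<close>

lemma vfield_lie_bracket:
  assumes "open U" "vfield A U X" "vfield A U Y"
  shows "vfield A U (lie_bracket A X Y)"
  by (rule vfield_cong[THEN iffD1, rotated -1, of _ "covd D X Y - covd D Y X"])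
    (use assms in \<open>auto simp: lie_bracket_D intro!: vfield_diff vfield_covd[OF affine_D]\<close>)

lemma torsion_cong:
  assumes "open U" "vfield A U X" "vfield A U Y" "p \<in> U"
    and "\<And>q. q \<in> U \<Longrightarrow> X q = X' q" "\<And>q. q \<in> U \<Longrightarrow> Y q = Y' q"
  shows "torsion A nab X Y p = torsion A nab X' Y' p"
proof -
  have "vfield A U X'" "vfield A U Y'"
    using assms vfield_cong[of U X X'] vfield_cong[of U Y Y'] by auto
  then show ?thesis
    using assms covd_cong[OF affine_nab, of U X Y p X' Y'] covd_cong[OF affine_nab, of U Y X p Y' X']
      covd_cong[OF affine_D, of U X Y p X' Y'] covd_cong[OF affine_D, of U Y X p Y' X']
    by (simp add: torsion_def lie_bracket_D)
qed

lemma torsion_type_fields: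
  assumes "open U" "vfield A U X" "vfield A U Y" "p \<in> U"
  shows "torsion A nab (app J X) Y p = torsion A nab X (app J Y) p"
proof -
  \<comment> \<open>\<open>?E\<close> is \<open>i\<close> times the (1,0)-part of \<open>2X\<close>, and \<open>?F\<close> is the (1,0)-part of \<open>2Y\<close>.\<close>
  let ?E = "fComplex (app J X) X" and ?F = "fComplex Y (- app J Y)"
  have [simp]: "fRe (fComplex X Y) = X" "fIm (fComplex X Y) = Y" for X Y :: "('m, 'n) field"
    by (simp_all add: fRe_def fIm_def fComplex_def tRe_def tIm_def tComplex_def)
  have f: "field10 A J U (fComplex X Y)"
    if "vfield A U X" "vfield A U Y" "\<And>p. p \<in> U \<Longrightarrow> J p (X p) = - Y p \<and> J p (Y p) = X p" for X Y
  proof -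
    have [simp]: "tRe (fComplex X Y p) = X p" "tIm (fComplex X Y p) = Y p" for p
      by (simp_all add: fComplex_def tRe_def tIm_def tComplex_def)
    have "cendo J p (fComplex X Y p) = ctscale \<i> (fComplex X Y p)" if "p \<in> U" for p
    proof -
      have "cendo J p (fComplex X Y p) = tComplex (- Y p) (X p)"
        using \<open>\<And>p. p \<in> U \<Longrightarrow> _\<close>[OF that] by (simp add: cendo_def)
      then show ?thesis
        by (auto simp: ctscale_def tComplex_def fComplex_def fun_eq_iff vec_eq_iff complex_eq_iff)
    qed
    then show ?thesis
      using that by (auto simp: field10_def cvfield_def T10_def ctangent_def vfield_tangent)
  qed
  have E: "field10 A J U ?E"
    using assms by (intro f vfield_J) (auto simp: app_def vfield_tangent)
  have F: "field10 A J U ?F"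
    using assms by (intro f vfield_J vfield_uminus) (auto simp: app_def vfield_tangent J_uminus)
  have F': "fRe (fcnj ?F) = Y" "fIm (fcnj ?F) = app J Y"
    by (auto simp: fRe_def fIm_def fcnj_def tRe_def tIm_def tcnj_def fComplex_def tComplex_def vec_eq_iff fun_eq_iff)
  have E': "fRe ?E = app J X" "fIm ?E = X" by simp_all
  have "ctorsion A nab ?E (fcnj ?F) p = 0"
    using canonical E F assms(1,4) unfolding canonical_connection_def by blast
  then have "tComplex (torsion A nab (app J X) Y p - torsion A nab X (app J Y) p)
     (torsion A nab (app J X) (app J Y) p + torsion A nab X Y p) = 0"
    unfolding ctorsion_def bilinear_ext_def E' F' by (simp add: fComplex_def)
  then have "tRe (tComplex (torsion A nab (app J X) Y p - torsion A nab X (app J Y) p)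
     (torsion A nab (app J X) (app J Y) p + torsion A nab X Y p)) = tRe 0"
    by simp
  then show ?thesis
    by (simp add: tRe_def tComplex_def fun_eq_iff vec_eq_iff)
qed

lemma covd_D_cong: "\<lbrakk>open U; vfield A U X; vfield A U Y; p \<in> U; X p = X' p; \<And>q. q \<in> U \<Longrightarrow> Y q = Y' q\<rbrakk>
    \<Longrightarrow> covd D X Y p = covd D X' Y' p"
  and covd_nab_cong: "\<lbrakk>open U; vfield A U X; vfield A U Y; p \<in> U; X p = X' p; \<And>q. q \<in> U \<Longrightarrow> Y q = Y' q\<rbrakk>
    \<Longrightarrow> covd nab X Y p = covd nab X' Y' p"
  by (auto intro: covd_cong[OF affine_D] covd_cong[OF affine_nab])

lemma covd_add:
  assumes "affine_connection A C" "open U" "vfield A U X" "vfield A U Y" "vfield A U Z" "p \<in> U"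
  shows "covd C (X + Y) Z p = covd C X Z p + covd C Y Z p"
    and "covd C X (Y + Z) p = covd C X Y p + covd C X Z p"
  using affine_connectionD(2)[OF assms(1,2,5,5,6) vfield_tangent[OF assms(3,6)] vfield_tangent[OF assms(4,6)]]
    affine_connectionD(4)[OF assms(1,2,4,5,6) vfield_tangent[OF assms(3,6)] vfield_tangent[OF assms(3,6)]]
  by (simp_all add: covd_def)

lemma V_closed:
  assumes "open U" "X \<in> V U" "Y \<in> V U"
  shows "X + Y \<in> V U" "- X \<in> V U" "J' U X \<in> V U" "D' U X Y \<in> V U" "nab' U X Y \<in> V U"
  using assms
  by (auto simp: J'_def D'_def nab'_def V_vfield V_outside vfield_add vfield_uminus vfield_J
      vfield_covd[OF affine_D] vfield_covd[OF affine_nab] intro!: VI restr_in_V)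

lemma J'_at: "p \<in> U \<Longrightarrow> J' U X p = J p (X p)"
  and D'_at: "p \<in> U \<Longrightarrow> D' U X Y p = covd D X Y p"
  and nab'_at: "p \<in> U \<Longrightarrow> nab' U X Y p = covd nab X Y p"
  and G'_at: "p \<in> U \<Longrightarrow> G' U X Y p = g p (X p) (Y p)"
  and der'_at: "p \<in> U \<Longrightarrow> der' U X f p = dirderiv A p (X p) f"
  by (simp_all add: J'_def D'_def nab'_def G'_def der'_def restr_def app_def)

lemma restr_ops_outside:
  "p \<notin> U \<Longrightarrow> J' U X p = 0" "p \<notin> U \<Longrightarrow> D' U X Y p = 0" "p \<notin> U \<Longrightarrow> nab' U X Y p = 0"
  "p \<notin> U \<Longrightarrow> G' U X Y p = 0" "p \<notin> U \<Longrightarrow> der' U X f p = 0"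
  by (simp_all add: J'_def D'_def nab'_def G'_def der'_def restr_def)

lemma V_eqI: "X \<in> V U \<Longrightarrow> Y \<in> V U \<Longrightarrow> (\<And>p. p \<in> U \<Longrightarrow> X p = Y p) \<Longrightarrow> X = Y"
  using V_outside by (metis ext)

lemma fun_eqI_on: "(\<And>p. p \<notin> U \<Longrightarrow> f p = h p) \<Longrightarrow> (\<And>p. p \<in> U \<Longrightarrow> f p = h p) \<Longrightarrow> f = h"
  by (metis ext)

lemma dirderiv_G':
  assumes "open U" "p \<in> U"
  shows "dirderiv A p v (G' U Y Z) = dirderiv A p v (\<lambda>q. g q (Y q) (Z q))"
  by (rule dirderiv_cong[OF assms]) (simp add: G'_at)

lemma lie_bracket_D':
  assumes "open U" "X \<in> V U" "Y \<in> V U" "p \<in> U"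
  shows "(D' U X Y - D' U Y X) p = lie_bracket A X Y p"
  using assms by (simp add: D'_at lie_bracket_D V_vfield)

text \<open>Each law is a pointwise identity on \<open>U\<close> and trivial outside. The congruence
  lemmas enter because the restricted operations agree with the geometric ones on \<open>U\<close>
  only.\<close>

lemma field_algebra_V:
  assumes U: "open U"
  shows "field_algebra (V U) (J' U) (G' U) (der' U) (D' U) (nab' U)"
proof
  note c = V_closed[OF U] and v = V_vfield and t = V_tangent
  fix X Y Z W :: "('m, 'n) field" assume m: "X \<in> V U" "Y \<in> V U"
  show "X + Y \<in> V U" "- X \<in> V U" "J' U X \<in> V U" "D' U X Y \<in> V U" "nab' U X Y \<in> V U"
    using m c by auto
  show "J' U (X + Y) = J' U X + J' U Y"
    by (rule V_eqI[where U = U]) (use m in \<open>auto simp: c J'_at J_add_tangent t\<close>)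
  show "J' U (J' U X) = - X"
    by (rule V_eqI[where U = U]) (use m in \<open>auto simp: c J'_at t\<close>)
  show "G' U X Y = G' U Y X"
    by (rule fun_eqI_on[of U]) (use m in \<open>auto simp: restr_ops_outside G'_at t intro: g_sym\<close>)
  show "G' U (J' U X) (J' U Y) = G' U X Y"
    by (rule fun_eqI_on[of U]) (use m in \<open>auto simp: restr_ops_outside G'_at J'_at t g_J\<close>)
  show "X = 0" if "G' U X X = 0"
  proof (rule ext)
    fix p show "X p = 0 p"
    proof (cases "p \<in> U")
      case True
      then have "g p (X p) (X p) = 0" using fun_cong[OF that, of p] by (simp add: G'_at)
      then show ?thesis using g_pos[OF t[OF m(1)], of p] by fastforce
    qed (simp add: V_outside[OF m(1)])
  qed
  show "nab' U X (J' U Y) = J' U (nab' U X Y)"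
  proof (rule V_eqI[where U = U])
    fix p assume p: "p \<in> U"
    have "covd nab X (J' U Y) p = covd nab X (app J Y) p"
      by (rule covd_nab_cong[OF U]) (use m p in \<open>auto simp: v c J'_at app_def\<close>)
    then show "nab' U X (J' U Y) p = J' U (nab' U X Y) p"
      using m p by (simp add: nab'_at J'_at nab_J_fields[OF U] v)
  qed (use m c in auto)
  show "D' U X (J' U X) = J' U (D' U X X)"
  proof (rule V_eqI[where U = U])
    fix p assume p: "p \<in> U"
    have "covd D X (J' U X) p = covd D X (app J X) p"
      by (rule covd_D_cong[OF U]) (use m p in \<open>auto simp: v c J'_at app_def\<close>)
    then show "D' U X (J' U X) p = J' U (D' U X X) p"
      using m p by (simp add: D'_at J'_at D_J_fields[OF U] v)
  qed (use m c in auto)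
  show "T (J' U X) Y = T X (J' U Y)"
    if T: "T = (\<lambda>X Y. nab' U X Y - nab' U Y X - (D' U X Y - D' U Y X))" for T
  proof (rule fun_eqI_on[of U])
    fix p assume p: "p \<in> U"
    have Tt: "T X Y p = torsion A nab X Y p" if "X \<in> V U" "Y \<in> V U" for X Y
      using p that by (simp add: T torsion_def nab'_at D'_at lie_bracket_D[OF U] v)
    have "T (J' U X) Y p = torsion A nab (app J X) Y p"
      using m by (subst Tt) (auto simp: c J'_at app_def v intro!: torsion_cong[OF U _ _ p])
    also have "\<dots> = torsion A nab X (app J Y) p"
      by (rule torsion_type_fields[OF U _ _ p]) (use m in \<open>auto simp: v\<close>)
    also have "\<dots> = T X (J' U Y) p"
      using m by (subst Tt) (auto simp: c v J'_at app_def[of J Y] intro!: torsion_cong[OF U _ _ p] vfield_J[unfolded app_def] U)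
    finally show "T (J' U X) Y p = T X (J' U Y) p" .
  qed (simp add: T restr_ops_outside V_outside m)
  assume Z: "Z \<in> V U"
  note m = m Z
  show "G' U (X + Y) Z = G' U X Z + G' U Y Z"
    by (rule fun_eqI_on[of U]) (use m in \<open>auto simp: restr_ops_outside G'_at t g_add\<close>)
  show "D' U (X + Y) Z = D' U X Z + D' U Y Z" "D' U X (Y + Z) = D' U X Y + D' U X Z"
    "nab' U (X + Y) Z = nab' U X Z + nab' U Y Z" "nab' U X (Y + Z) = nab' U X Y + nab' U X Z"
    by (rule V_eqI[where U = U], use m c in auto,
        auto simp: D'_at nab'_at v covd_add[OF affine_D U] covd_add[OF affine_nab U])+
  show "der' U X (G' U Y Z) = G' U (D' U X Y) Z + G' U Y (D' U X Z)"
    by (rule fun_eqI_on[of U])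
      (use m in \<open>auto simp: restr_ops_outside der'_at G'_at D'_at dirderiv_G'[OF U] metric_D[OF U] v\<close>)
  show "der' U X (G' U Y Z) = G' U (nab' U X Y) Z + G' U Y (nab' U X Z)"
    by (rule fun_eqI_on[of U])
      (use m in \<open>auto simp: restr_ops_outside der'_at G'_at nab'_at dirderiv_G'[OF U] metric_nab[OF U] v\<close>)
  show "br X (br Y Z) + br Y (br Z X) + br Z (br X Y) = 0"
    if br: "br = (\<lambda>X Y. D' U X Y - D' U Y X)" for br
  proof (rule fun_eqI_on[of U])
    fix p assume p: "p \<in> U"
    have b: "br X Y q = lie_bracket A X Y q" if "X \<in> V U" "Y \<in> V U" "q \<in> U" for X Y q
      using lie_bracket_D'[OF U that] by (simp add: br)
    have bV: "br X Y \<in> V U" if "X \<in> V U" "Y \<in> V U" for X Y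
      using c(1)[OF c(4)[OF that] c(2)[OF c(4)[OF that(2,1)] c(4)[OF that(2,1)]]] by (simp add: br)
    show "(br X (br Y Z) + br Y (br Z X) + br Z (br X Y)) p = 0 p"
      using jacobi_lie_bracket[OF U v[OF m(1)] v[OF m(2)] v[OF m(3)] p, of "br X Y" "br Y Z" "br Z X"] m p
      by (simp add: b bV)
  qed (auto simp: br restr_ops_outside)
  assume W: "W \<in> V U"
  note m = m W
  show "der' U (D' U X Y - D' U Y X) (G' U Z W) = der' U X (der' U Y (G' U Z W)) - der' U Y (der' U X (G' U Z W))"
  proof (rule fun_eqI_on[of U])
    fix p assume p: "p \<in> U"
    let ?f = "\<lambda>q. g q (Z q) (W q)"
    have "dirderiv A p (lie_bracket A X Y p) ?f = dirderiv A p (X p) (der' U Y (G' U Z W)) - dirderiv A p (Y p) (der' U X (G' U Z W))"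
      by (rule dirderiv_lie_bracket[OF U v[OF m(1)] v[OF m(2)] smooth_fun_g[OF U v[OF m(3)] v[OF m(4)]] p])
        (use p m in \<open>auto simp: der'_at dirderiv_G'[OF U] v vfield_lie_bracket[OF U] vfield_tangent[where U = U]\<close>)
    then show "der' U (D' U X Y - D' U Y X) (G' U Z W) p =
        (der' U X (der' U Y (G' U Z W)) - der' U Y (der' U X (G' U Z W))) p"
      using lie_bracket_D'[OF U m(1,2) p] p by (simp add: der'_at dirderiv_G'[OF U])
  qed (auto simp: restr_ops_outside)
  fix B assume B: "B \<in> V U"
  note m = m B
  show "der' U X (G' U Y Z + G' U W B) = der' U X (G' U Y Z) + der' U X (G' U W B)"
  proof (rule fun_eqI_on[of U])
    fix p assume p: "p \<in> U"
    have "dirderiv A p (X p) (G' U Y Z + G' U W B) = dirderiv A p (X p) (\<lambda>q. g q (Y q) (Z q) + g q (W q) (B q))"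
      by (rule dirderiv_cong[OF U p]) (simp add: G'_at)
    also have "\<dots> = dirderiv A p (X p) (\<lambda>q. g q (Y q) (Z q)) + dirderiv A p (X p) (\<lambda>q. g q (W q) (B q))"
      by (rule dirderiv_add[where U = U]) (use p m in \<open>auto simp: smooth_fun_g[OF U] v t\<close>)
    finally show "der' U X (G' U Y Z + G' U W B) p = (der' U X (G' U Y Z) + der' U X (G' U W B)) p"
      using p by (simp add: der'_at dirderiv_G'[OF U])
  qed (auto simp: restr_ops_outside)
qed

end

section \<open>Propagation of zeros of the torsion\<close>

text \<open>Gronwall's argument for the sum of squares, which is differentiable where absolute
  values are not. By Cauchy-Schwarz its derivative is at most \<open>C\<close> times itself with
  \<open>C = 2 * K * card I\<close>, so multiplied by exp(-Cs) it cannot increase.\<close>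

lemma linear_differential_inequality_zero:
  fixes f :: "'i \<Rightarrow> real \<Rightarrow> real"
  assumes I: "finite I" and K: "K \<ge> 0"
    and der: "\<And>i s. i \<in> I \<Longrightarrow> 0 \<le> s \<Longrightarrow> s \<le> 1 \<Longrightarrow> (f i has_real_derivative f' i s) (at s)"
    and bound: "\<And>i s. i \<in> I \<Longrightarrow> 0 \<le> s \<Longrightarrow> s \<le> 1 \<Longrightarrow> \<bar>f' i s\<bar> \<le> K * (\<Sum>j\<in>I. \<bar>f j s\<bar>)"
    and init: "\<And>i. i \<in> I \<Longrightarrow> f i 0 = 0"
    and i: "i \<in> I"
  shows "f i 1 = 0"
proof -
  define \<phi> where "\<phi> s = (\<Sum>i\<in>I. (f i s)\<^sup>2)" for s
  define C where "C = 2 * K * card I"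
  have d: "((\<lambda>s. \<phi> s * exp (- C * s)) has_real_derivative
      (\<Sum>i\<in>I. 2 * f i s * f' i s) * exp (- C * s) - C * \<phi> s * exp (- C * s)) (at s)"
    if "0 \<le> s" "s \<le> 1" for s
    unfolding \<phi>_def
    by (rule derivative_eq_intros der that refl | assumption)+ (auto simp: algebra_simps intro!: sum.cong)
  have le: "(\<Sum>i\<in>I. 2 * f i s * f' i s) \<le> C * \<phi> s" if "0 \<le> s" "s \<le> 1" for s
  proof -
    have "(\<Sum>i\<in>I. 2 * f i s * f' i s) \<le> (\<Sum>i\<in>I. 2 * \<bar>f i s\<bar> * (K * (\<Sum>j\<in>I. \<bar>f j s\<bar>)))"
    proof (rule sum_mono)
      fix i assume "i \<in> I"
      have "2 * f i s * f' i s \<le> \<bar>2 * f i s * f' i s\<bar>" by simp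
      also have "\<dots> = 2 * \<bar>f i s\<bar> * \<bar>f' i s\<bar>" by (simp add: abs_mult)
      also have "\<dots> \<le> 2 * \<bar>f i s\<bar> * (K * (\<Sum>j\<in>I. \<bar>f j s\<bar>))"
        using bound[OF \<open>i \<in> I\<close> that] by (intro mult_left_mono) auto
      finally show "2 * f i s * f' i s \<le> 2 * \<bar>f i s\<bar> * (K * (\<Sum>j\<in>I. \<bar>f j s\<bar>))" .
    qed
    also have "\<dots> = 2 * K * (\<Sum>j\<in>I. \<bar>f j s\<bar>)\<^sup>2"
      by (simp add: power2_eq_square sum_distrib_left sum_distrib_right mult_ac)
    also have "\<dots> \<le> 2 * K * ((\<Sum>j\<in>I. \<bar>f j s\<bar>\<^sup>2) * card I)"
      using sum_squared_le_sum_of_squares[of "\<lambda>j. \<bar>f j s\<bar>" I] K by (intro mult_left_mono) auto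
    finally show ?thesis by (simp add: C_def \<phi>_def mult_ac)
  qed
  have "\<phi> 1 * exp (- C * 1) \<le> \<phi> 0 * exp (- C * 0)"
  proof (rule DERIV_nonpos_imp_nonincreasing[of 0 1 "\<lambda>s. \<phi> s * exp (- C * s)"])
    fix s :: real assume s: "0 \<le> s" "s \<le> 1"
    have "(\<Sum>i\<in>I. 2 * f i s * f' i s) * exp (- C * s) - C * \<phi> s * exp (- C * s) \<le> 0"
      using le[OF s] by (simp add: mult_right_mono)
    then show "\<exists>y. ((\<lambda>s. \<phi> s * exp (- C * s)) has_real_derivative y) (at s) \<and> y \<le> 0"
      using d[OF s] by blast
  qed simp
  also have "\<phi> 0 = 0" using init by (simp add: \<phi>_def)
  finally have "\<phi> 1 \<le> 0" by (simp add: mult_le_0_iff)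
  moreover have "(f i 1)\<^sup>2 \<le> \<phi> 1" unfolding \<phi>_def using I i by (intro member_le_sum) auto
  ultimately have "(f i 1)\<^sup>2 \<le> 0" by linarith
  then show ?thesis by simp
qed

context canonical_nearly_kaehler
begin

text \<open>Unlike \<open>t\<close> it is not tied to an open set, so it applies to fields given on
  different neighbourhoods.\<close>

definition tor :: "('m, 'n) field \<Rightarrow> ('m, 'n) field \<Rightarrow> ('m, 'n) field \<Rightarrow> 'm \<Rightarrow> real" where
  "tor X Y Z p = g p (torsion A nab X Y p) (Z p)"

lemma vfield_torsion: "open U \<Longrightarrow> vfield A U X \<Longrightarrow> vfield A U Y \<Longrightarrow> vfield A U (torsion A nab X Y)"
  unfolding torsion_def by (intro vfield_diff vfield_covd[OF affine_nab] vfield_lie_bracket)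

lemma restr_at: "p \<in> U \<Longrightarrow> restr U X p = X p"
  by (simp add: restr_def)

lemma tor_eq_t:
  assumes "open U" "vfield A U X" "vfield A U Y" "p \<in> U"
  shows "field_algebra.t (G' U) (D' U) (nab' U) (restr U X) (restr U Y) (restr U Z) p = tor X Y Z p"
proof -
  interpret F: field_algebra "V U" "J' U" "G' U" "der' U" "D' U" "nab' U"
    by (rule field_algebra_V[OF assms(1)])
  note m = restr_in_V[OF assms(1,2)] restr_in_V[OF assms(1,3)]
  have "F.T (restr U X) (restr U Y) p = torsion A nab (restr U X) (restr U Y) p"
    using assms(1,4) m
    by (simp add: F.T_def F.br_def torsion_def nab'_at D'_at lie_bracket_D[OF assms(1)] V_vfield)
  also have "\<dots> = torsion A nab X Y p"
    by (rule torsion_cong[OF assms(1) _ _ assms(4)]) (use m in \<open>auto simp: V_vfield restr_def\<close>)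
  finally show ?thesis
    using assms(4) by (simp add: F.t_def tor_def G'_at restr_def)
qed

lemma tor_cyclic:
  assumes "open U" "vfield A U X" "vfield A U Y" "vfield A U Z" "p \<in> U"
  shows "tor X Y Z p = tor Y Z X p"
proof -
  interpret F: field_algebra "V U" "J' U" "G' U" "der' U" "D' U" "nab' U"
    by (rule field_algebra_V[OF assms(1)])
  show ?thesis
    using F.t_cyclic[of "restr U X" "restr U Y" "restr U Z" p] assms by (simp add: tor_eq_t restr_in_V)
qed

lemma dirderiv_tor:
  assumes "open U" "vfield A U W" "vfield A U X" "vfield A U Y" "vfield A U Z" "p \<in> U"
  shows "dirderiv A p (W p) (tor X Y Z) =
    tor (covd nab W X) Y Z p + tor X (covd nab W Y) Z p + tor X Y (covd nab W Z) p"
proof -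
  interpret F: field_algebra "V U" "J' U" "G' U" "der' U" "D' U" "nab' U"
    by (rule field_algebra_V[OF assms(1)])
  let ?r = "restr U"
  have n: "nab' U (?r W) (?r X) = ?r (covd nab W X)" if "vfield A U X" for X
  proof (rule V_eqI[where U = U])
    show "nab' U (?r W) (?r X) q = ?r (covd nab W X) q" if "q \<in> U" for q
      using covd_cong[OF affine_nab, of U "?r W" "?r X" q W X] that assms \<open>vfield A U X\<close>
      by (simp add: nab'_at vfield_restr restr_at)
  qed (use assms that in \<open>auto simp: restr_in_V vfield_covd[OF affine_nab]\<close>)
  have "der' U (?r W) (F.t (?r X) (?r Y) (?r Z)) p =
     F.t (?r (covd nab W X)) (?r Y) (?r Z) p + F.t (?r X) (?r (covd nab W Y)) (?r Z) p
     + F.t (?r X) (?r Y) (?r (covd nab W Z)) p"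
    using assms by (simp add: F.der_t restr_in_V n)
  moreover have "der' U (?r W) (F.t (?r X) (?r Y) (?r Z)) p = dirderiv A p (W p) (F.t (?r X) (?r Y) (?r Z))"
    using assms by (simp add: der'_at restr_def)
  moreover have "\<dots> = dirderiv A p (W p) (tor X Y Z)"
    by (rule dirderiv_cong[OF assms(1,6)]) (use assms in \<open>auto simp: tor_eq_t\<close>)
  ultimately show ?thesis
    using assms by (simp add: tor_eq_t vfield_covd[OF affine_nab])
qed

lemma g_sum:
  assumes "finite I" "\<And>i. i \<in> I \<Longrightarrow> v i \<in> tangent A p" "w \<in> tangent A p"
  shows "(\<Sum>i\<in>I. tscale (a i) (v i)) \<in> tangent A p"
    and "g p (\<Sum>i\<in>I. tscale (a i) (v i)) w = (\<Sum>i\<in>I. a i * g p (v i) w)"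
proof -
  have z: "g p 0 w = 0"
    using g_add[of 0 p 0 w] assms(3) by simp
  have "(\<Sum>i\<in>I. tscale (a i) (v i)) \<in> tangent A p \<and>
      g p (\<Sum>i\<in>I. tscale (a i) (v i)) w = (\<Sum>i\<in>I. a i * g p (v i) w)"
    using assms(1,2) by induction (auto simp: z g_add g_tscale assms(3))
  then show "(\<Sum>i\<in>I. tscale (a i) (v i)) \<in> tangent A p"
    "g p (\<Sum>i\<in>I. tscale (a i) (v i)) w = (\<Sum>i\<in>I. a i * g p (v i) w)" by auto
qed

lemma tor_expand3:
  assumes "open U" "vfield A U X" "vfield A U Y" "vfield A U Z" "p \<in> U"
    and "finite I" "\<And>i. i \<in> I \<Longrightarrow> vfield A U (B i)" "Z p = (\<Sum>i\<in>I. tscale (a i) (B i p))"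
  shows "tor X Y Z p = (\<Sum>i\<in>I. a i * tor X Y (B i) p)"
proof -
  let ?T = "torsion A nab X Y p"
  have T: "?T \<in> tangent A p" and B: "B i p \<in> tangent A p" if "i \<in> I" for i
    using assms that by (auto intro!: vfield_tangent vfield_torsion)
  have T: "?T \<in> tangent A p" 
    using assms by (auto intro!: vfield_tangent vfield_torsion)
  have "tor X Y Z p = g p (Z p) ?T"
    unfolding tor_def by (rule g_sym[OF T vfield_tangent[OF assms(4,5)]])
  also have "\<dots> = (\<Sum>i\<in>I. a i * g p (B i p) ?T)"
    unfolding assms(8) by (rule g_sum(2)[OF assms(6) B T])
  also have "\<dots> = (\<Sum>i\<in>I. a i * tor X Y (B i) p)"
    using B T by (intro sum.cong) (auto simp: tor_def g_sym)
  finally show ?thesis .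
qed

definition torsion_free_at :: "'m \<Rightarrow> bool" where
  "torsion_free_at p \<longleftrightarrow> (\<forall>U X Y. open U \<longrightarrow> p \<in> U \<longrightarrow> vfield A U X \<longrightarrow> vfield A U Y \<longrightarrow>
     torsion A nab X Y p = 0)"

text \<open>The third argument of \<open>tor\<close> is paired by the metric, so only its value at p
  counts and it may be expanded in the frame. Cyclic symmetry brings the other two arguments into
  that slot one after the other; a torsion vector orthogonal to all fields, itself included, is
  zero.\<close>

lemma torsion_free_atI:
  assumes "open U" "p \<in> U" "finite I" "\<And>i. i \<in> I \<Longrightarrow> vfield A U (B i)"
    and span: "\<And>v. v \<in> tangent A p \<Longrightarrow> \<exists>a. v = (\<Sum>i\<in>I. tscale (a i) (B i p))"
    and tor: "\<And>i j k. i \<in> I \<Longrightarrow> j \<in> I \<Longrightarrow> k \<in> I \<Longrightarrow> tor (B i) (B j) (B k) p = 0"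
  shows "torsion_free_at p"
  unfolding torsion_free_at_def
proof (intro allI impI)
  fix U' X Y assume U': "open U'" "p \<in> U'" "vfield A U' X" "vfield A U' Y"
  define W where "W = U \<inter> U'"
  have W: "open W" "p \<in> W" "vfield A W X" "vfield A W Y" "\<And>i. i \<in> I \<Longrightarrow> vfield A W (B i)"
    using assms U' by (auto simp: W_def intro: vfield_subset)
  have zero: "tor X Y Z p = 0"
    if f: "vfield A W X" "vfield A W Y" "vfield A W Z" "\<And>i. i \<in> I \<Longrightarrow> tor X Y (B i) p = 0" for X Y Z
  proof -
    obtain a where "Z p = (\<Sum>i\<in>I. tscale (a i) (B i p))"
      using span[OF vfield_tangent[OF f(3) W(2)]] by blast
    from tor_expand3[OF W(1) f(1-3) W(2) assms(3) W(5) this] show ?thesis using f(4) by simp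
  qed
  have cyc: "tor X Y Z p = tor Y Z X p" if "vfield A W X" "vfield A W Y" "vfield A W Z" for X Y Z
    by (rule tor_cyclic[OF W(1) that W(2)])
  have 1: "tor (B i) (B j) Z p = 0" if "i \<in> I" "j \<in> I" "vfield A W Z" for i j Z
    using zero[OF W(5)[OF that(1)] W(5)[OF that(2)] that(3)] tor[OF that(1,2)] by blast
  have 2: "tor (B i) Y Z p = 0" if "i \<in> I" "vfield A W Y" "vfield A W Z" for i Y Z
  proof -
    have "tor Z (B i) (B j) p = 0" if "j \<in> I" for j
      using cyc[OF \<open>vfield A W Z\<close> W(5)[OF \<open>i \<in> I\<close>] W(5)[OF that]] 1 that \<open>i \<in> I\<close> \<open>vfield A W Z\<close> by simp
    then have "tor Z (B i) Y p = 0"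
      by (rule zero[OF that(3) W(5)[OF that(1)] that(2)])
    then show ?thesis using cyc[OF that(3) W(5)[OF that(1)] that(2)] by simp
  qed
  have "tor X Y (B i) p = 0" if "i \<in> I" for i
    using cyc[OF W(5)[OF that] W(3,4)] 2[OF that W(3,4)] by simp
  then have "tor X Y (torsion A nab X Y) p = 0"
    by (rule zero[OF W(3,4) vfield_torsion[OF W(1,3,4)]])
  then show "torsion A nab X Y p = 0"
    using g_pos[OF vfield_tangent[OF vfield_torsion[OF W(1,3,4)] W(2)]] by (fastforce simp: tor_def)
qed

lemma coord_field_span:
  assumes "c \<in> A" "p \<in> dom_of c" "v \<in> tangent A p"
  shows "v = (\<Sum>i\<in>UNIV. tscale (v c $ i) (coord_field c (axis i 1) p))"
proof (rule tangent_eqI[OF assms(3) _ assms(1,2)])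
  show "(\<Sum>i\<in>UNIV. tscale (v c $ i) (coord_field c (axis i 1) p)) \<in> tangent A p"
    by (rule g_sum(1)[OF _ _ tangent_0]) (use assms in \<open>auto simp: coord_field_tangent\<close>)
  have s: "(\<Sum>i\<in>I. f i) c = (\<Sum>i\<in>I. f i c)" if "finite I" for I :: "'n set" and f :: "'n \<Rightarrow> ('m, 'n) tvec"
    using that by induction auto
  show "v c = (\<Sum>i\<in>UNIV. tscale (v c $ i) (coord_field c (axis i 1) p)) c"
    using assms by (simp add: s tscale_def coord_field_self basis_expansion flip: scalar_mult_eq_scaleR)
qed

text \<open>
  As the torsion is parallel, its components in a coordinate frame satisfy a homogeneous linear
  system of differential equations along the segment.
\<close>

lemma torsion_free_at_segment:
  assumes c: "c \<in> A" and pq: "p \<in> dom_of c" "q \<in> dom_of c"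
    and segment: "closed_segment (coord c p) (coord c q) \<subseteq> img c UNIV"
    and p: "torsion_free_at p"
  shows "torsion_free_at q"
proof -
  let ?E = "\<lambda>i. coord_field c (axis i 1)" and ?O = "dom_of c"
  define w where "w = coord c q - coord c p"
  define x where "x s = coord c p + s *\<^sub>R w" for s :: real
  define r where "r s = chart_inv c (x s)" for s
  \<comment> \<open>Components, in the coordinate frame, of the derivatives of the frame fields
    along the segment: connection coefficients contracted with w. Their continuity on a compact
    interval provides the bound \<open>K\<close>.\<close>
  define \<gamma> where "\<gamma> i m s = covd nab (coord_field c w) (?E i) (r s) c $ m" for i m s
  define f where "f = (\<lambda>(i, j, k) s. tor (?E i) (?E j) (?E k) (r s))"
  define f' where "f' = (\<lambda>(i, j, k) s. \<Sum>m\<in>UNIV. \<gamma> i m s * f (m, j, k) s + \<gamma> j m s * f (i, m, k) s + \<gamma> k m s * f (i, j, m) s)"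
  have O: "open ?O" using c by (rule open_dom)
  have E: "vfield A ?O (?E i)" and w: "vfield A ?O (coord_field c w)" for i
    using c by (auto intro: vfield_coord_field)
  have xin: "x s \<in> img c UNIV" if "0 \<le> s" "s \<le> 1" for s
  proof -
    have "x s \<in> closed_segment (coord c p) (coord c q)"
      using that by (auto simp: x_def w_def closed_segment_def algebra_simps intro!: exI[of _ s])
    then show ?thesis using segment by blast
  qed
  have r: "r s \<in> ?O" "coord c (r s) = x s" if "0 \<le> s" "s \<le> 1" for s
    using xin[OF that] c by (auto simp: r_def)
  have \<gamma>_cont: "continuous_on {0..1} (\<gamma> i m)" for i m
  proof -
    have "smooth_on (img c ?O) (field_rep c (covd nab (coord_field c w) (?E i)))"
      by (rule vfield_smooth[OF vfield_covd[OF affine_nab O w E] c])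
    then have "continuous_on (img c ?O) (field_rep c (covd nab (coord_field c w) (?E i)))"
      by (rule smooth_on_continuous_on)
    moreover have "continuous_on {0..1} x" unfolding x_def by (intro continuous_intros)
    moreover have "x ` {0..1} \<subseteq> img c ?O" using xin by auto
    ultimately have "continuous_on {0..1} (\<lambda>s. field_rep c (covd nab (coord_field c w) (?E i)) (x s))"
      by (rule continuous_on_compose2)
    then show ?thesis
      unfolding \<gamma>_def r_def field_rep_def by (rule continuous_on_component)
  qed
  have "\<exists>K. \<forall>i m. \<forall>s\<in>{0..1}. \<bar>\<gamma> i m s\<bar> \<le> K"
  proof -
    have "\<exists>K. \<forall>s\<in>{0..1}. \<bar>\<gamma> i m s\<bar> \<le> K" for i m
      using compact_imp_bounded[OF compact_continuous_image[OF \<gamma>_cont compact_Icc]]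
      by (auto simp: bounded_iff)
    then obtain K where K: "\<And>i m s. s \<in> {0..1} \<Longrightarrow> \<bar>\<gamma> i m s\<bar> \<le> K i m" by metis
    have "\<bar>\<gamma> i m s\<bar> \<le> (\<Sum>i\<in>UNIV. \<Sum>m\<in>UNIV. \<bar>K i m\<bar>)" if "s \<in> {0..1}" for i m s
    proof -
      have "\<bar>\<gamma> i m s\<bar> \<le> \<bar>K i m\<bar>" using K[OF that, of i m] by linarith
      also have "\<dots> \<le> (\<Sum>m\<in>UNIV. \<bar>K i m\<bar>)" by (rule member_le_sum) auto
      also have "\<dots> \<le> (\<Sum>i\<in>UNIV. \<Sum>m\<in>UNIV. \<bar>K i m\<bar>)"
        by (rule member_le_sum[of i UNIV "\<lambda>i. \<Sum>m\<in>UNIV. \<bar>K i m\<bar>"]) (auto intro: sum_nonneg)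
      finally show ?thesis .
    qed
    then show ?thesis by blast
  qed
  then obtain K0 where K0: "\<And>i m s. 0 \<le> s \<Longrightarrow> s \<le> 1 \<Longrightarrow> \<bar>\<gamma> i m s\<bar> \<le> K0"
    by (metis atLeastAtMost_iff)
  define K where "K = max 0 K0"
  have K: "K \<ge> 0" "\<And>i m s. 0 \<le> s \<Longrightarrow> s \<le> 1 \<Longrightarrow> \<bar>\<gamma> i m s\<bar> \<le> K"
    using K0 by (auto simp: K_def le_max_iff_disj)
  have f_def': "f (i, j, k) s = tor (?E i) (?E j) (?E k) (r s)" for i j k s by (simp add: f_def)
  have der: "(f t has_real_derivative f' t s) (at s)" if s: "0 \<le> s" "s \<le> 1" for t s
  proof -
    obtain i j k where t: "t = (i, j, k)" by (cases t)
    note rin = r[OF s]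
    let ?h = "tor (?E i) (?E j) (?E k)"
    have sm: "smooth_fun A ?O ?h"
      unfolding tor_def by (rule smooth_fun_g[OF O vfield_torsion[OF O E E] E])
    have d: "(?h \<circ> chart_inv c) differentiable (at (coord c (r s)))"
      by (rule smooth_fun_differentiable[OF sm c rin(1) rin(1)])
    let ?F = "frechet_derivative (?h \<circ> chart_inv c) (at (x s))"
    have F: "((?h \<circ> chart_inv c) has_derivative ?F) (at (x s))"
      using has_derivative_frechet[OF d] by (simp add: rin)
    have "(x has_derivative (\<lambda>h. h *\<^sub>R w)) (at s)"
      unfolding x_def by (auto intro!: derivative_eq_intros)
    from has_derivative_compose[OF this F]
    have "((\<lambda>s. ?h (r s)) has_derivative (\<lambda>h. ?F (h *\<^sub>R w))) (at s)" by (simp add: r_def comp_def)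
    moreover have "?F (h *\<^sub>R w) = ?F w * h" for h
      using linear_scale[OF has_derivative_linear[OF F], of h w] by simp
    ultimately have 1: "((\<lambda>s. ?h (r s)) has_real_derivative ?F w) (at s)"
      by (simp add: has_field_derivative_def)
    have "?F w = dirderiv A (r s) (coord_field c w (r s)) ?h"
      using dirderiv_eq[OF c rin(1) vfield_tangent[OF w rin(1)] d] c rin by (simp add: coord_field_self)
    also have "\<dots> = tor (covd nab (coord_field c w) (?E i)) (?E j) (?E k) (r s)
       + tor (?E i) (covd nab (coord_field c w) (?E j)) (?E k) (r s)
       + tor (?E i) (?E j) (covd nab (coord_field c w) (?E k)) (r s)"
      by (rule dirderiv_tor[OF O w E E E rin(1)])
    \<comment> \<open>The differentiated field is rotated into the third slot, the one where
      \<open>tor_expand3\<close> can expand it.\<close>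
    also have "\<dots> = tor (?E j) (?E k) (covd nab (coord_field c w) (?E i)) (r s)
       + tor (?E k) (?E i) (covd nab (coord_field c w) (?E j)) (r s)
       + tor (?E i) (?E j) (covd nab (coord_field c w) (?E k)) (r s)"
      using tor_cyclic[OF O _ E E rin(1), of "covd nab (coord_field c w) (?E i)" j k]
        tor_cyclic[OF O E E _ rin(1), of "covd nab (coord_field c w) (?E j)" k i]
      by (simp add: vfield_covd[OF affine_nab O w E])
    also have "\<dots> = (\<Sum>m\<in>UNIV. \<gamma> i m s * tor (?E j) (?E k) (?E m) (r s))
       + (\<Sum>m\<in>UNIV. \<gamma> j m s * tor (?E k) (?E i) (?E m) (r s))
       + (\<Sum>m\<in>UNIV. \<gamma> k m s * tor (?E i) (?E j) (?E m) (r s))"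
    proof -
      have "tor (?E i) (?E j) (covd nab (coord_field c w) (?E k)) (r s) =
         (\<Sum>m\<in>UNIV. \<gamma> k m s * tor (?E i) (?E j) (?E m) (r s))" for i j k
        unfolding \<gamma>_def
        by (rule tor_expand3[OF O E E vfield_covd[OF affine_nab O w E] rin(1) finite[of UNIV] E
            coord_field_span[OF c rin(1) vfield_tangent[OF vfield_covd[OF affine_nab O w E] rin(1)]]])
      then show ?thesis by simp
    qed
    also have "\<dots> = f' t s"
    proof -
      have "tor (?E j) (?E k) (?E m) (r s) = f (m, j, k) s" for m
        using tor_cyclic[OF O E E E rin(1), of m j k] by (simp add: f_def)
      moreover have "tor (?E k) (?E i) (?E m) (r s) = f (i, m, k) s" for m
        using tor_cyclic[OF O E E E rin(1), of k i m] by (simp add: f_def)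
      ultimately show ?thesis by (simp add: t f'_def f_def' sum.distrib)
    qed
    finally show ?thesis using 1 by (simp add: t f_def)
  qed
  \<comment> \<open>\<open>f'\<close> is a sum over CARD('n) indices of three terms, each at most K
    times the sum of all components.\<close>
  have bound: "\<bar>f' t s\<bar> \<le> (K * 3 * CARD('n)) * (\<Sum>t\<in>UNIV. \<bar>f t s\<bar>)" if s: "0 \<le> s" "s \<le> 1" for t s
  proof -
    obtain i j k where t: "t = (i, j, k)" by (cases t)
    let ?S = "\<Sum>t\<in>UNIV. \<bar>f t s\<bar>"
    have b: "\<bar>\<gamma> i m s * f t s\<bar> \<le> K * ?S" for i m t
    proof -
      have "\<bar>f t s\<bar> \<le> ?S" by (rule member_le_sum[of t UNIV "\<lambda>t. \<bar>f t s\<bar>"]) auto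
      then show ?thesis unfolding abs_mult using K s by (intro mult_mono) auto
    qed
    have "\<bar>f' t s\<bar> \<le> (\<Sum>m\<in>(UNIV::'n set). K * ?S + K * ?S + K * ?S)"
      unfolding t f'_def prod.case
      by (rule order_trans[OF sum_abs sum_mono])
         (use b[of i] b[of j] b[of k] in \<open>meson abs_triangle_ineq add_mono order_trans\<close>)
    then show ?thesis by (simp add: algebra_simps)
  qed
  have init: "f t 0 = 0" for t
  proof -
    obtain i j k where t: "t = (i, j, k)" by (cases t)
    have "r 0 = p" using c pq by (simp add: r_def x_def)
    moreover have "torsion A nab (?E i) (?E j) p = 0"
      using p O pq E unfolding torsion_free_at_def by blast
    moreover have "g p 0 (?E k p) = 0"
      using g_add[of 0 p 0 "?E k p"] vfield_tangent[OF E pq(1)] by simp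
    ultimately show ?thesis by (simp add: t f_def tor_def)
  qed
  have "f t 1 = 0" for t
    by (rule linear_differential_inequality_zero[where I = UNIV and f = f and f' = f' and K = "K * 3 * CARD('n)"])
       (use K der bound init in auto)
  moreover have "r 1 = q" using c pq by (simp add: r_def x_def w_def)
  ultimately have tor: "tor (?E i) (?E j) (?E k) q = 0" for i j k
    by (metis f_def')
  show ?thesis
  proof (rule torsion_free_atI[OF O pq(2) finite[of UNIV], where B = ?E])
    show "\<exists>a. v = (\<Sum>i\<in>UNIV. tscale (a i) (?E i q))" if "v \<in> tangent A q" for v
      using coord_field_span[OF c pq(2) that] by blast
  qed (use E tor in auto)
qed

text \<open>A ball in a chart contains the segments from its centre to any point and back, so being
  a zero of the torsion is a locally constant property.\<close>

lemma torsion_free_everywhere: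
  assumes "connected (UNIV :: 'm set)" "torsion_free_at p"
  shows "torsion_free_at q"
proof -
  have "torsion_free_at constant_on (UNIV :: 'm set)"
  proof (rule locally_constant_imp_constant[OF assms(1)])
    fix a :: 'm
    obtain c where c: "c \<in> A" "a \<in> dom_of c" using ex_chart by blast
    have "coord c a \<in> img c UNIV" using c by blast
    with open_img[OF c(1) open_UNIV] obtain r where r: "r > 0" "ball (coord c a) r \<subseteq> img c UNIV" using openE by blast
    define N where "N = dom_of c \<inter> coord c -` ball (coord c a) r"
    have "continuous_on (dom_of c) (coord c)"
      using is_chart[OF c(1)] by (simp add: is_chart_def homeomorphism_def)
    then have openN: "open N"
      unfolding N_def by (rule continuous_open_preimage) (use open_dom[OF c(1)] in auto)
    have aN: "a \<in> N" using c r by (simp add: N_def)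
    have const: "torsion_free_at x = torsion_free_at a" if "x \<in> N" for x
    proof -
      have ball: "coord c x \<in> ball (coord c a) r" "coord c a \<in> ball (coord c a) r"
        using that r by (auto simp: N_def)
      note segments = subset_trans[OF closed_segment_subset[OF ball convex_ball] r(2)]
        subset_trans[OF closed_segment_subset[OF ball(2,1) convex_ball] r(2)]
      have x: "x \<in> dom_of c" using that by (simp add: N_def)
      show ?thesis
        by (rule iffI) (erule torsion_free_at_segment[OF c(1) x c(2) segments(1)],
          erule torsion_free_at_segment[OF c(1,2) x segments(2)])
    qed
    show "\<exists>N. openin (top_of_set UNIV) N \<and> a \<in> N \<and> (\<forall>x\<in>N. torsion_free_at x = torsion_free_at a)"
      using openN aN by (intro exI[of _ N] conjI ballI const) simp_all
  qed
  then show ?thesis using assms(2) unfolding constant_on_def by blast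
qed

end

section \<open>Torsion-free canonical connections; complexified curvature\<close>

context canonical_nearly_kaehler
begin

lemma torsion_free_lie_bracket:
  assumes "\<And>p. torsion_free_at p" "open U" "vfield A U X" "vfield A U Y" "p \<in> U"
  shows "lie_bracket A X Y p = covd nab X Y p - covd nab Y X p"
  using assms(1)[of p] assms(2-) unfolding torsion_free_at_def
  by (metis (no_types, lifting) eq_iff_diff_eq_0 minus_apply torsion_def)

lemma J_diff_tangent: "u \<in> tangent A p \<Longrightarrow> v \<in> tangent A p \<Longrightarrow> J p (u - v) = J p u - J p v"
  using J_add_tangent[of u p "- v"] by (simp add: J_uminus)

lemma covd_tangent:
  assumes "affine_connection A C" "open U" "vfield A U X" "vfield A U Y" "p \<in> U"
  shows "covd C X Y p \<in> tangent A p"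
  using vfield_tangent[OF vfield_covd[OF assms(1-4)] assms(5)] .

text \<open>Every bracket in the Nijenhuis tensor becomes a difference of covariant derivatives
  through which J passes, and the terms cancel.\<close>

lemma integrable_if_torsion_free:
  assumes "\<And>p. torsion_free_at p"
  shows "integrable_acs A J"
  unfolding integrable_acs_def
proof (intro allI impI ballI)
  fix U X Y p assume a: "open U" "vfield A U X" "vfield A U Y" "p \<in> U"
  note b = torsion_free_lie_bracket[OF assms a(1) _ _ a(4)] vfield_J[OF a(1)] nab_J_fields[OF a(1) _ _ a(4)]
  note t = covd_tangent[OF affine_nab a(1) _ _ a(4)]
  have "nijenhuis A J X Y p = lie_bracket A (app J X) (app J Y) p - J p (lie_bracket A (app J X) Y p)
     - J p (lie_bracket A X (app J Y) p) - lie_bracket A X Y p"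
    by (simp add: nijenhuis_def app_def)
  then show "nijenhuis A J X Y p = 0"
    using a(2,3) by (simp add: b J_diff_tangent t algebra_simps)
qed

lemma g_minus: "u \<in> tangent A p \<Longrightarrow> v \<in> tangent A p \<Longrightarrow> g p (- u) v = - g p u v"
  using g_tscale[of u p v "- 1"] by (simp add: tscale_minus_one)

lemma g_diff: "u \<in> tangent A p \<Longrightarrow> v \<in> tangent A p \<Longrightarrow> w \<in> tangent A p \<Longrightarrow> g p (u - v) w = g p u w - g p v w"
  using g_add[of u p "- v" w] by (simp add: g_minus)

lemma g_J_skew: 
  assumes "u \<in> tangent A p" "v \<in> tangent A p"
  shows "g p (J p u) v = - g p (J p v) u"
proof -
  have "g p (J p u) v = g p (J p (J p u)) (J p v)"
    using assms g_J[of "J p u" p v] by simp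
  also have "\<dots> = - g p u (J p v)"
    using assms by (simp add: g_minus)
  also have "g p u (J p v) = g p (J p v) u"
    using assms by (simp add: g_sym)
  finally show ?thesis .
qed

text \<open>The fundamental form is parallel because g and J are; without torsion the exterior
  derivative is an alternating sum of covariant derivatives.\<close>

lemma closed_if_torsion_free:
  assumes "\<And>p. torsion_free_at p"
  shows "closed_form2 A (fundamental_form J g)"
  unfolding closed_form2_def
proof (intro allI impI ballI)
  fix U X Y Z p assume a: "open U" "vfield A U X" "vfield A U Y" "vfield A U Z" "p \<in> U"
  let ?w = "\<lambda>u v. g p (J p u) v"
  note b = torsion_free_lie_bracket[OF assms a(1) _ _ a(5)]
  note t = covd_tangent[OF affine_nab a(1) _ _ a(5)] vfield_tangent[OF _ a(5)]
  have der: "dirderiv A p (X p) (\<lambda>q. fundamental_form J g q (Y q) (Z q)) =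
      ?w (covd nab X Y p) (Z p) - ?w (covd nab X Z p) (Y p)"
    if "vfield A U X" "vfield A U Y" "vfield A U Z" for X Y Z
  proof -
    have "dirderiv A p (X p) (\<lambda>q. g q (app J Y q) (Z q)) =
        g p (covd nab X (app J Y) p) (Z p) + g p (app J Y p) (covd nab X Z p)"
      by (rule metric_nab[OF a(1) that(1) vfield_J[OF a(1) that(2)] that(3) a(5)])
    moreover have "?w (Y p) (covd nab X Z p) = - ?w (covd nab X Z p) (Y p)"
      using that by (intro g_J_skew t)
    ultimately show ?thesis
      using that by (simp add: fundamental_form_def nab_J_fields[OF a(1) _ _ a(5)]) (simp add: app_def)
  qed
  have bracket: "fundamental_form J g p (lie_bracket A X Y p) (Z p) =
     ?w (covd nab X Y p) (Z p) - ?w (covd nab Y X p) (Z p)"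
    if "vfield A U X" "vfield A U Y" "vfield A U Z" for X Y Z
    using that by (simp add: fundamental_form_def b J_diff_tangent g_diff t)
  show "ext_deriv2 A (fundamental_form J g) X Y Z p = 0"
    unfolding ext_deriv2_def using a(2-4) by (simp add: der bracket)
qed

text \<open>Converts the global failure of the Kaehler condition into non-vanishing torsion at every
  single point, as the pointwise trace argument requires.\<close>

lemma not_torsion_free:
  assumes "connected (UNIV :: 'm set)" "\<not> kaehler A J g"
  shows "\<not> torsion_free_at p"
proof
  assume "torsion_free_at p"
  then have "torsion_free_at q" for q
    by (rule torsion_free_everywhere[OF assms(1)])
  then show False
    using assms(2) hermitian integrable_if_torsion_free closed_if_torsion_free
    by (simp add: kaehler_def)
qed

section \<open>The complexified curvature in terms of the real one\<close>

definition real_curvature :: "('m, 'n) field \<Rightarrow> ('m, 'n) field \<Rightarrow> ('m, 'n) field \<Rightarrow> ('m, 'n) field" where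
  "real_curvature X Y Z = covd nab X (covd nab Y Z) - covd nab Y (covd nab X Z) - covd nab (lie_bracket A X Y) Z"

lemma real_curvature_eq_R:
  assumes U: "open U" and f: "vfield A U X" "vfield A U Y" "vfield A U Z" and p: "p \<in> U"
  shows "real_curvature X Y Z p = field_algebra.R (D' U) (nab' U) (restr U X) (restr U Y) (restr U Z) p"
proof -
  interpret F: field_algebra "V U" "J' U" "G' U" "der' U" "D' U" "nab' U"
    by (rule field_algebra_V[OF U])
  have n: "nab' U (restr U X) (restr U Y) = restr U (covd nab X Y)" if "vfield A U X" "vfield A U Y" for X Y
  proof (rule V_eqI[where U = U])
    show "nab' U (restr U X) (restr U Y) q = restr U (covd nab X Y) q" if "q \<in> U" for q
      using covd_cong[OF affine_nab U, of "restr U X" "restr U Y" q X Y] that U \<open>vfield A U X\<close> \<open>vfield A U Y\<close>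
      by (simp add: nab'_at vfield_restr restr_at)
  qed (use U that in \<open>auto simp: restr_in_V vfield_covd[OF affine_nab]\<close>)
  have br: "F.br (restr U X) (restr U Y) = restr U (lie_bracket A X Y)"
  proof (rule V_eqI[where U = U])
    show "F.br (restr U X) (restr U Y) q = restr U (lie_bracket A X Y) q" if "q \<in> U" for q
      using covd_cong[OF affine_D U, of "restr U X" "restr U Y" q X Y] covd_cong[OF affine_D U, of "restr U Y" "restr U X" q Y X]
        that U f by (simp add: F.br_def D'_at vfield_restr restr_at lie_bracket_D[OF U] fun_eq_iff)
  qed (use U f in \<open>auto simp: restr_in_V vfield_lie_bracket\<close>)
  show ?thesis
    using p f by (simp add: F.R_def br n vfield_covd[OF affine_nab U] vfield_lie_bracket[OF U] real_curvature_def restr_at)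
qed

lemma covd_diff:
  assumes "open U" "vfield A U X" "vfield A U Y" "vfield A U Z" "p \<in> U"
  shows "covd nab (X - Y) Z p = covd nab X Z p - covd nab Y Z p"
    and "covd nab X (Y - Z) p = covd nab X Y p - covd nab X Z p"
  using covd_add(1)[OF affine_nab assms(1) vfield_diff[OF assms(1,2,3)] assms(3,4,5)]
    covd_add(2)[OF affine_nab assms(1,2) vfield_diff[OF assms(1,3,4)] assms(4,5)]
  by (simp_all add: eq_diff_eq)

lemma fRe_fComplex [simp]: "fRe (fComplex X Y) = X" and fIm_fComplex [simp]: "fIm (fComplex X Y) = Y"
  for X Y :: "('m, 'n) field"
  by (simp_all add: fRe_def fIm_def fComplex_def tRe_def tIm_def tComplex_def)

lemma tRe_tComplex [simp]: "tRe (tComplex u v) = u" and tIm_tComplex [simp]: "tIm (tComplex u v) = v"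
  for u v :: "('m, 'n) tvec"
  by (simp_all add: tRe_def tIm_def tComplex_def)

lemma tComplex_diff: "tComplex u v - tComplex u' v' = tComplex (u - u') (v - v')"
  for u v u' v' :: "('m, 'n) tvec"
  by (auto simp: tComplex_def fun_eq_iff vec_eq_iff complex_eq_iff)

lemma ccovd_fComplex:
  "ccovd nab (fComplex X1 X2) (fComplex Y1 Y2) =
    fComplex (covd nab X1 Y1 - covd nab X2 Y2) (covd nab X1 Y2 + covd nab X2 Y1)"
  by (simp add: ccovd_def bilinear_ext_def)

lemma clie_bracket_fComplex:
  "clie_bracket A (fComplex X1 X2) (fComplex Y1 Y2) =
    fComplex (lie_bracket A X1 Y1 - lie_bracket A X2 Y2) (lie_bracket A X1 Y2 + lie_bracket A X2 Y1)"
  by (simp add: clie_bracket_def bilinear_ext_def)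

lemma fComplex_at: "fComplex X Y p = tComplex (X p) (Y p)" for X Y :: "('m, 'n) field"
  by (simp add: fComplex_def)

lemma field_add_at: "(X + Y) p = X p + Y p" and field_diff_at: "(X - Y) p = X p - Y p"
  for X Y :: "('m, 'n) field"
  by simp_all

lemma curvature_fComplex:
  assumes U: "open U" "p \<in> U" and f: "vfield A U X1" "vfield A U X2" "vfield A U Y1" "vfield A U Y2"
    "vfield A U Z1" "vfield A U Z2"
  shows "curvature A nab (fComplex X1 X2) (fComplex Y1 Y2) (fComplex Z1 Z2) p = tComplex
    (real_curvature X1 Y1 Z1 p - real_curvature X2 Y2 Z1 p - real_curvature X1 Y2 Z2 p - real_curvature X2 Y1 Z2 p)
    (real_curvature X1 Y1 Z2 p - real_curvature X2 Y2 Z2 p + real_curvature X1 Y2 Z1 p + real_curvature X2 Y1 Z1 p)"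
proof -
  note add = covd_add[OF affine_nab U(1) _ _ _ U(2)] covd_diff[OF U(1) _ _ _ U(2)]
    vfield_covd[OF affine_nab U(1)] vfield_lie_bracket[OF U(1)] vfield_add[OF U(1)] vfield_diff[OF U(1)]
  have c: "ccovd nab (fComplex X1 X2) (ccovd nab (fComplex Y1 Y2) (fComplex Z1 Z2)) p = tComplex
     (covd nab X1 (covd nab Y1 Z1) p - covd nab X1 (covd nab Y2 Z2) p
       - (covd nab X2 (covd nab Y1 Z2) p + covd nab X2 (covd nab Y2 Z1) p))
     (covd nab X1 (covd nab Y1 Z2) p + covd nab X1 (covd nab Y2 Z1) p
       + (covd nab X2 (covd nab Y1 Z1) p - covd nab X2 (covd nab Y2 Z2) p))"
    if "vfield A U X1" "vfield A U X2" "vfield A U Y1" "vfield A U Y2" "vfield A U Z1" "vfield A U Z2"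
    for X1 X2 Y1 Y2 Z1 Z2
    by (simp only: ccovd_fComplex fComplex_at field_add_at field_diff_at add that)
  have l: "ccovd nab (clie_bracket A (fComplex X1 X2) (fComplex Y1 Y2)) (fComplex Z1 Z2) p = tComplex
     (covd nab (lie_bracket A X1 Y1) Z1 p - covd nab (lie_bracket A X2 Y2) Z1 p
       - (covd nab (lie_bracket A X1 Y2) Z2 p + covd nab (lie_bracket A X2 Y1) Z2 p))
     (covd nab (lie_bracket A X1 Y1) Z2 p - covd nab (lie_bracket A X2 Y2) Z2 p
       + (covd nab (lie_bracket A X1 Y2) Z1 p + covd nab (lie_bracket A X2 Y1) Z1 p))"
    by (simp only: ccovd_fComplex clie_bracket_fComplex fComplex_at field_add_at field_diff_at add f)
  have "curvature A nab (fComplex X1 X2) (fComplex Y1 Y2) (fComplex Z1 Z2) p =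
      ccovd nab (fComplex X1 X2) (ccovd nab (fComplex Y1 Y2) (fComplex Z1 Z2)) p
    - ccovd nab (fComplex Y1 Y2) (ccovd nab (fComplex X1 X2) (fComplex Z1 Z2)) p
    - ccovd nab (clie_bracket A (fComplex X1 X2) (fComplex Y1 Y2)) (fComplex Z1 Z2) p"
    by (simp add: curvature_def)
  then show ?thesis
    unfolding c[OF f] c[OF f(3,4,1,2,5,6)] l tComplex_diff real_curvature_def field_diff_at
    by (simp only:) (intro arg_cong2[where f = tComplex] ext; simp)
qed

lemma field_re_im: "fComplex (fRe X) (fIm X) = X" for X :: "('m, 'n) cfield"
  by (auto simp: fComplex_def fRe_def fIm_def tRe_def tIm_def tComplex_def fun_eq_iff vec_eq_iff)

text \<open>\<open>curvature4\<close> takes the two directions of differentiation last and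
  \<open>Rm\<close> takes them first, which explains the exchanged pairs. The signs are those of
  expanding a complex multilinear form in real and imaginary parts.\<close>

lemma curvature4_eq:
  assumes U: "open U" "p \<in> U" and f: "cvfield A U X" "cvfield A U Y" "cvfield A U Z" "cvfield A U W"
  defines "r \<equiv> \<lambda>X. restr U (fRe X)" and "i \<equiv> \<lambda>X. restr U (fIm X)"
    and "Rm \<equiv> \<lambda>X Y Z W. field_algebra.Rm (G' U) (D' U) (nab' U) X Y Z W p"
  shows "Re (curvature4 A g nab Z W X Y p) =
      (Rm (r X) (r Y) (r Z) (r W) - Rm (i X) (i Y) (r Z) (r W) - Rm (r X) (i Y) (i Z) (r W) - Rm (i X) (r Y) (i Z) (r W))
    - (Rm (r X) (r Y) (i Z) (i W) - Rm (i X) (i Y) (i Z) (i W) + Rm (r X) (i Y) (r Z) (i W) + Rm (i X) (r Y) (r Z) (i W))" (is ?re)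
   and "Im (curvature4 A g nab Z W X Y p) =
      (Rm (r X) (r Y) (r Z) (i W) - Rm (i X) (i Y) (r Z) (i W) - Rm (r X) (i Y) (i Z) (i W) - Rm (i X) (r Y) (i Z) (i W))
    + (Rm (r X) (r Y) (i Z) (r W) - Rm (i X) (i Y) (i Z) (r W) + Rm (r X) (i Y) (r Z) (r W) + Rm (i X) (r Y) (r Z) (r W))" (is ?im)
proof -
  interpret F: field_algebra "V U" "J' U" "G' U" "der' U" "D' U" "nab' U"
    by (rule field_algebra_V[OF U(1)])
  have v: "vfield A U (fRe X)" "vfield A U (fIm X)" "vfield A U (fRe Y)" "vfield A U (fIm Y)"
    "vfield A U (fRe Z)" "vfield A U (fIm Z)" "vfield A U (fRe W)" "vfield A U (fIm W)"
    using f by (auto simp: cvfield_def)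
  have m: "r X \<in> V U" "i X \<in> V U" "r Y \<in> V U" "i Y \<in> V U" "r Z \<in> V U" "i Z \<in> V U" "r W \<in> V U" "i W \<in> V U"
    using v U by (auto simp: r_def i_def restr_in_V)
  have R_at: "Rm P Q S B = g p (F.R P Q S p) (B p)" for P Q S B
    using U(2) by (simp add: Rm_def F.Rm_def G'_at)
  have t: "F.R P Q S p \<in> tangent A p" if "P \<in> V U" "Q \<in> V U" "S \<in> V U" for P Q S
    using that by (intro V_tangent[where U = U]) simp
  have w: "tRe (W p) = r W p" "tIm (W p) = i W p"
    using U(2) by (simp_all add: r_def i_def restr_at fRe_def fIm_def)
  have wt: "r W p \<in> tangent A p" "i W p \<in> tangent A p"
    using m by (auto intro: V_tangent)
  have "curvature A nab X Y Z p = tComplex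
     (F.R (r X) (r Y) (r Z) p - F.R (i X) (i Y) (r Z) p - F.R (r X) (i Y) (i Z) p - F.R (i X) (r Y) (i Z) p)
     (F.R (r X) (r Y) (i Z) p - F.R (i X) (i Y) (i Z) p + F.R (r X) (i Y) (r Z) p + F.R (i X) (r Y) (r Z) p)"
    using curvature_fComplex[OF U v(1-6)] real_curvature_eq_R[OF U(1) _ _ _ U(2)] v
    by (simp add: field_re_im r_def i_def)
  then have "curvature4 A g nab Z W X Y p = Complex
     (g p (F.R (r X) (r Y) (r Z) p - F.R (i X) (i Y) (r Z) p - F.R (r X) (i Y) (i Z) p - F.R (i X) (r Y) (i Z) p) (r W p)
     - g p (F.R (r X) (r Y) (i Z) p - F.R (i X) (i Y) (i Z) p + F.R (r X) (i Y) (r Z) p + F.R (i X) (r Y) (r Z) p) (i W p))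
     (g p (F.R (r X) (r Y) (r Z) p - F.R (i X) (i Y) (r Z) p - F.R (r X) (i Y) (i Z) p - F.R (i X) (r Y) (i Z) p) (i W p)
     + g p (F.R (r X) (r Y) (i Z) p - F.R (i X) (i Y) (i Z) p + F.R (r X) (i Y) (r Z) p + F.R (i X) (r Y) (r Z) p) (r W p))"
    by (simp only: curvature4_def cmetric_def tRe_tComplex tIm_tComplex w)
  then show ?re ?im
    by (simp_all add: g_diff g_add t m wt R_at)
qed

end

section \<open>Unitary frames and the trace of the curvature\<close>

text \<open>The place where three complex dimensions enter: an alternating form on three indices has
  a single component. It is applied to both real components of the (3,0)-part of the
  torsion.\<close>

lemma alternating_3_zero:
  fixes f :: "3 \<Rightarrow> 3 \<Rightarrow> 3 \<Rightarrow> real"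
  assumes a12: "\<And>i j k. f i j k = - f j i k" and a23: "\<And>i j k. f i j k = - f i k j"
    and z: "f 1 2 3 = 0"
  shows "f i j k = 0"
proof -
  have d12: "f i i k = 0" for i k using a12[of i i k] by simp
  have d23: "f k i i = 0" for i k using a23[of k i i] by simp
  have d13: "f i k i = 0" for i k using a12[of i k i] d23 by simp
  have p: "f 2 1 3 = 0" "f 1 3 2 = 0" using a12[of 2 1 3] a23[of 1 3 2] z by simp_all
  have p': "f 2 3 1 = 0" "f 3 1 2 = 0" using a23[of 2 3 1] a12[of 3 1 2] p by simp_all
  have "f 3 2 1 = 0" using a12[of 3 2 1] p' by simp
  with exhaust_3[of i] exhaust_3[of j] exhaust_3[of k] z p p' show ?thesis
    by (elim disjE) (simp_all add: d12 d23 d13)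
qed

locale framed = canonical_nearly_kaehler A J g D nab
  for A :: "('m::topological_space, 'n::finite) chart set" and J g D nab +
  fixes U :: "'m set" and e :: "'k::finite \<Rightarrow> ('m, 'n) cfield"
  assumes openU: "open U" and frame: "unitary_frame A J g U e"
begin

sublocale F: field_algebra "V U" "J' U" "G' U" "der' U" "D' U" "nab' U"
  by (rule field_algebra_V[OF openU])

text \<open>
  By \<open>Im_e\<close> the frame vectors are \<open>x l - i J (x l)\<close>, and \<open>x l\<close>, \<open>J (x l)\<close> form an orthogonal frame
  of vectors of square length 1/2.
\<close>

definition x :: "'k \<Rightarrow> ('m, 'n) field" where
  "x l = restr U (fRe (e l))"

lemma cvfield_e: "cvfield A U (e l)"
  using frame by (simp add: unitary_frame_def field10_def)

lemma x_in_V [simp]: "x l \<in> V U"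
  using cvfield_e openU by (simp add: x_def restr_in_V cvfield_def)

lemma Im_e:
  assumes "p \<in> U"
  shows "tIm (e l p) = - J p (tRe (e l p))"
proof -
  have "e l p \<in> T10 A J p" using frame assms by (simp add: unitary_frame_def field10_def)
  then have "tComplex (J p (tRe (e l p))) (J p (tIm (e l p))) = ctscale \<i> (e l p)"
    by (simp add: T10_def cendo_def)
  then have "tRe (tComplex (J p (tRe (e l p))) (J p (tIm (e l p)))) = tRe (ctscale \<i> (e l p))"
    by (rule arg_cong)
  then have "J p (tRe (e l p)) = - tIm (e l p)"
    unfolding tRe_tComplex by (simp add: tRe_def tIm_def ctscale_def fun_eq_iff vec_eq_iff)
  then show ?thesis by simp
qed

lemma x_at: "p \<in> U \<Longrightarrow> x l p = tRe (e l p)"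
  by (simp add: x_def restr_at fRe_def)

lemma restr_Im_e: "restr U (fIm (e l)) = - J' U (x l)"
proof (rule V_eqI[where U = U])
  show "restr U (fIm (e l)) \<in> V U" using cvfield_e openU by (simp add: restr_in_V cvfield_def)
  show "restr U (fIm (e l)) p = (- J' U (x l)) p" if "p \<in> U" for p
    using that by (simp add: restr_at fIm_def Im_e J'_at x_at fun_eq_iff)
qed simp

lemma tRe_fcnj: "tRe (fcnj X p) = tRe (X p)" and tIm_fcnj: "tIm (fcnj X p) = - tIm (X p)"
  for X :: "('m, 'n) cfield"
  by (simp_all add: tRe_def tIm_def fcnj_def tcnj_def fun_eq_iff vec_eq_iff)

lemma cnj_e: "fRe (fcnj (e l)) = fRe (e l)" "restr U (fIm (fcnj (e l))) = J' U (x l)"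
proof -
  show "fRe (fcnj (e l)) = fRe (e l)" by (simp add: fRe_def tRe_fcnj)
  have "restr U (fIm (fcnj (e l))) = - restr U (fIm (e l))"
    by (auto simp: restr_def fIm_def tIm_fcnj)
  then show "restr U (fIm (fcnj (e l))) = J' U (x l)" by (simp add: restr_Im_e)
qed

lemma cvfield_cnj_e: "cvfield A U (fcnj (e l))"
proof -
  have "fIm (fcnj (e l)) = - fIm (e l)" by (auto simp: fIm_def tIm_fcnj)
  then show ?thesis
    using cvfield_e[of l] openU by (simp add: cvfield_def cnj_e vfield_uminus)
qed

text \<open>The product of x_i - iJx_i with x_j + iJx_j is 2 g(x_i, x_j) - 2i g(Jx_i, x_j);
  unitarity is read off from its two parts.\<close>

lemma frame_orthonormal:
  assumes "p \<in> U"
  shows "g p (x i p) (x j p) = (if i = j then 1 / 2 else 0)"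
    and "g p (J p (x i p)) (x j p) = 0"
proof -
  have t: "x l p \<in> tangent A p" for l by (rule V_tangent[OF x_in_V])
  have im: "tIm (e l p) = - J p (x l p)" for l using Im_e assms by (simp add: x_at)
  have "cmetric g p (e i p) (fcnj (e j) p) = (if i = j then 1 else 0)"
    using frame assms by (simp add: unitary_frame_def)
  then have "Complex (g p (x i p) (x j p) - g p (- J p (x i p)) (J p (x j p)))
     (g p (x i p) (J p (x j p)) + g p (- J p (x i p)) (x j p)) = (if i = j then 1 else 0)"
    by (simp add: cmetric_def tRe_fcnj tIm_fcnj im flip: x_at[OF assms])
  moreover have "g p (x i p) (J p (x j p)) = - g p (J p (x i p)) (x j p)"
    using g_J_skew[OF t t, of j i] g_sym[OF t J_tangent[OF t], of i j] by simp
  ultimately show "g p (x i p) (x j p) = (if i = j then 1 / 2 else 0)"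
    "g p (J p (x i p)) (x j p) = 0"
    using t by (auto simp: g_minus g_J complex_eq_iff split: if_splits)
qed

lemma tRe_sum: "tRe (\<Sum>i\<in>I. z i) = (\<Sum>i\<in>I. tRe (z i))" if "finite I"
  for z :: "'k \<Rightarrow> ('m, 'n) ctvec"
  using that by induction (auto simp: tRe_def fun_eq_iff vec_eq_iff)

text \<open>The real vector v is the real part of v - iJv, which is of type (1,0); the real part of
  (\<alpha> + i\<beta>)(x - iJx) is \<alpha>x + \<beta>Jx.\<close>

lemma frame_span:
  assumes "p \<in> U" "v \<in> tangent A p"
  obtains \<alpha> \<beta> where "v = (\<Sum>l\<in>UNIV. tscale (\<alpha> l) (x l p)) + (\<Sum>l\<in>UNIV. tscale (\<beta> l) (J p (x l p)))"
proof -
  have "cendo J p (tComplex v (- J p v)) = tComplex (J p v) v"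
    using assms by (simp add: cendo_def J_uminus)
  also have "\<dots> = ctscale \<i> (tComplex v (- J p v))"
    by (auto simp: ctscale_def tComplex_def fun_eq_iff vec_eq_iff complex_eq_iff)
  finally have "tComplex v (- J p v) \<in> T10 A J p"
    using assms by (simp add: T10_def ctangent_def)
  then obtain a where "tComplex v (- J p v) = (\<Sum>i\<in>UNIV. ctscale (a i) (e i p))"
    using frame assms(1) unfolding unitary_frame_def by blast
  then have "tRe (tComplex v (- J p v)) = (\<Sum>i\<in>UNIV. tRe (ctscale (a i) (e i p)))"
    by (simp add: tRe_sum)
  moreover have "tRe (ctscale (a i) (e i p)) = tscale (Re (a i)) (x i p) + tscale (Im (a i)) (J p (x i p))" for i
  proof -
    have "tRe (ctscale (a i) (e i p)) = tscale (Re (a i)) (tRe (e i p)) + tscale (- Im (a i)) (tIm (e i p))"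
      by (auto simp: tRe_def tIm_def ctscale_def tscale_def fun_eq_iff vec_eq_iff)
    then show ?thesis using assms(1) by (simp add: Im_e x_at) (simp add: tscale_def fun_eq_iff)
  qed
  ultimately have "v = (\<Sum>l\<in>UNIV. tscale (Re (a l)) (x l p)) + (\<Sum>l\<in>UNIV. tscale (Im (a l)) (J p (x l p)))"
    by (simp add: sum.distrib)
  then show thesis by (rule that)
qed

text \<open>The factor 2 is the reciprocal of the square length of the frame vectors.\<close>

lemma g_frame_expansion:
  assumes p: "p \<in> U" and vw: "v \<in> tangent A p" "w \<in> tangent A p"
  shows "g p v w = (\<Sum>l\<in>UNIV. 2 * g p v (x l p) * g p (x l p) w + 2 * g p v (J p (x l p)) * g p (J p (x l p)) w)"
proof -
  have t: "x l p \<in> tangent A p" for l by (rule V_tangent[OF x_in_V])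
  obtain \<alpha> \<beta> where v: "v = (\<Sum>l\<in>UNIV. tscale (\<alpha> l) (x l p)) + (\<Sum>l\<in>UNIV. tscale (\<beta> l) (J p (x l p)))"
    by (rule frame_span[OF p vw(1)])
  have g: "g p v u = (\<Sum>l\<in>UNIV. \<alpha> l * g p (x l p) u) + (\<Sum>l\<in>UNIV. \<beta> l * g p (J p (x l p)) u)"
    if "u \<in> tangent A p" for u
    using that t g_sum[of "UNIV :: 'k set" "\<lambda>l. x l p" p u \<alpha>]
      g_sum[of "UNIV :: 'k set" "\<lambda>l. J p (x l p)" p u \<beta>] by (simp add: v g_add)
  have o: "g p (x i p) (J p (x j p)) = 0" for i j
    using frame_orthonormal(2)[OF p, of j i] g_sym[OF t J_tangent[OF t], of i j] by simp
  have coeff: "g p v (x m p) = \<alpha> m / 2" "g p v (J p (x m p)) = \<beta> m / 2" for m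
    using t by (simp_all add: g frame_orthonormal[OF p] o g_J sum.delta' if_distrib[of "(*) _"] cong: if_cong)
  show ?thesis unfolding g[OF vw(2)] coeff by (simp add: sum.distrib)
qed

text \<open>
  The skew-symmetry of \<open>t\<close> is what makes it depend on \<open>W\<close> only through the value at \<open>p\<close>.
\<close>

lemma t_frame_expansion:
  assumes p: "p \<in> U" and W: "W \<in> V U" "B \<in> V U" "C \<in> V U"
  shows "F.t W B C p = (\<Sum>l\<in>UNIV. 2 * G' U W (x l) p * F.t (x l) B C p
    + 2 * G' U W (J' U (x l)) p * F.t (J' U (x l)) B C p)"
proof -
  have "F.t W B C p = g p (W p) (F.T B C p)" if "W \<in> V U" for W
    using F.t_cyclic[of W B C p] W that p F.G_T_left[of B C W p] by (simp add: G'_at)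
  then show ?thesis
    using g_frame_expansion[OF p V_tangent[OF W(1)] V_tangent[OF F.V_T[OF W(2,3)]]] p
    by (simp add: W G'_at J'_at)
qed

text \<open>J may be moved between the arguments of \<open>t\<close> up to sign, and its square is
  -1; so every component in the real frame reduces to one with no J or with a single J in
  front.\<close>

lemma torsion_free_at_frame:
  assumes p: "p \<in> U" and z: "\<And>i j k. F.t (x i) (x j) (x k) p = 0" "\<And>i j k. F.t (J' U (x i)) (x j) (x k) p = 0"
  shows "torsion_free_at p"
proof -
  define B where "B = (\<lambda>(l, b). if b then J' U (x l) else x l)"
  have B: "B s \<in> V U" for s by (simp add: B_def split: prod.split)
  show ?thesis
  proof (rule torsion_free_atI[OF openU p finite[of UNIV], of B])
    show "vfield A U (B s)" for s using B by (rule V_vfield)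
    show "\<exists>a. v = (\<Sum>s\<in>UNIV. tscale (a s) (B s p))" if v: "v \<in> tangent A p" for v
    proof -
      obtain \<alpha> \<beta> where v: "v = (\<Sum>l\<in>UNIV. tscale (\<alpha> l) (x l p)) + (\<Sum>l\<in>UNIV. tscale (\<beta> l) (J p (x l p)))"
        by (rule frame_span[OF p v])
      have "v = (\<Sum>s\<in>UNIV \<times> UNIV. tscale ((\<lambda>(l, b). if b then \<beta> l else \<alpha> l) s) (B s p))"
        unfolding sum.cartesian_product' v
        by (simp add: UNIV_bool B_def J'_at p sum.distrib add.commute)
      then show ?thesis
        unfolding UNIV_Times_UNIV by (intro exI[of _ "\<lambda>(l, b). if b then \<beta> l else \<alpha> l"])
    qed
    show "tor (B s1) (B s2) (B s3) p = 0" for s1 s2 s3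
    proof -
      have minus: "F.t B (- C) E p = - F.t B C E p" if "B \<in> V U" "C \<in> V U" "E \<in> V U" for B C E
        using that by (simp add: F.t_def)
      have z2: "F.t (x i) (J' U (x j)) (x k) p = 0" for i j k
        using F.t_J_left[of "x i" "x j" "x k" p] z(2)[of i j k] by simp
      obtain i1 b1 i2 b2 i3 b3 where s: "s1 = (i1, b1)" "s2 = (i2, b2)" "s3 = (i3, b3)"
        by (cases s1; cases s2; cases s3)
      have "F.t (B s1) (B s2) (B s3) p = 0"
        unfolding s B_def prod.case
        by (cases b1; cases b2; cases b3)
          (simp_all add: z(1) z2 minus F.t_J_left flip: F.t_J_right)
      then show ?thesis
        using tor_eq_t[OF openU V_vfield[OF B] V_vfield[OF B] p, of s1 s2 "B s3"] B
        by (simp add: V_def)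
    qed
  qed
qed

end

locale framed3 = framed A J g D nab U e
  for A :: "('m::topological_space, 'n::finite) chart set" and J g D nab U and e :: "3 \<Rightarrow> ('m, 'n) cfield" +
  assumes connected: "connected (UNIV :: 'm set)" and not_kaehler: "\<not> kaehler A J g"
begin

text \<open>The (3,0)-part of \<open>t\<close> is a volume form with coefficient proportional to t0
  - i s. The curvature annihilates it and multiplies it by its trace, here written with the real
  numbers \<open>\<rho> l\<close>, so both real components times the trace vanish.\<close>

lemma trace_R:
  assumes p: "p \<in> U" and X: "X \<in> V U" "Y \<in> V U"
  shows "(\<Sum>l\<in>UNIV. F.Rm X Y (J' U (x l)) (x l) p) = 0"
proof -
  let ?J = "J' U"
  have d12: "F.t B B C p = 0" if "B \<in> V U" "C \<in> V U" for B C
    using F.t_skew12[of B B C p] that by simp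
  have d23: "F.t C B B p = 0" if "B \<in> V U" "C \<in> V U" for B C
    using F.t_skew23[of C B B p] that by simp
  have d13: "F.t B C B p = 0" if "B \<in> V U" "C \<in> V U" for B C
    using F.t_skew12[of B C B p] d23[of B C] that by simp
  \<comment> \<open>\<open>t\<close> also vanishes when two arguments lie in one complex line, as
    its type permits J to be moved away.\<close>
  have dJ12: "F.t (?J B) B C p = 0" "F.t B (?J B) C p = 0" if "B \<in> V U" "C \<in> V U" for B C
    using F.t_skew12[of B "?J B" C p] F.t_J_left[of B B C p] that by simp_all
  have dJ13: "F.t (?J B) C B p = 0" "F.t B C (?J B) p = 0" if "B \<in> V U" "C \<in> V U" for B C
    using F.t_J_left[of B C B p] F.t_J_right[of B C B p] d13[of B "?J C"] that by simp_all
  note diag = d12 d23 d13 dJ12 dJ13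
  define \<rho> where "\<rho> l = F.Rm X Y (?J (x l)) (x l) p" for l
  define R where "R l = F.R X Y (x l)" for l
  \<comment> \<open>t(e_1, e_2, e_3) = 4 (t0 - i s) for the complex frame.\<close>
  define t0 where "t0 = F.t (x 1) (x 2) (x 3) p"
  define s where "s = F.t (?J (x 1)) (x 2) (x 3) p"
  have R: "R l \<in> V U" for l using X by (simp add: R_def)
  have GR: "G' U (R l) (x l) p = 0" "G' U (R l) (?J (x l)) p = - \<rho> l" for l
    using F.Rm_skew34[of X Y "x l" "x l" p] X F.Rm_J[of X Y "x l" "x l"]
    by (simp_all add: R_def \<rho>_def F.Rm_def)
  \<comment> \<open>If B and C span the other two complex lines, only the component of
    \<open>R a\<close> in the line of \<open>x a\<close> contributes. Its part along
    \<open>x a\<close> is zero by skewness, and 2 comes from the frame expansion.\<close>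
  have col: "F.t (R a) B C p = - 2 * \<rho> a * F.t (?J (x a)) B C p"
    if "B \<in> V U" "C \<in> V U" "\<forall>m. m \<noteq> a \<longrightarrow> F.t (x m) B C p = 0 \<and> F.t (?J (x m)) B C p = 0" for a B C
  proof -
    have "F.t (R a) B C p = (\<Sum>l\<in>UNIV. if l = a then - 2 * \<rho> a * F.t (?J (x a)) B C p else 0)"
      unfolding t_frame_expansion[OF p R that(1,2)] using that(3) by (intro sum.cong) (auto simp: GR)
    then show ?thesis by simp
  qed
  have "F.t (R 1) (x 2) (x 3) p = - 2 * \<rho> 1 * s"
    unfolding s_def by (rule col) (simp_all add: forall_3 diag)
  moreover have "F.t (x 1) (R 2) (x 3) p = - 2 * \<rho> 2 * s"
  proof -
    have "F.t (x 1) (R 2) (x 3) p = F.t (R 2) (x 3) (x 1) p"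
      using R by (intro F.t_cyclic) auto
    also have "\<dots> = - 2 * \<rho> 2 * F.t (?J (x 2)) (x 3) (x 1) p"
      by (rule col) (simp_all add: forall_3 diag)
    also have "F.t (?J (x 2)) (x 3) (x 1) p = s"
      using F.t_J_left[of "x 2" "x 3" "x 1" p] F.t_J_right[of "x 2" "x 3" "x 1" p]
        F.t_cyclic[of "?J (x 1)" "x 2" "x 3" p] by (simp add: s_def)
    finally show ?thesis .
  qed
  moreover have "F.t (x 1) (x 2) (R 3) p = - 2 * \<rho> 3 * s"
  proof -
    have "F.t (x 1) (x 2) (R 3) p = F.t (R 3) (x 1) (x 2) p"
      using R F.t_cyclic[of "R 3" "x 1" "x 2" p] by simp
    also have "\<dots> = - 2 * \<rho> 3 * F.t (?J (x 3)) (x 1) (x 2) p"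
      by (rule col) (simp_all add: forall_3 diag)
    also have "F.t (?J (x 3)) (x 1) (x 2) p = s"
      using F.t_J_left[of "x 3" "x 1" "x 2" p] F.t_cyclic[of "x 3" "?J (x 1)" "x 2" p] by (simp add: s_def)
    finally show ?thesis .
  qed
  ultimately have "(\<rho> 1 + \<rho> 2 + \<rho> 3) * s = 0"
    using F.R_t[of X Y "x 1" "x 2" "x 3" p] X by (simp add: R_def algebra_simps)
  \<comment> \<open>The same derivation identity with J applied to the first frame vector, which
    exchanges the roles of \<open>s\<close> and \<open>t0\<close>; it covers points where
    \<open>s\<close> is zero.\<close>
  moreover have "(\<rho> 1 + \<rho> 2 + \<rho> 3) * t0 = 0"
  proof -
    have "F.t (F.R X Y (?J (x 1))) (x 2) (x 3) p = F.t (R 1) (?J (x 2)) (x 3) p"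
      using X R F.t_J_left[of "R 1" "x 2" "x 3" p] by (simp add: R_def F.R_J)
    also have "\<dots> = - 2 * \<rho> 1 * F.t (?J (x 1)) (?J (x 2)) (x 3) p"
      by (rule col) (simp_all add: forall_3 diag)
    also have "F.t (?J (x 1)) (?J (x 2)) (x 3) p = - t0"
      using F.t_J_left[of "x 1" "?J (x 2)" "x 3" p] by (simp add: t0_def F.t_def)
    finally have 1: "F.t (F.R X Y (?J (x 1))) (x 2) (x 3) p = 2 * \<rho> 1 * t0" by simp
    have "F.t (?J (x 1)) (R 2) (x 3) p = F.t (R 2) (x 3) (?J (x 1)) p"
      using R by (intro F.t_cyclic) auto
    also have "\<dots> = - 2 * \<rho> 2 * F.t (?J (x 2)) (x 3) (?J (x 1)) p"
      by (rule col) (simp_all add: forall_3 diag)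
    also have "F.t (?J (x 2)) (x 3) (?J (x 1)) p = - t0"
      using F.t_J_right[of "?J (x 2)" "x 3" "x 1" p] F.t_J_left[of "x 2" "?J (x 3)" "x 1" p]
        F.t_cyclic[of "x 1" "x 2" "x 3" p] by (simp add: t0_def F.t_def)
    finally have 2: "F.t (?J (x 1)) (R 2) (x 3) p = 2 * \<rho> 2 * t0" by simp
    have "F.t (?J (x 1)) (x 2) (R 3) p = F.t (R 3) (?J (x 1)) (x 2) p"
      using R F.t_cyclic[of "R 3" "?J (x 1)" "x 2" p] by simp
    also have "\<dots> = - 2 * \<rho> 3 * F.t (?J (x 3)) (?J (x 1)) (x 2) p"
      by (rule col) (simp_all add: forall_3 diag)
    also have "F.t (?J (x 3)) (?J (x 1)) (x 2) p = - t0"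
      using F.t_J_left[of "x 3" "?J (x 1)" "x 2" p] F.t_cyclic[of "x 3" "x 1" "x 2" p]
      by (simp add: t0_def F.t_def)
    finally have 3: "F.t (?J (x 1)) (x 2) (R 3) p = 2 * \<rho> 3 * t0" by simp
    show ?thesis
      using F.R_t[of X Y "?J (x 1)" "x 2" "x 3" p] X 1 2 3 by (simp add: R_def algebra_simps)
  qed
  \<comment> \<open>Otherwise the 3-form, and with it the torsion, would vanish at p.\<close>
  moreover have "s \<noteq> 0 \<or> t0 \<noteq> 0"
  proof (rule ccontr)
    assume "\<not> (s \<noteq> 0 \<or> t0 \<noteq> 0)"
    then have z: "s = 0" "t0 = 0" by auto
    have "F.t (x i) (x j) (x k) p = 0" for i j k
      by (rule alternating_3_zero[of "\<lambda>i j k. F.t (x i) (x j) (x k) p"])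
        (use z in \<open>auto simp: t0_def intro: F.t_skew12 F.t_skew23\<close>)
    moreover have "F.t (?J (x i)) (x j) (x k) p = 0" for i j k
    proof (rule alternating_3_zero[of "\<lambda>i j k. F.t (?J (x i)) (x j) (x k) p"])
      show "F.t (?J (x i)) (x j) (x k) p = - F.t (?J (x j)) (x i) (x k) p" for i j k
        using F.t_J_left[of "x i" "x j" "x k" p] F.t_skew12[of "x i" "?J (x j)" "x k" p] by simp
      show "F.t (?J (x i)) (x j) (x k) p = - F.t (?J (x i)) (x k) (x j) p" for i j k
        by (rule F.t_skew23) auto
    qed (use z in \<open>simp add: s_def\<close>)
    ultimately have "torsion_free_at p" by (rule torsion_free_at_frame[OF p])
    then show False using not_torsion_free[OF connected not_kaehler] by blast
  qed
  ultimately have "\<rho> 1 + \<rho> 2 + \<rho> 3 = 0" by auto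
  then show ?thesis by (simp add: \<rho>_def sum_3)
qed

text \<open>These are the sums in the second Ricci curvature, where the frame index runs over the
  directions of differentiation; pair symmetry reduces them to \<open>trace_R\<close>.\<close>

lemma trace_R':
  assumes "p \<in> U" "X \<in> V U" "Y \<in> V U"
  shows "(\<Sum>l\<in>UNIV. F.Rm (J' U (x l)) (x l) X Y p) = 0"
    and "(\<Sum>l\<in>UNIV. F.Rm (x l) (J' U (x l)) X Y p) = 0"
proof -
  show *: "(\<Sum>l\<in>UNIV. F.Rm (J' U (x l)) (x l) X Y p) = 0"
    using trace_R[OF assms] assms by (simp add: F.Rm_pair[of _ _ X Y])
  have "F.Rm (x l) (J' U (x l)) X Y p = - F.Rm (J' U (x l)) (x l) X Y p" for l
    using assms by (intro F.Rm_skew12) auto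
  then show "(\<Sum>l\<in>UNIV. F.Rm (x l) (J' U (x l)) X Y p) = 0"
    using * by (simp add: sum_negf)
qed

lemma ricci_zero:
  assumes p: "p \<in> U"
  shows "ricci1 A g nab e i j p = 0" and "ricci2 A g nab e i j p = 0"
proof -
  let ?J = "J' U"
  \<comment> \<open>In the first Ricci sum the frame index sits in the last two slots of
    \<open>Rm\<close>: repeated entries drop out and the mixed ones agree up to sign, which leaves
    multiples of the trace. \<open>d2\<close> does the same for the first two slots in the second
    sum.\<close>
  have d1: "F.Rm X Y (x l) (x l) p = 0" "F.Rm X Y (?J (x l)) (?J (x l)) p = 0"
      "F.Rm X Y (x l) (?J (x l)) p = - F.Rm X Y (?J (x l)) (x l) p"
    if "X \<in> V U" "Y \<in> V U" for X Y l
    using F.Rm_skew34[of X Y "x l" "x l" p] that by simp_all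
  have d2: "F.Rm B B X Y p = 0" if "X \<in> V U" "Y \<in> V U" "B \<in> V U" for X Y B
    using F.Rm_skew12[of B B X Y p] that by simp
  note c1 = curvature4_eq[OF openU p cvfield_e[of i] cvfield_cnj_e[of j] cvfield_e cvfield_cnj_e,
      unfolded cnj_e restr_Im_e, folded x_def]
  note c2 = curvature4_eq[OF openU p cvfield_e cvfield_cnj_e cvfield_e[of i] cvfield_cnj_e[of j],
      unfolded cnj_e restr_Im_e, folded x_def]
  show "ricci1 A g nab e i j p = 0"
    unfolding ricci1_def complex_eq_iff Re_sum Im_sum c1
    by (simp add: d1 del: F.Rm_J) (simp add: sum.distrib sum_negf sum_subtractf trace_R p flip: sum_distrib_left)
  show "ricci2 A g nab e i j p = 0"
    unfolding ricci2_def complex_eq_iff Re_sum Im_sum c2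
    by (simp add: d2 del: F.Rm_J) (simp add: sum.distrib sum_negf sum_subtractf trace_R' p flip: sum_distrib_left)
qed

end

theorem theorem1p4:
  fixes A :: "('m::{t2_space, second_countable_topology}, 6) chart set"
    and J :: "('m, 6) endo"
    and g :: "('m, 6) form2"
    and nab :: "('m, 6) conn"
    and U :: "'m set"
    and e :: "3 \<Rightarrow> ('m, 6) cfield"
  assumes "connected (UNIV :: 'm set)"
    and "strictly_nearly_kaehler A J g"
    and "canonical_connection A J g nab"
    and "open U"
    and "unitary_frame A J g U e"
  shows "\<forall>i j. \<forall>p\<in>U. ricci1 A g nab e i j p = 0 \<and> ricci2 A g nab e i j p = 0"
proof -
  obtain D where D: "almost_hermitian A J g" "levi_civita A g D"
    "\<And>U X p. open U \<Longrightarrow> vfield A U X \<Longrightarrow> p \<in> U \<Longrightarrow> cov_endo D J X X p = 0"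
    and nk: "\<not> kaehler A J g"
    using assms(2) unfolding strictly_nearly_kaehler_def nearly_kaehler_def by blast
  interpret framed3 A J g D nab U e
    by unfold_locales (use assms D nk in \<open>auto simp: almost_hermitian_def\<close>)
  show ?thesis using ricci_zero by blast
qed

end
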